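(* Let $S=\{(\mathbf{a},\mathbf{b})\in\mathbb{R}^{p+q}:\mathbf{a}\ge0,\ \mu>0\}$, where $\mu=\mu(\mathbf{a},\mathbf{b})=\sum_{j=1}^qb_j-\sum_{k=1}^pa_k+\frac{p-q}{2}$. Suppose $\sum_{j=1}^qB_j-\sum_{k=1}^pA_k=0$ and let $(\mathbf{a}^*,\mathbf{b}^* )=(a_1^*,\dots,a_p^*,b_1^*,\dots,b_q^* )$ be a limit point of $S$ with $\mu^*=\sum_{j=1}^qb_j^*-\sum_{k=1}^pa_k^*+\frac{p-q}{2}=0$. Then the signed measures $$dv_{(\mathbf{a},\mathbf{b})}(x)=H_{q,p}^{p,0}\left(x \,\middle|\, \begin{array}{c}(\mathbf{B},\mathbf{b})\\(\mathbf{A},\mathbf{a})\end{array}\right)dx$$ converge weakly on every interval $[\eta,\rho]$, $0\le\eta<\rho$, to the signed measure $$dv_*(x)=\nu^*\rho\,\delta_\rho(x)+H_{q,p}^{p,0}\left(x \,\middle|\, \begin{array}{c}(\mathbf{B},\mathbf{b}^* )\\(\mathbf{A},\mathbf{a}^* )\end{array}\right)dx$$ as $S\ni(\mathbf{a},\mathbf{b})\to(\mathbf{a}^*,\mathbf{b}^* )$, where $\nu^*=(2\pi)^{(p-q)/2}\prod_{k=1}^pA_k^{a_k^*-1/2}\prod_{j=1}^qB_j^{1/2-b_j^*}$ and $\delta_\rho$ is the unit point mass at $\rho$.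
   Context: Let $p,q\in\mathbb{N}$ and fix $\mathbf{A}=(A_1,\dots,A_p)$, $\mathbf{B}=(B_1,\dots,B_q)$ with positive entries; $\mathbf{a}\ge0$ means all $a_k\ge0$. Let $\rho=\prod_{k=1}^pA_k^{A_k}\prod_{j=1}^qB_j^{-B_j}$. For real vectors $\mathbf{a}\in\mathbb{R}^p$, $\mathbf{b}\in\mathbb{R}^q$ and $0<x<\rho$, Fox's H function is $$H_{q,p}^{p,0}\left(x \,\middle|\, \begin{array}{c}(\mathbf{B},\mathbf{b})\\(\mathbf{A},\mathbf{a})\end{array}\right)=\frac{1}{2\pi i}\int_{\mathcal{L}_{-\infty}}\frac{\prod_{k=1}^p\Gamma(A_ks+a_k)}{\prod_{j=1}^q\Gamma(B_js+b_j)}x^{-s}\,ds,$$ where $\mathcal{L}_{-\infty}$ is a loop lying in a horizontal strip, starting at $-\infty+i\varphi_1$ and ending at $-\infty+i\varphi_2$ ($\varphi_1<\varphi_2$), leaving all poles of the integrand on its left. Weak convergence: signed measures $dv_{\mathbf{c}}$ on $[\alpha,\beta]$, indexed by $\mathbf{c}\in S$, converge weakly to $dv_0$ as $S\ni\mathbf{c}\to\mathbf{c}_0$ ($\mathbf{c}_0$ a limit point of $S$) if for every continuous $f$ on $[\alpha,\beta]$, $\lim_{S\ni\mathbf{c}\to\mathbf{c}_0}\int_\alpha^\beta f\,dv_{\mathbf{c}}=\int_\alpha^\beta f\,dv_0$, the limit being independent of the path. On $[\eta,\rho]$ the measures are restricted to that interval. *)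

theory Defs
  imports "HOL-Complex_Analysis.Complex_Analysis"
begin

definition fox_rho :: "real^'p \<Rightarrow> real^'q \<Rightarrow> real" where
  "fox_rho A B = (\<Prod>k\<in>UNIV. A$k powr A$k) * (\<Prod>j\<in>UNIV. B$j powr (- B$j))"

definition fox_mu :: "real^'p \<Rightarrow> real^'q \<Rightarrow> real" where
  "fox_mu a b = (\<Sum>j\<in>UNIV. b$j) - (\<Sum>k\<in>UNIV. a$k) + (real CARD('p) - real CARD('q)) / 2"

definition fox_nu :: "real^'p \<Rightarrow> real^'q \<Rightarrow> real^'p \<Rightarrow> real^'q \<Rightarrow> real" where
  "fox_nu A B a b = (2*pi) powr ((real CARD('p) - real CARD('q)) / 2)
      * (\<Prod>k\<in>UNIV. A$k powr (a$k - 1/2)) * (\<Prod>j\<in>UNIV. B$j powr (1/2 - b$j))"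

definition fox_integrand ::
  "real^'p \<Rightarrow> real^'q \<Rightarrow> real^'p \<Rightarrow> real^'q \<Rightarrow> real \<Rightarrow> complex \<Rightarrow> complex" where
  "fox_integrand A B a b x s =
     (\<Prod>k\<in>UNIV. Gamma (of_real (A$k) * s + of_real (a$k)))
   * (\<Prod>j\<in>UNIV. rGamma (of_real (B$j) * s + of_real (b$j)))
   * (of_real x) powr (- s)"

text \<open>Abscissa to the right of all poles -(a_k+n)/A_k of the integrand.\<close>
definition fox_c :: "real^'p \<Rightarrow> real^'p \<Rightarrow> real" where
  "fox_c A a = 1 + (\<Sum>k\<in>UNIV. \<bar>a$k\<bar> / A$k)"

text \<open>Truncated loop: from -R - i to c - i, up to c + i, back to -R + i
  (a loop of type L_{-infinity} with phi1 = -1, phi2 = 1, truncated at Re s = -R).\<close>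
definition fox_loop :: "real \<Rightarrow> real \<Rightarrow> real \<Rightarrow> complex" where
  "fox_loop c R =
     linepath (Complex (-R) (-1)) (Complex c (-1)) +++
     linepath (Complex c (-1)) (Complex c 1) +++
     linepath (Complex c 1) (Complex (-R) 1)"

text \<open>Fox's H function H^{p,0}_{q,p}(x | (B,b); (A,a)), the loop integral over L_{-infinity}
  taken as the limit of the truncated loops.\<close>
definition fox_H :: "real^'p \<Rightarrow> real^'q \<Rightarrow> real^'p \<Rightarrow> real^'q \<Rightarrow> real \<Rightarrow> complex" where
  "fox_H A B a b x =
     Lim at_top (\<lambda>R. contour_integral (fox_loop (fox_c A a) R) (fox_integrand A B a b x))
     / (2 * of_real pi * \<i>)"

end

theory Submission
  imports Defs "HOL-Probability.Sinc_Integral" "HOL-Real_Asymp.Real_Asymp"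
begin

text \<open>
  Write \<open>G(s)\<close> for the quotient of Gamma products in the integrand. Stirling's formula with one
  correction term gives \<open>G(s) = \<nu> \<rho>\<^sup>s s\<^bsup>-\<mu>\<^esup> (1 + \<gamma>/s + O(1/(Im s)\<^sup>2))\<close> for \<open>\<bar>Im s\<bar> \<ge> 1\<close>, uniformly for bounded
  parameters. The beta factor \<open>\<Gamma>(s+1)/\<Gamma>(s+1+\<mu>)\<close> has the same leading behaviour \<open>s\<^bsup>-\<mu>\<^esup>\<close>, so a combination of
  the beta factors for \<open>\<mu>\<close> and \<open>\<mu>+1\<close>, multiplied by \<open>\<nu> \<rho>\<^sup>s\<close>, matches \<open>G\<close> up to a remainder of order
  \<open>\<rho>\<^sup>s/(Im s)\<^sup>2\<close>.

  The loop integrals of the beta factors are sums of residues, that is, binomial series: with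
  \<open>y = x/\<rho>\<close> they equal \<open>y (1-y)\<^bsup>\<mu>-1\<^esup>/\<Gamma>(\<mu>)\<close> and \<open>y (1-y)\<^bsup>\<mu>\<^esup>/\<Gamma>(\<mu>+1)\<close>. As \<open>\<mu>\<close> tends to 0 the first
  concentrates at \<open>y = 1\<close> and produces the point mass, while it vanishes identically for
  \<open>\<mu> = 0\<close>. The loop integral of the remainder can be moved to the line \<open>Re s = 1/2\<close>, where it converges
  absolutely; it depends continuously on the parameters and is bounded by a multiple of
  \<open>x\<^bsup>-1/2\<^esup>\<close>, so dominated convergence applies.
\<close>

section \<open>Stirling's formula off the real axis\<close>

text \<open>The loop runs to the left along Im s = -1 and Im s = 1, hugging the negative axis, where
  Stirling's formula in a sector does not reach. The version proved here holds for all z with |Im z|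
  \<ge> \<delta>, whatever the real part; the price is an error measured in \<open>Im z\<close>
  instead of \<open>norm z\<close>.

  One beta factor would not be enough: at \<mu> = 0 the difference would decay only like 1/s, which
  is not absolutely integrable on a vertical line. The second factor removes this term, and its
  density stays bounded as \<mu> tends to 0, so it does not concentrate.

  Since the a_k are nonnegative, all poles lie on the nonpositive real axis. The complement of this
  axis is starlike, so every integrand has a primitive there, and deforming a loop amounts to
  estimating differences of values of the primitive. Only the residue sums need a closed contour
  that crosses the axis.

  Working with \<open>rGamma\<close> instead of dividing by \<open>Gamma\<close> makes \<mu> = 0 a
  regular value of all formulas, so that the limit parameters and the approaching ones share one
  decomposition.\<close>

text \<open>A real shift keeps the imaginary part, so the shifted point still has norm at least
  \<delta>, and a shift of size M costs at most the factor M/\<delta>. No cancellation between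
  \<open>Re z\<close> and u can spoil this.\<close>

lemma norm_add_real_ge:
  fixes z :: complex
  assumes "\<delta> > 0" "\<bar>Im z\<bar> \<ge> \<delta>" "\<bar>u\<bar> \<le> M"
  shows "norm z \<le> (1 + M/\<delta>) * norm (z + of_real u)"
proof -
  have *: "norm (z + of_real u) \<ge> \<delta>"
    using abs_Im_le_cmod[of "z + of_real u"] assms by simp
  have "norm z \<le> norm (z + of_real u) + \<bar>u\<bar>"
    using norm_triangle_ineq4[of "z + of_real u" "of_real u"] by simp
  also have "\<dots> \<le> norm (z + of_real u) + M / \<delta> * norm (z + of_real u)"
    using mult_mono[of "\<bar>u\<bar>" M 1 "norm (z + of_real u) / \<delta>"] * assms by simp
  finally show ?thesis by (simp add: algebra_simps)
qed

text \<open>Taylor's theorem on the horizontal segment from \<open>z\<close> to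
  \<open>z + of_real a\<close>, which cannot meet the branch cut because Im is constant and nonzero
  on it. The power series of ln (1 + w) at w = a/z would require |a| < \<open>norm z\<close>, which
  need not hold here.\<close>

lemma Ln_add_real_taylor:
  fixes z :: complex
  assumes d: "\<delta> > 0" "\<bar>Im z\<bar> \<ge> \<delta>" "\<bar>a\<bar> \<le> M"
  shows "norm (Ln (z + of_real a) - Ln z - (\<Sum>k=1..n. (-1)^(k-1) * (of_real a / z)^k / of_nat k))
           \<le> ((1 + M/\<delta>) * \<bar>a\<bar> / norm z) ^ Suc n"
proof -
  \<comment> \<open>The successive derivatives of \<open>Ln\<close>, with \<open>Ln\<close> itself
    as number 0.\<close>
  define f :: "nat \<Rightarrow> complex \<Rightarrow> complex"
    where "f i v = (if i = 0 then Ln v else (-1)^(i-1) * fact (i-1) / v^i)" for i v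
  define S where "S = closed_segment z (z + of_real a)"
  have S: "\<exists>u. v = z + of_real u \<and> \<bar>u\<bar> \<le> M" if "v \<in> S" for v
  proof -
    from that[unfolded S_def in_segment] obtain t
      where t: "0 \<le> t" "t \<le> 1" "v = (1 - t) *\<^sub>R z + t *\<^sub>R (z + of_real a)" by (elim exE conjE)
    have "v = z + of_real (t * a)" unfolding t(3) by (simp add: scaleR_conv_of_real algebra_simps)
    moreover have "\<bar>t * a\<bar> \<le> M" using mult_mono[OF t(2) d(3)] t(1) by (simp add: abs_mult)
    ultimately show ?thesis by blast
  qed
  have Imv: "\<bar>Im v\<bar> \<ge> \<delta>" if "v \<in> S" for v using S[OF that] d by auto
  have z0: "norm z > 0" using d by auto
  have M: "M \<ge> 0" using d by simp
  have "norm (f 0 (z + of_real a) - (\<Sum>i\<le>n. f i z * (z + of_real a - z)^i / fact i))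
      \<le> (fact n * ((1 + M/\<delta>) / norm z) ^ Suc n) * norm (z + of_real a - z) ^ Suc n / fact n"
  proof (rule complex_Taylor[of S])
    show "convex S" by (simp add: S_def)
    show "(f i has_field_derivative f (Suc i) v) (at v within S)" if "v \<in> S" for i v
    proof (cases "i = 0")
      case True
      have "v \<notin> \<real>\<^sub>\<le>\<^sub>0" using Imv[OF that] d by (auto simp: complex_nonpos_Reals_iff)
      then show ?thesis using True by (auto simp: f_def[abs_def] divide_inverse intro!: derivative_eq_intros)
    next
      case False
      have v: "v \<noteq> 0" using Imv[OF that] d by auto
      obtain j where j: "i = Suc j" using False by (cases i) auto
      have "((\<lambda>v. (-1)^j * fact j / v^Suc j) has_field_derivative ((-1)^Suc j * fact (Suc j) / v^Suc (Suc j))) (at v within S)"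
        using v by (auto intro!: derivative_eq_intros simp del: power_Suc) (simp add: divide_simps)
      then show ?thesis using j by (simp add: f_def[abs_def])
    qed
    show "norm (f (Suc n) v) \<le> fact n * ((1 + M/\<delta>) / norm z) ^ Suc n" if v: "v \<in> S" for v
    proof -
      obtain u where u: "v = z + of_real u" "\<bar>u\<bar> \<le> M" using S[OF v] by blast
      have v0: "norm v > 0" using Imv[OF v] d by auto
      have "norm z \<le> (1 + M/\<delta>) * norm v"
        using norm_add_real_ge[OF d(1,2) u(2)] u by simp
      then have "1 / norm v \<le> (1 + M/\<delta>) / norm z"
        using v0 z0 by (simp add: field_simps)
      then have "(1 / norm v) ^ Suc n \<le> ((1 + M/\<delta>) / norm z) ^ Suc n"
        by (intro power_mono) auto
      moreover have "norm (f (Suc n) v) = fact n * (1 / norm v) ^ Suc n"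
        unfolding f_def by (simp add: norm_mult norm_divide norm_power power_one_over field_simps del: power_Suc)
      ultimately show ?thesis
        by (simp add: mult_left_mono del: power_Suc)
    qed
  qed (auto simp: S_def)
  moreover have "(\<Sum>i\<le>n. f i z * (z + of_real a - z)^i / fact i)
      = Ln z + (\<Sum>k=1..n. (-1)^(k-1) * (of_real a / z)^k / of_nat k)"
  proof -
    have "{..n} = insert 0 {1..n}" by auto
    then have "(\<Sum>i\<le>n. f i z * (z + of_real a - z)^i / fact i)
       = f 0 z + (\<Sum>i=1..n. f i z * (z + of_real a - z)^i / fact i)" by simp
    also have "(\<Sum>i=1..n. f i z * (z + of_real a - z)^i / fact i) = (\<Sum>k=1..n. (-1)^(k-1) * (of_real a / z)^k / of_nat k)"
    proof (rule sum.cong[OF refl])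
      fix k assume "k \<in> {1..n}"
      then obtain j where j: "k = Suc j" by (cases k) auto
      show "f k z * (z + of_real a - z)^k / fact k = (-1)^(k-1) * (of_real a / z)^k / of_nat k"
        unfolding j f_def by (simp add: power_divide divide_simps del: power_Suc of_nat_Suc)
    qed
    finally show ?thesis by (simp add: f_def)
  qed
  ultimately have "norm (Ln (z + of_real a) - (Ln z + (\<Sum>k=1..n. (-1)^(k-1) * (of_real a / z)^k / of_nat k)))
     \<le> ((1 + M/\<delta>) / norm z) ^ Suc n * \<bar>a\<bar> ^ Suc n"
    by (simp add: f_def del: power_Suc)
  then show ?thesis by (simp add: diff_diff_eq power_mult_distrib power_divide mult_ac del: power_Suc)
qed

text \<open>The increment \<open>J z - J (z + 1)\<close> of the remainder
  \<open>J z = ln_Gamma z - ((z - 1/2) * Ln z - z + ln (2 * pi) / 2 + 1 / (12 * z))\<close> in Stirling's formula.\<close>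
definition stirling_step :: "complex \<Rightarrow> complex" where
  "stirling_step z = (z + 1/2) * (Ln (z + 1) - Ln z) - 1 - (1 / (12 * z) - 1 / (12 * (z + 1)))"

text \<open>The expansion of (z + 1/2) (Ln (z + 1) - Ln z) - 1 begins with 1/(12 z^2) - 1/(12 z^3),
  and the increment of 1/(12 z) agrees with these two terms up to order z^(-4). The logarithm is
  expanded to fourth order because its error is multiplied by z + 1/2.\<close>

lemma stirling_step_bound:
  assumes "\<delta> > 0"
  obtains C where "C > 0" "\<And>z. \<bar>Im z\<bar> \<ge> \<delta> \<Longrightarrow> norm (stirling_step z) \<le> C / norm z ^ 4"
proof -
  define \<kappa> where "\<kappa> = 1 + 1/\<delta>"
  \<comment> \<open>The summands belong to the three terms of \<open>eq\<close> below; \<kappa>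
    trades \<open>norm (z + 1)\<close> for \<open>norm z\<close>.\<close>
  define C where "C = 1/8 + (1 + 1/(2*\<delta>)) * \<kappa>^5 + \<kappa> / 12"
  have k: "\<kappa> > 1" using assms by (simp add: \<kappa>_def)
  have "C > 0" using k assms by (auto simp: C_def intro!: add_pos_pos mult_pos_pos)
  moreover have "norm (stirling_step z) \<le> C / norm z ^ 4" if z: "\<bar>Im z\<bar> \<ge> \<delta>" for z
  proof -
    define E where "E = Ln (z + 1) - Ln z - (1/z - 1/(2*z^2) + 1/(3*z^3) - 1/(4*z^4))"
    have z0: "z \<noteq> 0" and z1: "z + 1 \<noteq> 0" using z assms by (auto simp: complex_eq_iff)
    have nz: "norm z \<ge> \<delta>" using z abs_Im_le_cmod[of z] by simp
    have kz: "norm z \<le> \<kappa> * norm (z + 1)"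
      using norm_add_real_ge[OF assms z, of 1 1] by (simp add: \<kappa>_def)
    have E: "norm E \<le> (\<kappa> / norm z)^5"
    proof -
      have "(\<Sum>k=1..4. (-1)^(k-1) * (of_real 1 / z)^k / of_nat k) = 1/z - 1/(2*z^2) + 1/(3*z^3) - 1/(4*z^4)"
        by (simp add: eval_nat_numeral field_simps)
      then show ?thesis
        using Ln_add_real_taylor[OF assms z, of 1 1 4] by (simp add: E_def \<kappa>_def numeral_eq_Suc mult_ac)
    qed
    have "Ln (z + 1) - Ln z = E + (1/z - 1/(2*z^2) + 1/(3*z^3) - 1/(4*z^4))" by (simp add: E_def)
    then have "stirling_step z = (z + 1/2) * (E + (1/z - 1/(2*z^2) + 1/(3*z^3) - 1/(4*z^4))) - 1 - (1 / (12 * z) - 1 / (12 * (z + 1)))"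
      unfolding stirling_step_def by simp
    also have "\<dots> = (z + 1/2) * E - 1 / (8 * z^4) - 1 / (12 * z^3 * (z + 1))"
      using z0 z1 by (simp add: divide_simps) algebra
    finally have eq: "stirling_step z = (z + 1/2) * E - 1 / (8 * z^4) - 1 / (12 * z^3 * (z + 1))" .
    have "norm (z + 1/2) \<le> norm z + 1/2" using norm_triangle_ineq[of z "1/2"] by simp
    also have "\<dots> \<le> norm z * (1 + 1/(2*\<delta>))" using nz assms by (simp add: field_simps)
    finally have "norm ((z + 1/2) * E) \<le> (norm z * (1 + 1/(2*\<delta>))) * (\<kappa> / norm z)^5"
      unfolding norm_mult using E assms by (intro mult_mono) auto
    also have "\<dots> = (1 + 1/(2*\<delta>)) * \<kappa>^5 / norm z^4"
      using z0 by (simp add: power_divide eval_nat_numeral)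
    finally have 1: "norm ((z + 1/2) * E) \<le> (1 + 1/(2*\<delta>)) * \<kappa>^5 / norm z^4" .
    have "norm (1 / (12 * z^3 * (z + 1))) = 1 / (12 * norm z^3 * norm (z+1))"
      by (simp add: norm_divide norm_mult norm_power)
    also have "\<dots> \<le> \<kappa> / 12 / norm z^4"
      using kz z0 z1 k by (simp add: divide_simps eval_nat_numeral)
    finally have 2: "norm (1 / (12 * z^3 * (z + 1))) \<le> \<kappa> / 12 / norm z^4" .
    have 3: "norm (1 / (8 * z^4)) = 1/8 / norm z^4" by (simp add: norm_divide norm_mult norm_power)
    have "norm (stirling_step z) \<le> norm ((z + 1/2) * E) + norm (1 / (8 * z^4)) + norm (1 / (12 * z^3 * (z + 1)))"
      unfolding eq by (meson norm_triangle_ineq4 order_trans add_mono order_refl)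
    also have "\<dots> \<le> C / norm z ^ 4"
      using 1 2 3 unfolding C_def by (simp add: add_divide_distrib)
    finally show ?thesis .
  qed
  ultimately show ?thesis using that by blast
qed

section \<open>Summing the Stirling steps uniformly in the real part\<close>

text \<open>The mean value theorem gives a point t between y and y + 1, where 1 + t^2 \<le> 3 (1 +
  y^2). Comparison with arctan makes the sums in the next lemma telescope.\<close>

lemma arctan_step_ge:
  fixes y :: real
  shows "1 / (1 + y^2) \<le> 3 * (arctan (y + 1) - arctan y)"
proof -
  have "\<exists>t. y < t \<and> t < y + 1 \<and> arctan (y + 1) - arctan y = (y + 1 - y) * (1 / (1 + t^2))"
    by (rule MVT2) (auto intro!: derivative_eq_intros simp: divide_inverse)
  then obtain t where t: "y < t" "t < y + 1" "arctan (y + 1) - arctan y = 1 / (1 + t^2)" by auto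
  have "\<bar>t\<bar> \<le> \<bar>y\<bar> + 1" using t by linarith
  then have "t^2 \<le> (\<bar>y\<bar> + 1)^2" by (metis abs_ge_zero power2_abs power_mono)
  also have "\<dots> \<le> 2 * y^2 + 2"
    using sum_squares_bound[of "\<bar>y\<bar>" 1] by (simp add: power2_eq_square algebra_simps)
  finally have "1 + t^2 \<le> 1 + (2 * y^2 + 2)" by simp
  also have "\<dots> \<le> 3 * (1 + y^2)" by (simp add: algebra_simps)
  finally have "1 + t^2 \<le> 3 * (1 + y^2)" .
  moreover have "1 + y^2 > 0" "1 + t^2 > 0" by (simp_all add: add_pos_nonneg)
  ultimately show ?thesis unfolding t(3) by (simp add: field_simps)
qed

text \<open>The point is that the bound does not involve x, which may be arbitrarily negative: the
  telescoped arctan differences never exceed pi.\<close>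

lemma summable_inverse_shifted_square:
  fixes x :: real
  assumes "\<delta> > 0"
  shows "summable (\<lambda>n. 1 / (\<delta>^2 + (x + real n)^2))"
    and "(\<Sum>n. 1 / (\<delta>^2 + (x + real n)^2)) \<le> 3 * pi * (1 + 1/\<delta>^2)"
proof -
  have *: "1 / (\<delta>^2 + y^2) \<le> (1 + 1/\<delta>^2) * (3 * (arctan (y + 1) - arctan y))" for y
  proof -
    have "1 / (\<delta>^2 + y^2) \<le> (1 + 1/\<delta>^2) * (1 / (1 + y^2))"
    proof -
      have "(1 + y\<^sup>2) \<le> (1 + 1/\<delta>^2) * (\<delta>^2 + y^2)"
        using assms by (simp add: field_simps)
      moreover have "\<delta>^2 + y^2 > 0" "1 + y^2 > 0" using assms by (simp_all add: add_pos_nonneg)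
      ultimately show ?thesis by (simp add: field_simps)
    qed
    also have "\<dots> \<le> (1 + 1/\<delta>^2) * (3 * (arctan (y + 1) - arctan y))"
      using arctan_step_ge[of y] by (intro mult_left_mono) auto
    finally show ?thesis .
  qed
  have part: "(\<Sum>n<N. 1 / (\<delta>^2 + (x + real n)^2)) \<le> 3 * pi * (1 + 1/\<delta>^2)" for N
  proof -
    have "(\<Sum>n<N. 1 / (\<delta>^2 + (x + real n)^2)) \<le> (\<Sum>n<N. (1 + 1/\<delta>^2) * (3 * (arctan (x + real (Suc n)) - arctan (x + real n))))"
      using *[of "x + real n" for n] by (intro sum_mono) (simp add: add_ac)
    also have "\<dots> = (1 + 1/\<delta>^2) * 3 * (\<Sum>n<N. arctan (x + real (Suc n)) - arctan (x + real n))"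
      by (simp only: sum_distrib_left mult.assoc)
    also have "(\<Sum>n<N. arctan (x + real (Suc n)) - arctan (x + real n)) = arctan (x + real N) - arctan x"
      by (subst sum_lessThan_telescope) simp
    also have "(1 + 1/\<delta>^2) * 3 * (arctan (x + real N) - arctan x) \<le> (1 + 1/\<delta>^2) * 3 * pi"
      using arctan_bounded[of "x + real N"] arctan_bounded[of x] by (intro mult_left_mono) auto
    finally show ?thesis by (simp add: mult_ac)
  qed
  show s: "summable (\<lambda>n. 1 / (\<delta>^2 + (x + real n)^2))"
    by (rule summableI_nonneg_bounded[OF _ part]) simp
  show "(\<Sum>n. 1 / (\<delta>^2 + (x + real n)^2)) \<le> 3 * pi * (1 + 1/\<delta>^2)"
    by (rule suminf_le_const[OF s part])
qed

text \<open>The fourth power of \<open>norm (z + of_nat n)\<close> is split into two squares: one is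
  bounded below by (Im z)^2 and yields the decay, the other makes the series converge uniformly in
  \<open>Re z\<close>. No decay in \<open>norm z\<close> can come out of this argument, since for
  very negative \<open>Re z\<close> some z + n come back close to the imaginary axis.\<close>

lemma stirling_step_sum_bound:
  assumes "\<delta> > 0"
  obtains C where "C > 0"
    "\<And>z. \<bar>Im z\<bar> \<ge> \<delta> \<Longrightarrow> summable (\<lambda>n. stirling_step (z + of_nat n))"
    "\<And>z. \<bar>Im z\<bar> \<ge> \<delta> \<Longrightarrow> norm (\<Sum>n. stirling_step (z + of_nat n)) \<le> C / (Im z)^2"
proof -
  obtain C where C: "C > 0" "\<And>z. \<bar>Im z\<bar> \<ge> \<delta> \<Longrightarrow> norm (stirling_step z) \<le> C / norm z ^ 4"
    using stirling_step_bound[OF assms] by blast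
  have b: "norm (stirling_step (z + of_nat n)) \<le> C / (Im z)^2 * (1 / (\<delta>^2 + (Re z + real n)^2))"
    if z: "\<bar>Im z\<bar> \<ge> \<delta>" for z n
  proof -
    have d: "(Im z)^2 \<ge> \<delta>^2" using z assms by (metis abs_ge_zero power2_abs power_mono less_imp_le)
    have i: "(Im z)^2 > 0" using z assms by auto
    have "norm (z + of_nat n) ^ 4 = (norm (z + of_nat n) ^ 2)^2" by simp
    also have "norm (z + of_nat n) ^ 2 = (Re z + real n)^2 + (Im z)^2" by (simp add: cmod_power2)
    also have "\<dots>^2 \<ge> (Im z)^2 * (\<delta>^2 + (Re z + real n)^2)"
      unfolding power2_eq_square[of "(Re z + real n)^2 + (Im z)^2"] using d
      by (intro mult_mono) (auto simp: add_nonneg_nonneg)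
    finally have *: "(Im z)^2 * (\<delta>^2 + (Re z + real n)^2) \<le> norm (z + of_nat n) ^ 4" .
    have p: "0 < (Im z)^2 * (\<delta>^2 + (Re z + real n)^2)"
      using i assms by (intro mult_pos_pos) (auto intro!: add_pos_nonneg)
    have "norm (stirling_step (z + of_nat n)) \<le> C / norm (z + of_nat n) ^ 4"
      using z by (intro C(2)) simp
    also have "\<dots> \<le> C / ((Im z)^2 * (\<delta>^2 + (Re z + real n)^2))"
      using * p C(1) by (intro divide_left_mono) (auto intro: mult_pos_pos less_le_trans)
    finally show ?thesis by simp
  qed
  have s: "summable (\<lambda>n. C / (Im z)^2 * (1 / (\<delta>^2 + (Re z + real n)^2)))" for z
    by (intro summable_mult summable_inverse_shifted_square assms)
  show ?thesis
  proof (rule that[of "C * (3 * pi * (1 + 1/\<delta>^2))"])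
    show "C * (3 * pi * (1 + 1/\<delta>^2)) > 0" using C by (intro mult_pos_pos) (auto intro: add_pos_nonneg)
    fix z assume z: "\<bar>Im z\<bar> \<ge> \<delta>"
    show "summable (\<lambda>n. stirling_step (z + of_nat n))"
      by (rule summable_comparison_test'[OF s[of z], of 0]) (use b[OF z] in auto)
    have "norm (\<Sum>n. stirling_step (z + of_nat n)) \<le> (\<Sum>n. C / (Im z)^2 * (1 / (\<delta>^2 + (Re z + real n)^2)))"
      by (rule norm_suminf_le[OF b[OF z] s])
    also have "\<dots> = C / (Im z)^2 * (\<Sum>n. 1 / (\<delta>^2 + (Re z + real n)^2))"
      by (rule suminf_mult[OF summable_inverse_shifted_square(1)[OF assms]])
    also have "\<dots> \<le> C / (Im z)^2 * (3 * pi * (1 + 1/\<delta>^2))"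
      using C by (intro mult_left_mono summable_inverse_shifted_square assms) auto
    finally show "norm (\<Sum>n. stirling_step (z + of_nat n)) \<le> C * (3 * pi * (1 + 1/\<delta>^2)) / (Im z)^2" by simp
  qed
qed

section \<open>Stirling's formula from Euler's limit for Gamma\<close>

text \<open>Only the logarithms fail to telescope; the exponential of their sum is the Pochhammer
  symbol in \<open>Gamma_series'\<close>.\<close>

lemma stirling_step_sum:
  "(\<Sum>n<N. stirling_step (z + of_nat n)) =
     (z + of_nat N - 1/2) * Ln (z + of_nat N) - (z - 1/2) * Ln z - (\<Sum>m<N. Ln (z + of_nat m))
     - of_nat N - (1 / (12 * z) - 1 / (12 * (z + of_nat N)))"
  by (induction N) (simp_all add: stirling_step_def algebra_simps)

text \<open>This is Gamma n divided by n^(n - 1/2) exp (-n), so its limit is the constant in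
  Stirling's formula.\<close>

definition stirling_ratio :: "nat \<Rightarrow> real" where
  "stirling_ratio n = fact (n - 1) * exp (real n - (real n - 1/2) * ln (real n))"

lemma fact_stirling_ratio:
  assumes "n > 0"
  shows "fact n = stirling_ratio n * exp ((real n + 1/2) * ln (real n) - real n)"
proof -
  have "stirling_ratio n * exp ((real n + 1/2) * ln (real n) - real n)
      = fact (n - 1) * exp (real n - (real n - 1/2) * ln (real n) + ((real n + 1/2) * ln (real n) - real n))"
    unfolding stirling_ratio_def by (simp only: exp_add mult.assoc)
  also have "real n - (real n - 1/2) * ln (real n) + ((real n + 1/2) * ln (real n) - real n) = ln (real n)"
    by (simp add: algebra_simps)
  also have "fact (n - 1) * exp (ln (real n)) = fact n"
    using assms by (simp add: fact_reduce[of n])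
  finally show ?thesis by simp
qed

text \<open>The dependence on N is sorted into a factor free of z, a partial sum of a convergent
  series, and a last bracket that tends to z. Exponentiating the sum of logarithms avoids any
  question about branches.\<close>

lemma Gamma_series'_stirling:
  assumes "Im z \<noteq> 0" "N > 0"
  shows "Gamma_series' z N = of_real (stirling_ratio N) *
    exp ((\<Sum>n<N. stirling_step (z + of_nat n)) + (z - 1/2) * Ln z + 1 / (12 * z)
         - ((z + of_nat N - 1/2) * (Ln (z + of_nat N) - of_real (ln (real N))) + 1 / (12 * (z + of_nat N))))"
proof -
  have nz: "z + of_nat m \<noteq> 0" for m using assms by (auto simp: complex_eq_iff)
  have "exp (\<Sum>m<N. Ln (z + of_nat m)) = pochhammer z N"
    by (simp add: exp_sum pochhammer_prod nz atLeast0LessThan)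
  then have "Gamma_series' z N = fact (N - 1) * exp (z * of_real (ln (real N))) * exp (- (\<Sum>m<N. Ln (z + of_nat m)))"
    using assms by (simp add: Gamma_series'_def exp_minus divide_inverse)
  also have "\<dots> = fact (N - 1) * exp (z * of_real (ln (real N)) - (\<Sum>m<N. Ln (z + of_nat m)))"
    by (simp add: exp_diff exp_minus divide_inverse)
  also have "z * of_real (ln (real N)) - (\<Sum>m<N. Ln (z + of_nat m)) =
     of_real (real N - (real N - 1/2) * ln (real N)) + ((\<Sum>n<N. stirling_step (z + of_nat n)) + (z - 1/2) * Ln z + 1 / (12 * z)
         - ((z + of_nat N - 1/2) * (Ln (z + of_nat N) - of_real (ln (real N))) + 1 / (12 * (z + of_nat N))))"
    unfolding stirling_step_sum by (simp add: algebra_simps)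
  finally show ?thesis
    by (simp only: exp_add stirling_ratio_def of_real_mult of_real_exp[symmetric] exp_of_real of_real_fact mult.assoc)
qed

text \<open>Splitting ln N off the logarithm leaves (z + N - 1/2) Ln (1 + z/N), whose limit is z
  times the derivative of \<open>Ln\<close> at 1.\<close>

lemma Ln_shift_limit:
  assumes "Im z \<noteq> 0"
  shows "(\<lambda>N. (z + of_nat N - 1/2) * (Ln (z + of_nat N) - of_real (ln (real N))) + 1 / (12 * (z + of_nat N))) \<longlonglongrightarrow> z"
proof -
  have z: "z \<noteq> 0" using assms by auto
  have inv: "(\<lambda>N. 1 / of_nat N :: complex) \<longlonglongrightarrow> 0" by (simp add: lim_1_over_n)
  have zN: "(\<lambda>N. z / of_nat N) \<longlonglongrightarrow> 0"
    using tendsto_mult[OF tendsto_const[of z] inv] by simp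
  have "(Ln has_field_derivative 1) (at 1)"
    using has_field_derivative_Ln[of 1] by simp
  then have "((\<lambda>h. (Ln (1 + h) - Ln 1) / h) \<longlongrightarrow> 1) (at 0)"
    unfolding DERIV_def .
  moreover have "filterlim (\<lambda>N. z / of_nat N) (at 0) sequentially"
    using zN z by (auto simp: filterlim_at intro!: eventually_mono[OF eventually_gt_at_top[of 0]])
  ultimately have L: "(\<lambda>N. (Ln (1 + z / of_nat N) - Ln 1) / (z / of_nat N)) \<longlonglongrightarrow> 1"
    by (rule filterlim_compose)
  have "(\<lambda>N. (z * (1 / of_nat N) + 1 - 1/2 * (1 / of_nat N)) * z * ((Ln (1 + z / of_nat N) - Ln 1) / (z / of_nat N))
        + 1/12 * (1 / of_nat N) / (z * (1 / of_nat N) + 1))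
      \<longlonglongrightarrow> (z * 0 + 1 - 1/2 * 0) * z * 1 + 1/12 * 0 / (z * 0 + 1)"
    by (intro tendsto_intros inv L) auto
  moreover have "\<forall>\<^sub>F N in sequentially. (z * (1 / of_nat N) + 1 - 1/2 * (1 / of_nat N)) * z * ((Ln (1 + z / of_nat N) - Ln 1) / (z / of_nat N))
        + 1/12 * (1 / of_nat N) / (z * (1 / of_nat N) + 1) =
      (z + of_nat N - 1/2) * (Ln (z + of_nat N) - of_real (ln (real N))) + 1 / (12 * (z + of_nat N))"
    using eventually_gt_at_top[of 0]
  proof eventually_elim
    case (elim N)
    have nz: "z + of_nat N \<noteq> 0" "1 + z / of_nat N \<noteq> 0" using assms elim by (auto simp: complex_eq_iff)
    have "Ln (z + of_nat N) = Ln (of_real (real N) * (1 + z / of_nat N))"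
      using elim by (simp add: ring_distribs add.commute)
    also have "\<dots> = of_real (ln (real N)) + Ln (1 + z / of_nat N)"
      using elim nz by (subst Ln_times_of_real) auto
    finally have *: "Ln (z + of_nat N) - of_real (ln (real N)) = Ln (1 + z / of_nat N)" by simp
    have a: "(z * (1 / of_nat N) + 1 - 1/2 * (1 / of_nat N)) * z * (X / (z / of_nat N)) = (z + of_nat N - 1/2) * X" for X
      using elim z by (simp add: field_simps)
    have "z * (1 / of_nat N) + 1 = (z + of_nat N) / of_nat N" using elim by (simp add: field_simps)
    then have b: "1/12 * (1 / of_nat N) / (z * (1 / of_nat N) + 1) = 1 / (12 * (z + of_nat N))"
      using elim nz by simp
    show ?case unfolding * a b by simp
  qed
  ultimately show ?thesis by (auto intro: Lim_transform_eventually)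
qed

text \<open>Divide \<open>Gamma_series'_stirling\<close> by its exponential. The sequence does not
  contain z, so a single number is the limit for every nonreal z; this is Stirling's formula up to
  the value of that number.\<close>

lemma stirling_ratio_limit_aux:
  assumes "Im z \<noteq> 0"
  shows "(\<lambda>N. of_real (stirling_ratio N)) \<longlonglongrightarrow>
    Gamma z / exp ((\<Sum>n. stirling_step (z + of_nat n)) + (z - 1/2) * Ln z + 1 / (12 * z) - z)"
proof -
  have pos: "\<bar>Im z\<bar> > 0" using assms by simp
  obtain C where C: "C > (0::real)" "\<And>w. \<bar>Im w\<bar> \<ge> \<bar>Im z\<bar> \<Longrightarrow> summable (\<lambda>n. stirling_step (w + of_nat n))"
    using stirling_step_sum_bound[OF pos] by metis
  have s: "(\<lambda>N. \<Sum>n<N. stirling_step (z + of_nat n)) \<longlonglongrightarrow> (\<Sum>n. stirling_step (z + of_nat n))"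
    using C(2)[of z] by (simp add: summable_LIMSEQ)
  have "(\<lambda>N. Gamma_series' z N / exp ((\<Sum>n<N. stirling_step (z + of_nat n)) + (z - 1/2) * Ln z + 1 / (12 * z)
         - ((z + of_nat N - 1/2) * (Ln (z + of_nat N) - of_real (ln (real N))) + 1 / (12 * (z + of_nat N)))))
      \<longlonglongrightarrow> Gamma z / exp ((\<Sum>n. stirling_step (z + of_nat n)) + (z - 1/2) * Ln z + 1 / (12 * z) - z)"
    by (intro tendsto_divide tendsto_exp tendsto_diff[OF _ Ln_shift_limit[OF assms]] tendsto_add[OF _ tendsto_const] s Gamma_series'_LIMSEQ) auto
  then show ?thesis
    by (rule Lim_transform_eventually)
       (use eventually_gt_at_top[of 0] in eventually_elim, simp add: Gamma_series'_stirling[OF assms])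
qed

section \<open>The constant sqrt (2 pi) from Wallis's product\<close>

lemma wallis_product_fact:
  "(\<Prod>k=1..n. (4*real k^2) / (4*real k^2 - 1)) * (fact (2*n))^2 * (2 * real n + 1) = (4^n * (fact n)^2)^2"
proof (induction n)
  case (Suc n)
  have nz: "4*real (Suc n)^2 - 1 = (2 * real n + 1) * (2 * real n + 3)"
    by (simp add: power2_eq_square algebra_simps)
  have f: "fact (2 * Suc n) = (2 * real n + 2) * (2 * real n + 1) * fact (2*n)"
    by (simp add: algebra_simps)
  define P where "P = (\<Prod>k=1..n. (4*real k^2) / (4*real k^2 - 1))"
  have "(\<Prod>k=1..Suc n. (4*real k^2) / (4*real k^2 - 1)) * (fact (2*Suc n))^2 * (2 * real (Suc n) + 1)
     = P * ((4*real (Suc n)^2) / ((2 * real n + 1) * (2 * real n + 3))) * ((2 * real n + 2) * (2 * real n + 1) * fact (2*n))^2 * (2 * real n + 3)"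
    unfolding nz[symmetric] f P_def by simp
  also have "\<dots> = (P * (fact (2*n))^2 * (2 * real n + 1)) * (4*real (Suc n)^2) * (2 * real n + 2)^2"
    by (simp add: divide_simps power2_eq_square)
  also have "P * (fact (2*n))^2 * (2 * real n + 1) = (4^n * (fact n)^2)^2" using Suc unfolding P_def .
  also have "(4^n * (fact n)^2)^2 * (4*real (Suc n)^2) * (2 * real n + 2)^2 = (4^(Suc n) * (fact (Suc n))^2)^2"
    by (simp add: power2_eq_square algebra_simps)
  finally show ?case .
qed simp

lemma stirling_ratio_limit: "stirling_ratio \<longlonglongrightarrow> sqrt (2 * pi)"
proof -
  \<comment> \<open>Any nonreal point would serve. The limit is nonzero because \<open>Gamma\<close>
    has no zeros off its poles, which later permits cancelling \<open>Re c ^ 2\<close>.\<close>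
  define c where "c = Gamma \<i> / exp ((\<Sum>n. stirling_step (\<i> + of_nat n)) + (\<i> - 1/2) * Ln \<i> + 1 / (12 * \<i>) - \<i>)"
  have c: "(\<lambda>N. complex_of_real (stirling_ratio N)) \<longlonglongrightarrow> c"
    unfolding c_def by (rule stirling_ratio_limit_aux) simp
  have "\<i> \<notin> \<int>\<^sub>\<le>\<^sub>0" by (auto elim!: nonpos_Ints_cases simp: complex_eq_iff)
  then have c0: "c \<noteq> 0" by (auto simp: c_def Gamma_eq_zero_iff)
  have r: "stirling_ratio \<longlonglongrightarrow> Re c" using tendsto_Re[OF c] by simp
  have "c = of_real (Re c)" using LIMSEQ_unique[OF c tendsto_of_real[OF r]] .
  then have r0: "Re c \<noteq> 0" using c0 by (metis of_real_0)
  have "strict_mono (\<lambda>n::nat. 2 * n)" by (auto simp: strict_mono_def)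
  from LIMSEQ_subseq_LIMSEQ[OF r this] have r2: "(\<lambda>n. stirling_ratio (2 * n)) \<longlonglongrightarrow> Re c" by (simp add: o_def)
  have l1: "(\<lambda>n. stirling_ratio n ^ 4 * (real n / (2 * (2 * real n + 1)))) \<longlonglongrightarrow> Re c ^ 4 * (1/4)"
    by (intro tendsto_mult tendsto_power r) real_asymp
  have l2: "(\<lambda>n. (\<Prod>k=1..n. (4*real k^2) / (4*real k^2 - 1)) * stirling_ratio (2*n)^2) \<longlonglongrightarrow> pi / 2 * Re c ^ 2"
    by (intro tendsto_mult tendsto_power r2 wallis)
  \<comment> \<open>Insert \<open>fact_stirling_ratio\<close> at n and at 2n into
    \<open>wallis_product_fact\<close>: the exponential main parts cancel, and only the ratios and a
    rational function of n survive.\<close>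
  have ev: "\<forall>\<^sub>F n in sequentially. (\<Prod>k=1..n. (4*real k^2) / (4*real k^2 - 1)) * stirling_ratio (2*n)^2
      = stirling_ratio n ^ 4 * (real n / (2 * (2 * real n + 1)))"
    using eventually_gt_at_top[of 0]
  proof eventually_elim
    case (elim n)
    define W where "W = (\<Prod>k=1..n. (4*real k^2) / (4*real k^2 - 1))"
    define X where "X = exp ((real n + 1/2) * ln (real n) - real n)"
    have X0: "X > 0" by (simp add: X_def)
    have "(exp ((real (2*n) + 1/2) * ln (real (2*n)) - real (2*n)))^2 = exp (4 * ((real n + 1/2) * ln (real n) - real n) + (4 * real n * ln 2 + ln 2 - ln (real n)))"
      using elim unfolding exp_of_nat_mult[symmetric, of 2, simplified] exp_double[symmetric]
      by (simp add: ln_mult algebra_simps)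
    also have "\<dots> = X^4 * (exp (4 * real n * ln 2) * 2 / real n)"
      using elim exp_of_nat_mult[of 4 "(real n + 1/2) * ln (real n) - real n"]
      unfolding X_def exp_add exp_diff[of _ "ln (real n)"] by simp
    also have "exp (4 * real n * ln 2) = (2::real) ^ (4 * n)"
      using exp_of_nat_mult[of "4 * n" "ln 2 :: real"] by simp
    finally have e2: "(exp ((real (2*n) + 1/2) * ln (real (2*n)) - real (2*n)))^2 = X^4 * (2^(4*n) * 2 / real n)" .
    have "W * (stirling_ratio (2*n)^2 * (X^4 * (2^(4*n) * 2 / real n))) * (2 * real n + 1) = (4^n * (stirling_ratio n * X)^2)^2"
      using wallis_product_fact[of n] fact_stirling_ratio[of n] fact_stirling_ratio[of "2*n"] elim
      unfolding W_def[symmetric] e2[symmetric] by (simp add: power_mult_distrib X_def)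
    also have "\<dots> = 2^(4*n) * X^4 * stirling_ratio n^4"
    proof -
      have "(2::real)^(4*n) = (4^n)^2"
        using power_mult[of "2::real" 2 "2*n"] power_mult[of "4::real" n 2] by (simp add: mult.commute)
      moreover have "stirling_ratio n ^ 4 = ((stirling_ratio n)^2)^2" "X^4 = (X^2)^2" by simp_all
      ultimately show ?thesis by (simp only: power_mult_distrib mult_ac)
    qed
    finally have "2^(4*n) * X^4 * (W * stirling_ratio (2*n)^2 * 2 * (2 * real n + 1)) = 2^(4*n) * X^4 * (stirling_ratio n^4 * real n)"
      using elim by (simp add: field_simps)
    then have "W * stirling_ratio (2*n)^2 * 2 * (2 * real n + 1) = stirling_ratio n^4 * real n"
      using X0 by simp
    then show ?case unfolding W_def[symmetric] by (simp add: field_simps)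
  qed
  have "Re c ^ 4 * (1/4) = pi / 2 * Re c ^ 2"
    by (rule LIMSEQ_unique[OF l1 Lim_transform_eventually[OF l2 ev]])
  then have "Re c ^ 2 * Re c ^ 2 = Re c ^ 2 * (2 * pi)" by (simp add: power_add[symmetric])
  then have "Re c ^ 2 = 2 * pi" using r0 by (subst (asm) mult_left_cancel) auto
  moreover have "Re c \<ge> 0"
    by (rule LIMSEQ_le_const[OF r]) (auto simp: stirling_ratio_def)
  ultimately have "Re c = sqrt (2 * pi)" by (metis real_sqrt_unique)
  then show ?thesis using r by simp
qed

lemma Gamma_stirling:
  assumes "\<delta> > 0"
  obtains J :: "complex \<Rightarrow> complex" and C where
    "\<And>z. \<bar>Im z\<bar> \<ge> \<delta> \<Longrightarrow> norm (J z) \<le> C / (Im z)^2"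
    "\<And>z. \<bar>Im z\<bar> \<ge> \<delta> \<Longrightarrow> Gamma z = of_real (sqrt (2 * pi)) * exp ((z - 1/2) * Ln z - z + 1 / (12 * z) + J z)"
proof -
  obtain C where C: "C > 0"
    "\<And>z. \<bar>Im z\<bar> \<ge> \<delta> \<Longrightarrow> summable (\<lambda>n. stirling_step (z + of_nat n))"
    "\<And>z. \<bar>Im z\<bar> \<ge> \<delta> \<Longrightarrow> norm (\<Sum>n. stirling_step (z + of_nat n)) \<le> C / (Im z)^2"
    using stirling_step_sum_bound[OF assms] by metis
  show ?thesis
  proof (rule that[of "\<lambda>z. \<Sum>n. stirling_step (z + of_nat n)" C, OF C(3)])
    fix z :: complex assume "\<bar>Im z\<bar> \<ge> \<delta>"
    then have "Im z \<noteq> 0" using assms by auto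
    from LIMSEQ_unique[OF stirling_ratio_limit_aux[OF this] tendsto_of_real[OF stirling_ratio_limit]]
    have "Gamma z = of_real (sqrt (2 * pi)) * exp ((\<Sum>n. stirling_step (z + of_nat n)) + (z - 1/2) * Ln z + 1 / (12 * z) - z)"
      by (simp add: field_simps)
    then show "Gamma z = of_real (sqrt (2 * pi)) * exp ((z - 1/2) * Ln z - z + 1 / (12 * z) + (\<Sum>n. stirling_step (z + of_nat n)))"
      by (simp add: algebra_simps)
  qed
qed

section \<open>The integrand for large imaginary part\<close>

text \<open>The coefficient of \<open>1/z\<close> in the expansion of \<open>ln_Gamma (z + a)\<close>; it is half the second
  Bernoulli polynomial.\<close>
definition stirling_coeff :: "real \<Rightarrow> real" where
  "stirling_coeff a = (a^2 - a + 1/6) / 2"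

lemma norm_triangle_ineq_four:
  fixes x y u v :: "'a::real_normed_vector"
  shows "norm (x + y - u - v) \<le> norm x + norm y + norm u + norm v"
  using norm_triangle_ineq4[of "x + y - u" v] norm_triangle_ineq4[of "x + y" u] norm_triangle_ineq[of x y]
  by linarith

text \<open>With z = A s, the shift by a is removed by expanding \<open>Ln (z + of_real a)\<close>
  to second order. Everything up to order 1/z becomes explicit, with coefficient
  \<open>stirling_coeff a\<close>, and the rest goes into e. The condition |Im s| \<ge> 1 turns into
  |Im z| \<ge> A, which fixes the \<delta> of Stirling's formula.\<close>

lemma Gamma_affine_stirling:
  assumes A: "A > 0"
  obtains e :: "real \<Rightarrow> complex \<Rightarrow> complex" and C where
    "\<And>a s. \<bar>a\<bar> \<le> M \<Longrightarrow> \<bar>Im s\<bar> \<ge> 1 \<Longrightarrow> norm (e a s) \<le> C / (Im s)^2"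
    "\<And>a s. \<bar>a\<bar> \<le> M \<Longrightarrow> \<bar>Im s\<bar> \<ge> 1 \<Longrightarrow> Gamma (of_real A * s + of_real a) =
        exp (of_real (ln (2 * pi) / 2) + (of_real A * s + of_real a - 1/2) * (Ln s + of_real (ln A)) - of_real A * s
             + of_real (stirling_coeff a / A) / s + e a s)"
proof -
  obtain J :: "complex \<Rightarrow> complex" and C where J:
    "\<And>z. \<bar>Im z\<bar> \<ge> A \<Longrightarrow> norm (J z) \<le> C / (Im z)^2"
    "\<And>z. \<bar>Im z\<bar> \<ge> A \<Longrightarrow> Gamma z = of_real (sqrt (2 * pi)) * exp ((z - 1/2) * Ln z - z + 1 / (12 * z) + J z)"
    using Gamma_stirling[OF A] by metis
  define E :: "real \<Rightarrow> complex \<Rightarrow> complex"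
    where "E a z = Ln (z + of_real a) - Ln z - (of_real a / z - (of_real a)^2 / (2 * z^2))" for a z
  \<comment> \<open>The summands are the Stirling remainder, the Taylor remainder of the logarithm
    times its large prefactor, and the two rational leftovers of the identity \<open>*\<close>
    below.\<close>
  define e :: "real \<Rightarrow> complex \<Rightarrow> complex" where "e a s = (let z = of_real A * s in
     J (z + of_real a) + (z + of_real a - 1/2) * E a z - of_real (a^2 * (a - 1/2) / 2) / z^2
     - of_real (a / 12) / (z * (z + of_real a)))" for a s
  define \<kappa> where "\<kappa> = 1 + M / A"
  define D where "D = C / A^2 + (1 + (M + 1/2) / A) * (\<kappa> * M)^3 / A^2 + M^2 * (M + 1/2) / 2 / A^2 + M / 12 / A^2"
  show ?thesis
  proof (rule that[of e D])
    fix a :: real and s :: complex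
    assume a: "\<bar>a\<bar> \<le> M" and s: "\<bar>Im s\<bar> \<ge> 1"
    define z where "z = of_real A * s"
    have M: "M \<ge> 0" using a by simp
    have Imz: "\<bar>Im z\<bar> = A * \<bar>Im s\<bar>" using A by (simp add: z_def abs_mult)
    have z: "\<bar>Im z\<bar> \<ge> A" using s A by (simp add: Imz)
    have za: "\<bar>Im (z + of_real a)\<bar> \<ge> A" using z by simp
    have z0: "z \<noteq> 0" and za0: "z + of_real a \<noteq> 0" using z A by (auto simp: complex_eq_iff)
    have s0: "s \<noteq> 0" using s by auto
    have h: "A * \<bar>Im s\<bar> > 0" using s A by auto
    have nz: "norm z \<ge> A * \<bar>Im s\<bar>" using abs_Im_le_cmod[of z] Imz by simp
    have nza: "norm (z + of_real a) \<ge> A * \<bar>Im s\<bar>" using abs_Im_le_cmod[of "z + of_real a"] Imz by simp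
    have nzA: "norm z \<ge> A" using abs_Im_le_cmod[of z] z by simp
    have Lz: "Ln z = Ln s + of_real (ln A)"
      unfolding z_def using A s0 by (simp add: Ln_times_of_real Ln_of_real add.commute)
    have es: "e a s = J (z + of_real a) + (z + of_real a - 1/2) * E a z - of_real (a^2 * (a - 1/2) / 2) / z^2
     - of_real (a / 12) / (z * (z + of_real a))" by (simp add: e_def z_def Let_def)
    show "norm (e a s) \<le> D / (Im s)^2"
    proof -
      have inv2: "1 / norm z^2 \<le> 1 / A^2 / (Im s)^2"
        using power_mono[OF nz, of 2] h A s by (simp add: power_mult_distrib divide_simps)
      have "norm (J (z + of_real a)) \<le> C / (Im z)^2" using J(1)[OF za] by simp
      then have 1: "norm (J (z + of_real a)) \<le> C / A^2 / (Im s)^2" by (simp add: z_def power_mult_distrib)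
      have "norm (E a z) \<le> ((1 + M / A) * \<bar>a\<bar> / norm z)^3"
        using Ln_add_real_taylor[OF A z a, of 2] by (simp add: E_def eval_nat_numeral field_simps)
      also have "\<dots> \<le> (\<kappa> * M / norm z)^3"
        unfolding \<kappa>_def using a A M by (intro power_mono divide_right_mono mult_left_mono) auto
      finally have E: "norm (E a z) \<le> (\<kappa> * M / norm z)^3" .
      have "norm (z + of_real a - 1/2) \<le> norm z + (M + 1/2)"
        using norm_triangle_ineq[of z "of_real (a - 1/2)"] a by (simp add: norm_of_real del: of_real_diff)
           (auto simp: algebra_simps)
      also have "\<dots> \<le> (1 + (M + 1/2) / A) * norm z"
        using mult_left_mono[OF nzA, of "M + 1/2"] M A by (simp add: field_simps)
      finally have "norm ((z + of_real a - 1/2) * E a z) \<le> ((1 + (M + 1/2) / A) * norm z) * (\<kappa> * M / norm z)^3"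
        unfolding norm_mult using E M A by (intro mult_mono) auto
      also have "\<dots> = (1 + (M + 1/2) / A) * (\<kappa> * M)^3 * (1 / norm z^2)"
        using z0 by (simp add: power_divide eval_nat_numeral)
      also have "\<dots> \<le> (1 + (M + 1/2) / A) * (\<kappa> * M)^3 * (1 / A^2 / (Im s)^2)"
        using M A by (intro mult_left_mono inv2) (auto simp: \<kappa>_def)
      finally have 2: "norm ((z + of_real a - 1/2) * E a z) \<le> (1 + (M + 1/2) / A) * (\<kappa> * M)^3 / A^2 / (Im s)^2" by simp
      have "norm (of_real (a^2 * (a - 1/2) / 2) / z^2 :: complex) = \<bar>a\<bar>^2 * \<bar>a - 1/2\<bar> / 2 * (1 / norm z^2)"
        unfolding norm_divide norm_of_real norm_power by (simp add: abs_mult)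
      also have "\<dots> \<le> M^2 * (M + 1/2) / 2 * (1 / A^2 / (Im s)^2)"
        using a M by (intro mult_mono divide_right_mono power_mono inv2) auto
      finally have 3: "norm (of_real (a^2 * (a - 1/2) / 2) / z^2 :: complex) \<le> M^2 * (M + 1/2) / 2 / A^2 / (Im s)^2" by simp
      have "norm (of_real (a / 12) / (z * (z + of_real a))) = \<bar>a\<bar> / 12 * (1 / (norm z * norm (z + of_real a)))"
        by (simp add: norm_divide norm_mult)
      also have "\<dots> \<le> M / 12 * (1 / ((A * \<bar>Im s\<bar>) * (A * \<bar>Im s\<bar>)))"
        using a M h z0 za0 A by (intro mult_mono divide_right_mono divide_left_mono nz nza mult_pos_pos) auto
      finally have 4: "norm (of_real (a / 12) / (z * (z + of_real a))) \<le> M / 12 / A^2 / (Im s)^2"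
        by (simp add: power2_eq_square mult_ac)
      have "norm (e a s) \<le> C / A^2 / (Im s)^2 + (1 + (M + 1/2) / A) * (\<kappa> * M)^3 / A^2 / (Im s)^2
          + M^2 * (M + 1/2) / 2 / A^2 / (Im s)^2 + M / 12 / A^2 / (Im s)^2"
        unfolding es by (rule order_trans[OF norm_triangle_ineq_four]) (intro add_mono 1 2 3 4)
      then show ?thesis by (simp add: D_def add_divide_distrib)
    qed
    have Lza: "Ln (z + of_real a) = Ln z + (of_real a / z - (of_real a)^2 / (2 * z^2)) + E a z" by (simp add: E_def)
    \<comment> \<open>The constants cancel; the coefficients -a^2/2 + a (a - 1/2) and 1/12 of 1/z
      add up to \<open>stirling_coeff a\<close>. The last term comes from replacing 1/(z + a) by
      1/z.\<close>
    have *: "(z + of_real a - 1/2) * (of_real a / z - (of_real a)^2 / (2 * z^2)) - of_real a + 1 / (12 * (z + of_real a))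
       = of_real (stirling_coeff a) / z - of_real (a^2 * (a - 1/2) / 2) / z^2 - of_real (a / 12) / (z * (z + of_real a))"
      using z0 za0 by (simp add: stirling_coeff_def divide_simps) algebra
    have "Gamma (z + of_real a) = of_real (sqrt (2 * pi)) * exp ((z + of_real a - 1/2) * Ln (z + of_real a) - (z + of_real a)
         + 1 / (12 * (z + of_real a)) + J (z + of_real a))" by (rule J(2)[OF za])
    also have "(z + of_real a - 1/2) * Ln (z + of_real a) - (z + of_real a) + 1 / (12 * (z + of_real a)) + J (z + of_real a)
       = (z + of_real a - 1/2) * Ln z - z + ((z + of_real a - 1/2) * (of_real a / z - (of_real a)^2 / (2 * z^2)) - of_real a + 1 / (12 * (z + of_real a)))
         + (z + of_real a - 1/2) * E a z + J (z + of_real a)"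
      unfolding Lza by (simp add: distrib_left)
    also have "\<dots> = (z + of_real a - 1/2) * Ln z - z + of_real (stirling_coeff a) / z + e a s"
      unfolding * es by (simp add: algebra_simps)
    also have "of_real (stirling_coeff a) / z = of_real (stirling_coeff a / A) / s"
      by (simp add: z_def)
    also have "complex_of_real (sqrt (2 * pi)) = exp (of_real (ln (2 * pi) / 2))"
    proof -
      have "sqrt (2 * pi) = exp (ln (2 * pi) / 2)"
        using powr_half_sqrt[of "2 * pi"] by (simp add: powr_def)
      then show ?thesis by (simp only: exp_of_real)
    qed
    finally show "Gamma (of_real A * s + of_real a) =
        exp (of_real (ln (2 * pi) / 2) + (of_real A * s + of_real a - 1/2) * (Ln s + of_real (ln A)) - of_real A * s
             + of_real (stirling_coeff a / A) / s + e a s)"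
      unfolding Lz unfolding z_def exp_add[symmetric] by (simp add: algebra_simps)
  qed
qed

definition fox_gammas :: "real^'p \<Rightarrow> real^'q \<Rightarrow> real^'p \<Rightarrow> real^'q \<Rightarrow> complex \<Rightarrow> complex" where
  "fox_gammas A B a b s =
     (\<Prod>k\<in>UNIV. Gamma (of_real (A$k) * s + of_real (a$k)))
   * (\<Prod>j\<in>UNIV. rGamma (of_real (B$j) * s + of_real (b$j)))"

text \<open>The coefficient of \<open>1/s\<close> in the asymptotic expansion of \<open>ln (fox_gammas A B a b s)\<close>.\<close>
definition fox_gamma1 :: "real^'p \<Rightarrow> real^'q \<Rightarrow> real^'p \<Rightarrow> real^'q \<Rightarrow> real" where
  "fox_gamma1 A B a b =
     (\<Sum>k\<in>UNIV. stirling_coeff (a$k) / A$k) - (\<Sum>j\<in>UNIV. stirling_coeff (b$j) / B$j)"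

lemma fox_rho_pos:
  fixes A :: "real^'p" and B :: "real^'q"
  assumes "\<forall>k. A$k > 0" "\<forall>j. B$j > 0"
  shows "fox_rho A B > 0"
  using assms unfolding fox_rho_def by (auto intro!: mult_pos_pos prod_pos simp: powr_gt_zero less_imp_neq[symmetric])

lemma fox_rho_exp:
  fixes A :: "real^'p" and B :: "real^'q"
  assumes "\<forall>k. A$k > 0" "\<forall>j. B$j > 0"
  shows "ln (fox_rho A B) = (\<Sum>k\<in>UNIV. A$k * ln (A$k)) - (\<Sum>j\<in>UNIV. B$j * ln (B$j))"
proof -
  have "fox_rho A B = exp ((\<Sum>k\<in>UNIV. A$k * ln (A$k)) - (\<Sum>j\<in>UNIV. B$j * ln (B$j)))"
    using assms unfolding fox_rho_def
    by (simp add: powr_def less_imp_neq[symmetric] exp_sum exp_diff exp_minus prod_inversef[symmetric] divide_inverse)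
  then show ?thesis by simp
qed

lemma fox_nu_exp:
  fixes A a :: "real^'p" and B b :: "real^'q"
  assumes "\<forall>k. A$k > 0" "\<forall>j. B$j > 0"
  shows "fox_nu A B a b = exp ((real CARD('p) - real CARD('q)) / 2 * ln (2*pi)
     + (\<Sum>k\<in>UNIV. (a$k - 1/2) * ln (A$k)) + (\<Sum>j\<in>UNIV. (1/2 - b$j) * ln (B$j)))"
  using assms unfolding fox_nu_def
  by (simp add: powr_def less_imp_neq[symmetric] exp_sum exp_add)

text \<open>Add the expansions of the single Gamma factors. \<open>balance\<close> cancels the
  growing terms s Ln s - s, the multiples of \<open>Ln s\<close> add up to -\<mu>, those of s to ln
  \<rho>, and the constants to ln \<nu>.\<close>

lemma fox_gammas_stirling:
  fixes A :: "real^'p" and B :: "real^'q"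
  assumes Apos: "\<forall>k. A$k > 0" and Bpos: "\<forall>j. B$j > 0"
    and balance: "(\<Sum>j\<in>UNIV. B$j) - (\<Sum>k\<in>UNIV. A$k) = 0"
  obtains e :: "real^'p \<Rightarrow> real^'q \<Rightarrow> complex \<Rightarrow> complex" and C where
    "\<And>a b s. norm (a, b) \<le> M \<Longrightarrow> \<bar>Im s\<bar> \<ge> 1 \<Longrightarrow> norm (e a b s) \<le> C / (Im s)^2"
    "\<And>a b s. norm (a, b) \<le> M \<Longrightarrow> \<bar>Im s\<bar> \<ge> 1 \<Longrightarrow> fox_gammas A B a b s =
        of_real (fox_nu A B a b) * exp (s * of_real (ln (fox_rho A B)) - of_real (fox_mu a b) * Ln s
          + of_real (fox_gamma1 A B a b) / s + e a b s)"
proof -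
  define T :: "real \<Rightarrow> real \<Rightarrow> complex \<Rightarrow> complex" where
    "T A a s = of_real (ln (2 * pi) / 2) + (of_real A * s + of_real a - 1/2) * (Ln s + of_real (ln A)) - of_real A * s
             + of_real (stirling_coeff a / A) / s" for A a s
  define P :: "real \<Rightarrow> (real \<Rightarrow> complex \<Rightarrow> complex) \<Rightarrow> real \<Rightarrow> bool" where
    "P A e C \<longleftrightarrow> (\<forall>a s. \<bar>a\<bar> \<le> M \<longrightarrow> \<bar>Im s\<bar> \<ge> 1 \<longrightarrow> norm (e a s) \<le> C / (Im s)^2 \<and>
        Gamma (of_real A * s + of_real a) = exp (T A a s + e a s))" for A e C
  have ex: "\<exists>e C. P A e C" if "A > 0" for A
    using Gamma_affine_stirling[OF that, of M] unfolding P_def T_def by metis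
  have "\<forall>k. \<exists>e C. P (A$k) e C" using ex Apos by blast
  then obtain eA CA where eA: "\<And>k. P (A$k) (eA k) (CA k)" by metis
  have "\<forall>j. \<exists>e C. P (B$j) e C" using ex Bpos by blast
  then obtain eB CB where eB: "\<And>j. P (B$j) (eB j) (CB j)" by metis
  define e where "e a b s = (\<Sum>k\<in>UNIV. eA k (a$k) s) - (\<Sum>j\<in>UNIV. eB j (b$j) s)" for a b s
  define C where "C = (\<Sum>k\<in>UNIV. CA k) + (\<Sum>j\<in>UNIV. CB j)"
  show ?thesis
  proof (rule that[of e C])
    fix a :: "real^'p" and b :: "real^'q" and s :: complex
    assume ab: "norm (a, b) \<le> M" and s: "\<bar>Im s\<bar> \<ge> 1"
    have a: "\<bar>a$k\<bar> \<le> M" for k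
      using component_le_norm_cart[of a k] norm_fst_le[of a b] ab by linarith
    have b: "\<bar>b$j\<bar> \<le> M" for j
      using component_le_norm_cart[of b j] norm_snd_le[of b a] ab by linarith
    have "norm (e a b s) \<le> (\<Sum>k\<in>UNIV. norm (eA k (a$k) s)) + (\<Sum>j\<in>UNIV. norm (eB j (b$j) s))"
      unfolding e_def by (rule order_trans[OF norm_triangle_ineq4]) (intro add_mono norm_sum)
    also have "\<dots> \<le> (\<Sum>k\<in>UNIV. CA k / (Im s)^2) + (\<Sum>j\<in>UNIV. CB j / (Im s)^2)"
      using eA eB a b s unfolding P_def by (intro add_mono sum_mono) auto
    finally show "norm (e a b s) \<le> C / (Im s)^2"
      by (simp add: C_def add_divide_distrib sum_divide_distrib)
    have GA: "Gamma (of_real (A$k) * s + of_real (a$k)) = exp (T (A$k) (a$k) s + eA k (a$k) s)" for k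
      using eA[of k] a s unfolding P_def by blast
    have GB: "rGamma (of_real (B$j) * s + of_real (b$j)) = exp (- (T (B$j) (b$j) s + eB j (b$j) s))" for j
      using eB[of j] b[of j] s unfolding P_def rGamma_inverse_Gamma exp_minus by simp
    have s0: "s \<noteq> 0" using s by auto
    have "fox_gammas A B a b s = exp ((\<Sum>k\<in>UNIV. T (A$k) (a$k) s) - (\<Sum>j\<in>UNIV. T (B$j) (b$j) s) + e a b s)"
      unfolding fox_gammas_def GA GB
      by (subst (1 2) exp_sum[symmetric], simp, simp)
         (simp add: exp_add[symmetric] e_def sum.distrib sum_subtractf sum_negf algebra_simps)
    also have "(\<Sum>k\<in>UNIV. T (A$k) (a$k) s) - (\<Sum>j\<in>UNIV. T (B$j) (b$j) s) =
       of_real ((real CARD('p) - real CARD('q)) / 2 * ln (2*pi)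
         + (\<Sum>k\<in>UNIV. (a$k - 1/2) * ln (A$k)) + (\<Sum>j\<in>UNIV. (1/2 - b$j) * ln (B$j)))
       + (s * of_real (ln (fox_rho A B)) - of_real (fox_mu a b) * Ln s + of_real (fox_gamma1 A B a b) / s)"
    proof -
      \<comment> \<open>The exponent regrouped by its dependence on s, so that each group can be
        summed over the indices separately.\<close>
      have T: "T x y s = of_real (ln (2 * pi) / 2) + (s * Ln s - s) * of_real x + s * of_real (x * ln x) + Ln s * of_real y - Ln s / 2
           + of_real ((y - 1/2) * ln x) + of_real (stirling_coeff y / x) / s" for x y
        unfolding T_def by (simp add: algebra_simps add_divide_distrib diff_divide_distrib)
      have sums: "(\<Sum>k\<in>(UNIV::'c::finite set). T (X$k) (x$k) s) = of_real (real CARD('c) * ln (2 * pi) / 2) + (s * Ln s - s) * of_real (\<Sum>k\<in>UNIV. X$k)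
          + s * of_real (\<Sum>k\<in>UNIV. X$k * ln (X$k)) + Ln s * of_real (\<Sum>k\<in>UNIV. x$k) - of_real (real CARD('c)) * Ln s / 2
          + of_real (\<Sum>k\<in>UNIV. (x$k - 1/2) * ln (X$k)) + of_real (\<Sum>k\<in>UNIV. stirling_coeff (x$k) / X$k) / s" for X x :: "real^'c"
        unfolding T by (simp add: sum.distrib sum_subtractf sum_distrib_left sum_divide_distrib)
      have neg: "(\<Sum>j\<in>UNIV. (1/2 - b$j) * ln (B$j)) = - (\<Sum>j\<in>UNIV. (b$j - 1/2) * ln (B$j))"
        by (simp add: sum_negf[symmetric] algebra_simps)
      have bal: "(\<Sum>j\<in>UNIV. B$j) = (\<Sum>k\<in>UNIV. A$k)" using balance by simp
      show ?thesis
        unfolding sums neg bal fox_rho_exp[OF Apos Bpos] fox_mu_def fox_gamma1_def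
        by (simp add: algebra_simps diff_divide_distrib add_divide_distrib)
    qed
    finally show "fox_gammas A B a b s =
        of_real (fox_nu A B a b) * exp (s * of_real (ln (fox_rho A B)) - of_real (fox_mu a b) * Ln s
          + of_real (fox_gamma1 A B a b) / s + e a b s)"
      unfolding fox_nu_exp[OF Apos Bpos] by (simp only: exp_add[of "of_real _"] exp_of_real add.assoc)
  qed
qed

text \<open>The Mellin transform of the density \<open>y * (1 - y) powr (\<mu> - 1) * rGamma \<mu>\<close> on \<open>(0, 1)\<close>.\<close>
definition beta_factor :: "real \<Rightarrow> complex \<Rightarrow> complex" where
  "beta_factor \<mu> s = Gamma (s + 1) * rGamma (s + 1 + of_real \<mu>)"

text \<open>The case A = 1 with the shifts 1 and 1 + \<mu>, hence the range M + 1. The coefficient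
  of 1/s is \<open>stirling_coeff 1 - stirling_coeff (1 + \<mu>)\<close>.\<close>

lemma beta_factor_stirling:
  obtains e :: "real \<Rightarrow> complex \<Rightarrow> complex" and C where
    "\<And>\<mu> s. \<bar>\<mu>\<bar> \<le> M \<Longrightarrow> \<bar>Im s\<bar> \<ge> 1 \<Longrightarrow> norm (e \<mu> s) \<le> C / (Im s)^2"
    "\<And>\<mu> s. \<bar>\<mu>\<bar> \<le> M \<Longrightarrow> \<bar>Im s\<bar> \<ge> 1 \<Longrightarrow> beta_factor \<mu> s =
        exp (- of_real \<mu> * Ln s - of_real ((\<mu>^2 + \<mu>) / 2) / s + e \<mu> s)"
proof -
  obtain e :: "real \<Rightarrow> complex \<Rightarrow> complex" and C where
    e: "\<And>a s. \<bar>a\<bar> \<le> M + 1 \<Longrightarrow> \<bar>Im s\<bar> \<ge> 1 \<Longrightarrow> norm (e a s) \<le> C / (Im s)^2" and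
    G: "\<And>a s. \<bar>a\<bar> \<le> M + 1 \<Longrightarrow> \<bar>Im s\<bar> \<ge> 1 \<Longrightarrow> Gamma (of_real 1 * s + of_real a) =
        exp (of_real (ln (2 * pi) / 2) + (of_real 1 * s + of_real a - 1/2) * (Ln s + of_real (ln 1)) - of_real 1 * s
             + of_real (stirling_coeff a / 1) / s + e a s)"
    using Gamma_affine_stirling[OF zero_less_one, of "M + 1"] by metis
  show ?thesis
  proof (rule that[of "\<lambda>\<mu> s. e 1 s - e (1 + \<mu>) s" "2 * C"])
    fix \<mu> :: real and s :: complex assume m: "\<bar>\<mu>\<bar> \<le> M" and s: "\<bar>Im s\<bar> \<ge> 1"
    have m1: "\<bar>1\<bar> \<le> M + 1" "\<bar>1 + \<mu>\<bar> \<le> M + 1" using m by auto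
    show "norm (e 1 s - e (1 + \<mu>) s) \<le> 2 * C / (Im s)^2"
      using norm_triangle_ineq4[of "e 1 s" "e (1 + \<mu>) s"] e[OF m1(1) s] e[OF m1(2) s] by simp
    have "beta_factor \<mu> s = Gamma (of_real 1 * s + of_real 1) * inverse (Gamma (of_real 1 * s + of_real (1 + \<mu>)))"
      by (simp add: beta_factor_def rGamma_inverse_Gamma add.assoc)
    also have "\<dots> = exp ((of_real (ln (2 * pi) / 2) + (s + of_real 1 - 1/2) * Ln s - s + of_real (stirling_coeff 1) / s + e 1 s)
       - (of_real (ln (2 * pi) / 2) + (s + of_real (1 + \<mu>) - 1/2) * Ln s - s + of_real (stirling_coeff (1 + \<mu>)) / s + e (1 + \<mu>) s))"
      unfolding G[OF m1(1) s] G[OF m1(2) s] exp_minus[symmetric] exp_add[symmetric]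
      by (simp only: of_real_1 mult_1 ln_one of_real_0 add_0_right div_by_1 diff_conv_add_uminus)
    also have "(of_real (ln (2 * pi) / 2) + (s + of_real 1 - 1/2) * Ln s - s + of_real (stirling_coeff 1) / s + e 1 s)
       - (of_real (ln (2 * pi) / 2) + (s + of_real (1 + \<mu>) - 1/2) * Ln s - s + of_real (stirling_coeff (1 + \<mu>)) / s + e (1 + \<mu>) s)
       = - of_real \<mu> * Ln s + of_real (stirling_coeff 1 - stirling_coeff (1 + \<mu>)) / s + (e 1 s - e (1 + \<mu>) s)"
      by (simp add: algebra_simps diff_divide_distrib)
    also have "stirling_coeff 1 - stirling_coeff (1 + \<mu>) = - ((\<mu>^2 + \<mu>) / 2)"
      by (simp add: stirling_coeff_def power2_eq_square field_simps)
    finally show "beta_factor \<mu> s = exp (- of_real \<mu> * Ln s - of_real ((\<mu>^2 + \<mu>) / 2) / s + (e 1 s - e (1 + \<mu>) s))"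
      by simp
  qed
qed

section \<open>Comparing the Gamma quotient with beta factors\<close>

lemma norm_exp_neg_mult_Ln_le:
  assumes "\<bar>Im s\<bar> \<ge> 1" "\<mu> \<ge> 0"
  shows "norm (exp (- of_real \<mu> * Ln s)) \<le> 1"
proof -
  have "norm s \<ge> 1" using abs_Im_le_cmod[of s] assms by simp
  moreover from this have "s \<noteq> 0" by auto
  ultimately show ?thesis using assms by (simp add: norm_exp_eq_Re mult_nonneg_nonneg)
qed

text \<open>In the application the w are the exponents of the quotient and of the two beta factors
  after removal of the common main part. Linear terms match up to g/s by assumption; what remains is
  two quadratic Taylor remainders and the product of g/s with exp w3 - 1, which explains the factor
  3.\<close>

lemma exp_difference_bound:
  fixes w1 w2 w3 s :: complex and g :: real
  assumes w: "norm w1 \<le> K / h" "norm w2 \<le> K / h" "norm w3 \<le> K / h"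
    and d: "norm (w1 - w2 - of_real g / s) \<le> K / h^2" and g: "\<bar>g\<bar> \<le> K"
    and h: "h \<ge> 1" "norm s \<ge> h"
  shows "norm (exp w1 - exp w2 - of_real g / s * exp w3) \<le> (3 * K^2 * exp K + K) / h^2"
proof -
  have K: "K \<ge> 0" using g by simp
  have *: "norm (exp w - 1 - w) \<le> K^2 * exp K / h^2" "norm (exp w - 1) \<le> K * exp K / h" if "norm w \<le> K / h" for w :: complex
  proof -
    have "norm w \<le> K" using that h K divide_left_mono[of 1 h K] by simp
    then have r: "\<bar>Re w\<bar> \<le> K" using abs_Re_le_cmod[of w] by simp
    have "norm (exp w - 1 - w) \<le> exp \<bar>Re w\<bar> * norm w ^ 2"
      using Taylor_exp[of w 1] by (simp add: diff_diff_eq numeral_2_eq_2)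
    also have "\<dots> \<le> exp K * (K / h)^2" using r that by (intro mult_mono power_mono) auto
    finally show "norm (exp w - 1 - w) \<le> K^2 * exp K / h^2" by (simp add: power_divide mult_ac)
    have "norm (exp w - 1) \<le> exp \<bar>Re w\<bar> * norm w"
      using Taylor_exp[of w 0] by simp
    also have "\<dots> \<le> exp K * (K / h)" using r that by (intro mult_mono) auto
    finally show "norm (exp w - 1) \<le> K * exp K / h" by (simp add: mult_ac)
  qed
  have gs: "norm (of_real g / s) \<le> K / h"
    using g h K by (auto simp: norm_divide intro!: frac_le)
  have "norm (of_real g / s * (exp w3 - 1)) \<le> (K / h) * (K * exp K / h)"
    unfolding norm_mult using gs *(2)[OF w(3)] h K by (intro mult_mono) auto
  then have 4: "norm (of_real g / s * (exp w3 - 1)) \<le> K^2 * exp K / h^2" by (simp add: power2_eq_square mult_ac)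
  have eq: "exp w1 - exp w2 - of_real g / s * exp w3 =
     (exp w1 - 1 - w1) + (w1 - w2 - of_real g / s) - (exp w2 - 1 - w2) - of_real g / s * (exp w3 - 1)"
    by (simp add: algebra_simps diff_divide_distrib)
  have "norm (exp w1 - exp w2 - of_real g / s * exp w3) \<le> K^2 * exp K / h^2 + K / h^2 + K^2 * exp K / h^2 + K^2 * exp K / h^2"
    unfolding eq by (rule order_trans[OF norm_triangle_ineq_four]) (intro add_mono *(1) w d 4)
  then show ?thesis by (simp add: add_divide_distrib mult_ac)
qed

text \<open>The coefficient of \<open>1/s\<close> that \<open>beta_factor \<mu>\<close> leaves unmatched.\<close>
definition fox_corr :: "real^'p \<Rightarrow> real^'q \<Rightarrow> real^'p \<Rightarrow> real^'q \<Rightarrow> real" where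
  "fox_corr A B a b = fox_gamma1 A B a b + ((fox_mu a b)^2 + fox_mu a b) / 2"

definition fox_rem :: "real^'p \<Rightarrow> real^'q \<Rightarrow> real^'p \<Rightarrow> real^'q \<Rightarrow> complex \<Rightarrow> complex" where
  "fox_rem A B a b s = fox_gammas A B a b s
     - of_real (fox_nu A B a b) * exp (s * of_real (ln (fox_rho A B))) *
       (beta_factor (fox_mu a b) s + of_real (fox_corr A B a b) * beta_factor (fox_mu a b + 1) s)"

lemma continuous_on_fox_mu:
  "continuous_on S (\<lambda>x. fox_mu (fst x :: real^'p) (snd x :: real^'q))"
  unfolding fox_mu_def by (intro continuous_intros)

lemma continuous_on_fox_nu:
  fixes A :: "real^'p" and B :: "real^'q"
  assumes "\<forall>k. A$k > 0" "\<forall>j. B$j > 0"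
  shows "continuous_on S (\<lambda>x. fox_nu A B (fst x) (snd x))"
  unfolding fox_nu_exp[OF assms] by (intro continuous_intros)

lemma continuous_on_fox_corr:
  fixes A :: "real^'p" and B :: "real^'q"
  assumes "\<forall>k. A$k > 0" "\<forall>j. B$j > 0"
  shows "continuous_on S (\<lambda>x. fox_corr A B (fst x) (snd x))"
proof -
  have "A$k \<noteq> 0" "B$j \<noteq> 0" for k j using assms by (auto simp: less_imp_neq[symmetric])
  then show ?thesis
    unfolding fox_corr_def fox_gamma1_def fox_mu_def stirling_coeff_def by (intro continuous_intros) auto
qed

lemma bounded_on_cball_pair:
  fixes f :: "(real^'p) \<times> (real^'q) \<Rightarrow> real"
  assumes "continuous_on UNIV f"
  obtains D where "D > 0" "\<And>a b. norm (a, b) \<le> M \<Longrightarrow> \<bar>f (a, b)\<bar> \<le> D"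
proof -
  have "bounded (f ` cball 0 M)"
    using assms by (intro compact_imp_bounded compact_continuous_image) (auto intro: continuous_on_subset)
  then obtain D where "D > 0" "\<forall>x\<in>f ` cball 0 M. norm x \<le> D" unfolding bounded_pos by blast
  then show ?thesis by (intro that[of D]) auto
qed

text \<open>After extraction of \<nu> \<rho>^s s^(-\<mu>) the bracket has the shape treated in
  \<open>exp_difference_bound\<close>. The condition \<mu> \<ge> 0 keeps |s^(-\<mu>)| \<le> 1, and
  all constants are uniform because the parameters stay in a ball.\<close>

lemma fox_rem_bound:
  fixes A :: "real^'p" and B :: "real^'q"
  assumes Apos: "\<forall>k. A$k > 0" and Bpos: "\<forall>j. B$j > 0"
    and balance: "(\<Sum>j\<in>UNIV. B$j) - (\<Sum>k\<in>UNIV. A$k) = 0"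
  obtains C where "C > 0" "\<And>a b s. norm (a, b) \<le> M \<Longrightarrow> fox_mu a b \<ge> 0 \<Longrightarrow> \<bar>Im s\<bar> \<ge> 1 \<Longrightarrow>
      norm (fox_rem A B a b s) \<le> C * exp (ln (fox_rho A B) * Re s) / (Im s)^2"
proof -
  obtain N where N: "N > 0" "\<And>a b. norm (a, b) \<le> M \<Longrightarrow> \<bar>fox_nu A B a b\<bar> \<le> N"
    using bounded_on_cball_pair[OF continuous_on_fox_nu[OF Apos Bpos]] by (metis fst_conv snd_conv)
  obtain G where G: "G > 0" "\<And>a b. norm (a, b) \<le> M \<Longrightarrow> \<bar>fox_corr A B a b\<bar> \<le> G"
    using bounded_on_cball_pair[OF continuous_on_fox_corr[OF Apos Bpos]] by (metis fst_conv snd_conv)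
  obtain L where L: "L > 0" "\<And>(a::real^'p) (b::real^'q). norm (a, b) \<le> M \<Longrightarrow> \<bar>fox_mu a b\<bar> \<le> L"
    using bounded_on_cball_pair[OF continuous_on_fox_mu[where ?'p = 'p and ?'q = 'q]] by (metis fst_conv snd_conv)
  obtain e1 :: "real^'p \<Rightarrow> real^'q \<Rightarrow> complex \<Rightarrow> complex" and C1 where e1:
    "\<And>a b s. norm (a, b) \<le> M \<Longrightarrow> \<bar>Im s\<bar> \<ge> 1 \<Longrightarrow> norm (e1 a b s) \<le> C1 / (Im s)^2"
    "\<And>a b s. norm (a, b) \<le> M \<Longrightarrow> \<bar>Im s\<bar> \<ge> 1 \<Longrightarrow> fox_gammas A B a b s =
        of_real (fox_nu A B a b) * exp (s * of_real (ln (fox_rho A B)) - of_real (fox_mu a b) * Ln s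
          + of_real (fox_gamma1 A B a b) / s + e1 a b s)"
    using fox_gammas_stirling[OF assms, of M] by metis
  \<comment> \<open>The range \<open>L + 1\<close> also admits the shifted parameter \<mu> +
    1.\<close>
  obtain e2 :: "real \<Rightarrow> complex \<Rightarrow> complex" and C2 where e2:
    "\<And>\<mu> s. \<bar>\<mu>\<bar> \<le> L + 1 \<Longrightarrow> \<bar>Im s\<bar> \<ge> 1 \<Longrightarrow> norm (e2 \<mu> s) \<le> C2 / (Im s)^2"
    "\<And>\<mu> s. \<bar>\<mu>\<bar> \<le> L + 1 \<Longrightarrow> \<bar>Im s\<bar> \<ge> 1 \<Longrightarrow> beta_factor \<mu> s =
        exp (- of_real \<mu> * Ln s - of_real ((\<mu>^2 + \<mu>) / 2) / s + e2 \<mu> s)"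
    using beta_factor_stirling[of "L + 1"] by metis
  define D where "D = ((L+1)^2 + (L+1)) / 2"
  define K where "K = G + D + \<bar>C1\<bar> + \<bar>C2\<bar>"
  define C where "C = N * (3 * K^2 * exp K + K)"
  have D0: "D \<ge> 0" using L(1) by (simp add: D_def)
  have K: "K > 0" using G(1) L(1) by (simp add: K_def D_def add_pos_pos add_pos_nonneg)
  show ?thesis
  proof (rule that[of C])
    show "C > 0" unfolding C_def using N K by (intro mult_pos_pos add_nonneg_pos) auto
    fix a :: "real^'p" and b :: "real^'q" and s :: complex
    assume ab: "norm (a, b) \<le> M" and mu: "fox_mu a b \<ge> 0" and s: "\<bar>Im s\<bar> \<ge> 1"
    define \<mu> where "\<mu> = fox_mu a b"
    define g where "g = fox_corr A B a b"
    define h where "h = \<bar>Im s\<bar>"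
    have h: "h \<ge> 1" "norm s \<ge> h" using s abs_Im_le_cmod[of s] by (auto simp: h_def)
    have h2: "h^2 = (Im s)^2" by (simp add: h_def)
    have s0: "s \<noteq> 0" using s by auto
    have m: "0 \<le> \<mu>" "\<mu> \<le> L" "\<bar>\<mu>\<bar> \<le> L + 1" "\<bar>\<mu> + 1\<bar> \<le> L + 1" using mu L(2)[OF ab] by (auto simp: \<mu>_def)
    have g: "\<bar>g\<bar> \<le> G" using G(2)[OF ab] by (simp add: g_def)
    have q: "\<bar>(x^2 + x) / 2\<bar> \<le> D" if "0 \<le> x" "x \<le> L + 1" for x
    proof -
      have "\<bar>(x^2 + x) / 2\<bar> = (x^2 + x) / 2" using that by simp
      also have "\<dots> \<le> D" unfolding D_def using that by (intro divide_right_mono add_mono power_mono) auto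
      finally show ?thesis .
    qed
    define w1 where "w1 = of_real (fox_gamma1 A B a b) / s + e1 a b s"
    define w where "w x = - of_real ((x^2 + x) / 2) / s + e2 x s" for x
    have bnd: "norm (of_real x / s + y) \<le> (X + \<bar>Y\<bar>) / h" if "\<bar>x\<bar> \<le> X" "norm y \<le> Y / (Im s)^2" for x X Y and y :: complex
    proof -
      have "norm (of_real x / s) \<le> X / h" using that h by (auto simp: norm_divide intro!: frac_le)
      moreover have "Y / (Im s)^2 \<le> \<bar>Y\<bar> / h"
        unfolding h2[symmetric] using h by (intro frac_le) (auto simp: self_le_power)
      ultimately show ?thesis
        using norm_triangle_ineq[of "of_real x / s" y] that by (simp add: add_divide_distrib)
    qed
    have mono: "X / h \<le> K / h" if "X \<le> K" for X using that h by (intro divide_right_mono) auto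
    have "\<bar>fox_gamma1 A B a b\<bar> \<le> G + D"
      using g q[of \<mu>] m unfolding g_def fox_corr_def \<mu>_def by linarith
    from bnd[OF this e1(1)[OF ab s]] have b1: "norm w1 \<le> K / h"
      unfolding w1_def by (rule order_trans) (intro mono, simp add: K_def)
    have bw: "norm (w x) \<le> K / h" if "0 \<le> x" "x \<le> L + 1" for x
    proof -
      have "norm (of_real (- ((x^2 + x) / 2)) / s + e2 x s) \<le> (D + \<bar>C2\<bar>) / h"
        using q[OF that] that by (intro bnd e2 s) auto
      also have "\<dots> \<le> K / h" using G(1) by (intro mono) (simp add: K_def)
      finally show ?thesis unfolding w_def by simp
    qed
    \<comment> \<open>\<open>fox_corr\<close> is defined so that all terms in 1/s cancel here and
      only errors of second order are left.\<close>
    have "w1 - w \<mu> - of_real g / s = e1 a b s - e2 \<mu> s"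
      using s0 unfolding w1_def w_def g_def fox_corr_def \<mu>_def[symmetric]
      by (simp add: divide_simps) (simp add: algebra_simps)
    moreover have "norm (e1 a b s - e2 \<mu> s) \<le> C1 / h^2 + C2 / h^2"
      unfolding h2 by (rule order_trans[OF norm_triangle_ineq4]) (intro add_mono e1 e2 ab s m)
    moreover have "C1 / h^2 + C2 / h^2 \<le> K / h^2"
      unfolding add_divide_distrib[symmetric] using G(1) D0 by (intro divide_right_mono) (auto simp: K_def)
    ultimately have d: "norm (w1 - w \<mu> - of_real g / s) \<le> K / h^2" by simp
    have "\<bar>g\<bar> \<le> K" using g D0 by (simp add: K_def)
    then have br: "norm (exp w1 - exp (w \<mu>) - of_real g / s * exp (w (\<mu> + 1))) \<le> (3 * K^2 * exp K + K) / h^2"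
      using m by (intro exp_difference_bound b1 bw d h) auto
    have f1: "fox_gammas A B a b s = of_real (fox_nu A B a b) * exp (s * of_real (ln (fox_rho A B))) * exp (- of_real \<mu> * Ln s) * exp w1"
      unfolding e1(2)[OF ab s] w1_def \<mu>_def by (simp add: exp_add[symmetric] add.assoc mult.assoc)
    have f2: "beta_factor \<mu> s = exp (- of_real \<mu> * Ln s) * exp (w \<mu>)"
      unfolding e2(2)[OF m(3) s] w_def by (simp add: exp_add[symmetric] algebra_simps)
    have "beta_factor (\<mu> + 1) s = exp (- of_real (\<mu> + 1) * Ln s) * exp (w (\<mu> + 1))"
      unfolding e2(2)[OF m(4) s] w_def by (simp add: exp_add[symmetric] algebra_simps)
    \<comment> \<open>Raising the parameter by one contributes a factor 1/s; this is why
      \<open>beta_factor (\<mu> + 1)\<close> can absorb the unmatched term.\<close>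
    also have "exp (- of_real (\<mu> + 1) * Ln s) = exp (- of_real \<mu> * Ln s) * (1 / s)"
      using s0 by (simp add: ring_distribs exp_diff exp_add)
    finally have f3: "beta_factor (\<mu> + 1) s = exp (- of_real \<mu> * Ln s) * (1 / s) * exp (w (\<mu> + 1))" .
    have "fox_rem A B a b s = of_real (fox_nu A B a b) * exp (s * of_real (ln (fox_rho A B))) * exp (- of_real \<mu> * Ln s) *
       (exp w1 - exp (w \<mu>) - of_real g / s * exp (w (\<mu> + 1)))"
      unfolding fox_rem_def \<mu>_def[symmetric] g_def[symmetric] f1 f2 f3 by (simp add: algebra_simps)
    also have "norm \<dots> \<le> N * exp (ln (fox_rho A B) * Re s) * 1 * ((3 * K^2 * exp K + K) / h^2)"
      unfolding norm_mult
    proof (intro mult_mono br norm_exp_neg_mult_Ln_le s m mult_nonneg_nonneg)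
      show "norm (complex_of_real (fox_nu A B a b)) \<le> N" using N(2)[OF ab] by simp
      show "norm (exp (s * complex_of_real (ln (fox_rho A B)))) \<le> exp (ln (fox_rho A B) * Re s)"
        by (simp add: norm_exp_eq_Re mult.commute)
    qed (use N in auto)
    finally show "norm (fox_rem A B a b s) \<le> C * exp (ln (fox_rho A B) * Re s) / (Im s)^2"
      by (simp add: C_def h2 mult_ac)
  qed
qed

section \<open>Loop integrals in the slit plane\<close>

lemma open_slit_plane: "open (- \<real>\<^sub>\<le>\<^sub>0 :: complex set)"
  by (simp add: open_Compl closed_nonpos_Reals_complex)

text \<open>A slit plane is starlike, so holomorphic functions on it have primitives. All loops and
  vertical lines used below avoid the slit, and their integrals reduce to endpoint values.\<close>

lemma slit_plane_primitive:
  assumes "f holomorphic_on - \<real>\<^sub>\<le>\<^sub>0"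
  obtains F where "\<And>s. s \<notin> \<real>\<^sub>\<le>\<^sub>0 \<Longrightarrow> (F has_field_derivative f s) (at s)"
proof -
  have "- \<real>\<^sub>\<le>\<^sub>0 = - (complex_of_real ` {..0})"
    by (auto simp: complex_nonpos_Reals_iff image_iff complex_eq_iff)
  then have "starlike (- \<real>\<^sub>\<le>\<^sub>0 :: complex set)" using starlike_slotted_complex_plane_left[of 0] by simp
  then have "\<exists>F. \<forall>s\<in>- \<real>\<^sub>\<le>\<^sub>0. (F has_field_derivative f s) (at s)"
    using assms open_slit_plane
    by (intro holomorphic_starlike_primitive[of _ _ "{}"])
       (auto intro: holomorphic_on_imp_continuous_on simp: holomorphic_on_open field_differentiable_def)
  then show ?thesis using that by auto
qed

context
  fixes f F :: "complex \<Rightarrow> complex"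
  assumes F: "\<And>s. s \<notin> \<real>\<^sub>\<le>\<^sub>0 \<Longrightarrow> (F has_field_derivative f s) (at s)"
begin

lemma primitive_has_contour_integral:
  assumes "valid_path g" "path_image g \<inter> \<real>\<^sub>\<le>\<^sub>0 = {}"
  shows "(f has_contour_integral (F (pathfinish g) - F (pathstart g))) g"
  by (rule contour_integral_primitive[where S = "- \<real>\<^sub>\<le>\<^sub>0"])
     (use assms F in \<open>auto intro: has_field_derivative_at_within\<close>)

lemma primitive_diff_bound:
  assumes "closed_segment u v \<inter> \<real>\<^sub>\<le>\<^sub>0 = {}" "D \<ge> 0" "\<And>s. s \<in> closed_segment u v \<Longrightarrow> norm (f s) \<le> D"
  shows "norm (F v - F u) \<le> D * norm (v - u)"
  using has_contour_integral_bound_linepath[OF primitive_has_contour_integral[of "linepath u v", simplified]] assms by simp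

text \<open>The loop meets the real axis only at c, which is positive. The integral therefore
  depends on the two ends alone, and in particular not on c.\<close>

lemma fox_loop_primitive:
  assumes "c > 0"
  shows "(f has_contour_integral (F (Complex (-R) 1) - F (Complex (-R) (-1)))) (fox_loop c R)"
proof -
  have "path_image (fox_loop c R) \<inter> \<real>\<^sub>\<le>\<^sub>0 = {}"
    using assms by (auto simp: fox_loop_def path_image_join closed_segment_same_Re closed_segment_same_Im
        closed_segment_eq_real_ivl complex_nonpos_Reals_iff)
  then show ?thesis
    using primitive_has_contour_integral[of "fox_loop c R"] by (simp add: fox_loop_def)
qed

end

lemma integrable_inverse_one_plus_square: "integrable lborel (\<lambda>t::real. 1 / (1 + t^2))"
  using integrable_inverse_1_plus_square by (simp add: set_integrable_def einterval_def divide_inverse)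

text \<open>For large R the ends of the loop are joined to the points 1/2 - iR and 1/2 + iR; the
  values of the primitive change by o(1) along these connections, and its increment between the two
  points is the truncated vertical integral.\<close>

lemma loop_limit_eq_vertical:
  fixes f :: "complex \<Rightarrow> complex"
  assumes hol: "f holomorphic_on - \<real>\<^sub>\<le>\<^sub>0" and c: "c > 0" and \<tau>: "\<tau> > 0"
    and bound: "\<And>s. \<bar>Im s\<bar> \<ge> 1 \<Longrightarrow> norm (f s) \<le> C * exp (\<tau> * Re s) / (Im s)^2"
    and vert: "\<And>t. norm (f (Complex (1/2) t)) \<le> D / (1 + t^2)"
  shows "((\<lambda>R. contour_integral (fox_loop c R) f) \<longlongrightarrow> \<i> * (LINT t|lborel. f (Complex (1/2) t))) at_top"
proof -
  obtain F where F: "\<And>s. s \<notin> \<real>\<^sub>\<le>\<^sub>0 \<Longrightarrow> (F has_field_derivative f s) (at s)"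
    using slit_plane_primitive[OF hol] by blast
  have "norm (f \<i>) \<le> C" using bound[of \<i>] by simp
  then have C: "C \<ge> 0" using norm_ge_zero order_trans by blast
  have loop: "contour_integral (fox_loop c R) f = F (Complex (-R) 1) - F (Complex (-R) (-1))" for R
    by (rule contour_integral_unique[OF fox_loop_primitive[OF F c]])
  \<comment> \<open>The connection first climbs at Re s = -T to height \<sigma> T, where exp
    (-\<tau> T) beats the length, and then runs horizontally to Re s = 1/2, where 1/T^2 beats the
    length T + 1/2.\<close>
  have seg: "norm (F (Complex (-T) \<sigma>) - F (Complex (1/2) (\<sigma> * T))) \<le> C * exp (- \<tau> * T) * T + C * exp (\<tau> / 2) / T^2 * (T + 1/2)"
    if T: "T \<ge> 1" and \<sigma>: "\<bar>\<sigma>\<bar> = 1" for T \<sigma>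
  proof -
    have \<sigma>': "\<sigma> = 1 \<or> \<sigma> = -1" using \<sigma> by auto
    have "norm (F (Complex (-T) \<sigma>) - F (Complex (-T) (\<sigma> * T))) \<le> C * exp (- \<tau> * T) * norm (Complex (-T) \<sigma> - Complex (-T) (\<sigma> * T))"
    proof (rule primitive_diff_bound[OF F])
      have im: "\<bar>Im s\<bar> \<ge> 1 \<and> Re s = -T" if "s \<in> closed_segment (Complex (- T) (\<sigma> * T)) (Complex (- T) \<sigma>)" for s
        using that T \<sigma>' by (auto simp: closed_segment_same_Re closed_segment_eq_real_ivl split: if_splits)
      show "closed_segment (Complex (- T) (\<sigma> * T)) (Complex (- T) \<sigma>) \<inter> \<real>\<^sub>\<le>\<^sub>0 = {}"
        using im by (fastforce simp: complex_nonpos_Reals_iff)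
      show "norm (f s) \<le> C * exp (- \<tau> * T)" if "s \<in> closed_segment (Complex (- T) (\<sigma> * T)) (Complex (- T) \<sigma>)" for s
      proof -
        have "norm (f s) \<le> C * exp (\<tau> * Re s) / (Im s)^2" using im[OF that] by (intro bound) auto
        also have "\<dots> \<le> C * exp (\<tau> * Re s) / 1"
          using im[OF that] C by (intro divide_left_mono) (auto simp: abs_le_square_iff[of 1, simplified])
        finally show ?thesis using im[OF that] by simp
      qed
    qed (use C in auto)
    moreover have "norm (Complex (-T) \<sigma> - Complex (-T) (\<sigma> * T)) \<le> T"
      using T \<sigma>' by (auto simp: cmod_def)
    ultimately have 1: "norm (F (Complex (-T) \<sigma>) - F (Complex (-T) (\<sigma> * T))) \<le> C * exp (- \<tau> * T) * T"
      using C by (meson exp_ge_zero mult_left_mono mult_nonneg_nonneg order_trans)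
    have "norm (F (Complex (-T) (\<sigma> * T)) - F (Complex (1/2) (\<sigma> * T))) \<le> C * exp (\<tau> / 2) / T^2 * norm (Complex (-T) (\<sigma> * T) - Complex (1/2) (\<sigma> * T))"
    proof (rule primitive_diff_bound[OF F])
      have im: "Im s = \<sigma> * T \<and> Re s \<le> 1/2" if "s \<in> closed_segment (Complex (1/2) (\<sigma> * T)) (Complex (- T) (\<sigma> * T))" for s
        using that T by (auto simp: closed_segment_same_Im closed_segment_eq_real_ivl split: if_splits)
      show "closed_segment (Complex (1/2) (\<sigma> * T)) (Complex (- T) (\<sigma> * T)) \<inter> \<real>\<^sub>\<le>\<^sub>0 = {}"
        using im T \<sigma>' by (fastforce simp: complex_nonpos_Reals_iff)
      show "norm (f s) \<le> C * exp (\<tau> / 2) / T^2" if "s \<in> closed_segment (Complex (1/2) (\<sigma> * T)) (Complex (- T) (\<sigma> * T))" for s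
      proof -
        have "norm (f s) \<le> C * exp (\<tau> * Re s) / (Im s)^2" using im[OF that] T \<sigma> by (intro bound) (auto simp: abs_mult)
        also have "\<dots> \<le> C * exp (\<tau> / 2) / (Im s)^2"
          using im[OF that] C \<tau> by (intro divide_right_mono mult_left_mono) (auto simp: mult_left_mono[of _ "1/2" \<tau>, simplified])
        also have "(Im s)^2 = T^2" using im[OF that] \<sigma>' by auto
        finally show ?thesis .
      qed
    qed (use C in auto)
    moreover have "norm (Complex (-T) (\<sigma> * T) - Complex (1/2) (\<sigma> * T)) = T + 1/2"
      using T by (simp add: cmod_def)
    ultimately have 2: "norm (F (Complex (-T) (\<sigma> * T)) - F (Complex (1/2) (\<sigma> * T))) \<le> C * exp (\<tau> / 2) / T^2 * (T + 1/2)" by simp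
    show ?thesis
      using norm_triangle_ineq[of "F (Complex (-T) \<sigma>) - F (Complex (-T) (\<sigma> * T))" "F (Complex (-T) (\<sigma> * T)) - F (Complex (1/2) (\<sigma> * T))"] 1 2
      by simp
  qed
  have lim0: "((\<lambda>T. C * exp (- \<tau> * T) * T + C * exp (\<tau> / 2) / T^2 * (T + 1/2)) \<longlongrightarrow> 0) at_top"
  proof -
    have "((\<lambda>T. exp (- \<tau> * T) * T) \<longlongrightarrow> 0) at_top" "((\<lambda>T::real. 1 / T^2 * (T + 1/2)) \<longlongrightarrow> 0) at_top"
      using \<tau> by real_asymp+
    from tendsto_add[OF tendsto_mult[OF tendsto_const[of C] this(1)] tendsto_mult[OF tendsto_const[of "C * exp (\<tau> / 2)"] this(2)]]
    show ?thesis by (simp add: mult.assoc)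
  qed
  have side: "((\<lambda>T. F (Complex (-T) \<sigma>) - F (Complex (1/2) (\<sigma> * T))) \<longlongrightarrow> 0) at_top" if "\<bar>\<sigma>\<bar> = 1" for \<sigma>
    by (rule Lim_null_comparison[OF _ lim0]) (use eventually_ge_at_top[of 1] in eventually_elim, rule seg, use that in auto)
  have cont: "continuous_on UNIV (\<lambda>t. f (Complex (1/2) t))"
  proof (rule continuous_on_compose2[OF holomorphic_on_imp_continuous_on[OF hol]])
    show "continuous_on UNIV (\<lambda>t. Complex (1/2) t)"
      unfolding Complex_eq by (intro continuous_intros)
  qed (auto simp: complex_nonpos_Reals_iff)
  have meas: "(\<lambda>t. f (Complex (1/2) t)) \<in> borel_measurable lborel"
    using borel_measurable_continuous_onI[OF cont] by simp
  have vlim: "((\<lambda>T. F (Complex (1/2) T) - F (Complex (1/2) (-T))) \<longlongrightarrow> \<i> * (LINT t|lborel. f (Complex (1/2) t))) at_top"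
  proof -
    have "((\<lambda>T. LINT t|lborel. indicator {-T..T} t *\<^sub>R (\<i> * f (Complex (1/2) t))) \<longlongrightarrow> (LINT t|lborel. \<i> * f (Complex (1/2) t))) at_top"
    proof (rule integral_dominated_convergence_at_top)
      show "integrable lborel (\<lambda>t. D * (1 / (1 + t^2)))"
        by (intro integrable_mult_right integrable_inverse_one_plus_square)
      show "AE t in lborel. ((\<lambda>T. indicator {-T..T} t *\<^sub>R (\<i> * f (Complex (1/2) t))) \<longlongrightarrow> \<i> * f (Complex (1/2) t)) at_top"
      proof (rule AE_I2)
        fix t :: real
        show "((\<lambda>T. indicator {-T..T} t *\<^sub>R (\<i> * f (Complex (1/2) t))) \<longlongrightarrow> \<i> * f (Complex (1/2) t)) at_top"
          by (rule tendsto_eventually, rule eventually_mono[OF eventually_ge_at_top[of "\<bar>t\<bar>"]]) (auto simp: indicator_def)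
      qed
      show "\<forall>\<^sub>F T in at_top. AE t in lborel. norm (indicator {-T..T} t *\<^sub>R (\<i> * f (Complex (1/2) t))) \<le> D * (1 / (1 + t^2))"
      proof (intro always_eventually allI AE_I2)
        fix T t :: real
        have "norm (indicator {-T..T} t *\<^sub>R (\<i> * f (Complex (1/2) t))) \<le> norm (f (Complex (1/2) t))"
          by (simp add: norm_mult indicator_def)
        then show "norm (indicator {-T..T} t *\<^sub>R (\<i> * f (Complex (1/2) t))) \<le> D * (1 / (1 + t^2))" using vert[of t] by simp
      qed
    qed (use meas in measurable)
    moreover have "\<forall>\<^sub>F T in at_top. (LINT t|lborel. indicator {-T..T} t *\<^sub>R (\<i> * f (Complex (1/2) t))) = F (Complex (1/2) T) - F (Complex (1/2) (-T))"
      using eventually_ge_at_top[of 0]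
    proof eventually_elim
      case (elim T)
      show ?case
      proof (rule integral_FTC_atLeastAtMost)
        show "-T \<le> T" using elim by simp
        fix x assume "-T \<le> x" "x \<le> T"
        have "(F has_field_derivative f (Complex (1/2) x)) (at (Complex (1/2) x))"
          by (rule F) (simp add: complex_nonpos_Reals_iff)
        moreover have "((\<lambda>t. Complex (1/2) t) has_vector_derivative \<i>) (at x within {-T..T})"
          unfolding Complex_eq by (auto intro!: derivative_eq_intros simp: has_vector_derivative_def scaleR_conv_of_real mult.commute)
        ultimately show "((\<lambda>t. F (Complex (1/2) t)) has_vector_derivative \<i> * f (Complex (1/2) x)) (at x within {-T..T})"
          using field_vector_diff_chain_within[of "\<lambda>t. Complex (1/2) t" \<i> x "{-T..T}" F "f (Complex (1/2) x)"]
          by (auto simp: o_def intro: has_field_derivative_at_within)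
      next
        show "continuous_on {-T..T} (\<lambda>t. \<i> * f (Complex (1/2) t))"
          by (intro continuous_intros continuous_on_subset[OF cont]) auto
      qed
    qed
    ultimately show ?thesis by (auto intro: Lim_transform_eventually)
  qed
  have "((\<lambda>R. (F (Complex (-R) 1) - F (Complex (1/2) (1 * R))) - (F (Complex (-R) (-1)) - F (Complex (1/2) ((-1) * R)))
      + (F (Complex (1/2) R) - F (Complex (1/2) (-R)))) \<longlongrightarrow> 0 - 0 + \<i> * (LINT t|lborel. f (Complex (1/2) t))) at_top"
    by (rule tendsto_add[OF tendsto_diff[OF side side] vlim]) auto
  then show ?thesis unfolding loop by simp
qed

section \<open>The loop integral of the beta factor\<close>

lemma add_one_notin_nonpos_Ints:
  assumes "s \<notin> \<real>\<^sub>\<le>\<^sub>0"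
  shows "s + 1 \<notin> (\<int>\<^sub>\<le>\<^sub>0 :: complex set)"
proof
  assume "s + 1 \<in> \<int>\<^sub>\<le>\<^sub>0"
  then obtain n :: int where n: "n \<le> 0" "s + 1 = of_int n" by (elim nonpos_Ints_cases)
  then have "s = of_real (of_int n - 1)" by (simp add: algebra_simps)
  then have "s \<in> \<real>\<^sub>\<le>\<^sub>0" using n by (simp add: complex_nonpos_Reals_iff)
  then show False using assms by simp
qed

lemma holomorphic_on_beta_factor [holomorphic_intros]:
  assumes "\<And>s. s \<in> S \<Longrightarrow> s + 1 \<notin> \<int>\<^sub>\<le>\<^sub>0"
  shows "beta_factor \<mu> holomorphic_on S"
proof -
  have "(\<lambda>s. Gamma (s + 1) * rGamma (s + 1 + of_real \<mu>)) holomorphic_on S"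
    using assms by (intro holomorphic_intros)
  then show ?thesis by (simp add: beta_factor_def[abs_def])
qed

text \<open>Boundedness suffices on the horizontal sides, since for 0 < y < 1 the factor exp (-s ln
  y) decays exponentially to the left.\<close>

lemma beta_factor_bounded:
  assumes "\<mu> \<ge> 0"
  obtains C where "C > 0" "\<And>s. \<bar>Im s\<bar> \<ge> 1 \<Longrightarrow> norm (beta_factor \<mu> s) \<le> C"
proof -
  obtain e :: "real \<Rightarrow> complex \<Rightarrow> complex" and C where
    e: "\<And>m s. \<bar>m\<bar> \<le> \<mu> \<Longrightarrow> \<bar>Im s\<bar> \<ge> 1 \<Longrightarrow> norm (e m s) \<le> C / (Im s)^2" and
    G: "\<And>m s. \<bar>m\<bar> \<le> \<mu> \<Longrightarrow> \<bar>Im s\<bar> \<ge> 1 \<Longrightarrow> beta_factor m s =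
        exp (- of_real m * Ln s - of_real ((m^2 + m) / 2) / s + e m s)"
    using beta_factor_stirling[of \<mu>] by metis
  define D where "D = (\<mu>^2 + \<mu>) / 2"
  show ?thesis
  proof (rule that[of "exp (D + \<bar>C\<bar>)"])
    fix s :: complex assume s: "\<bar>Im s\<bar> \<ge> 1"
    have m: "\<bar>\<mu>\<bar> \<le> \<mu>" using assms by simp
    have ns: "norm s \<ge> 1" using abs_Im_le_cmod[of s] s by simp
    have D: "D \<ge> 0" using assms by (simp add: D_def)
    have i: "(Im s)^2 \<ge> 1" using s by (simp add: abs_le_square_iff[of 1, simplified])
    have "norm (e \<mu> s) \<le> \<bar>C\<bar>"
      using e[OF m s] frac_le[of "\<bar>C\<bar>" C 1 "(Im s)^2"] i abs_ge_self[of C] by simp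
    moreover have "norm (of_real D / s) \<le> D"
      using frac_le[of D D 1 "norm s"] ns D by (simp add: norm_divide)
    ultimately have "norm (- of_real D / s + e \<mu> s) \<le> D + \<bar>C\<bar>"
      using norm_triangle_ineq[of "- of_real D / s" "e \<mu> s"] by simp
    then have "norm (exp (- of_real D / s + e \<mu> s)) \<le> exp (D + \<bar>C\<bar>)"
      by (meson exp_le_cancel_iff norm_exp order_trans)
    then have "norm (exp (- of_real \<mu> * Ln s)) * norm (exp (- of_real D / s + e \<mu> s)) \<le> 1 * exp (D + \<bar>C\<bar>)"
      using norm_exp_neg_mult_Ln_le[OF s assms] by (intro mult_mono) auto
    moreover have "beta_factor \<mu> s = exp (- of_real \<mu> * Ln s) * exp (- of_real D / s + e \<mu> s)"
      unfolding G[OF m s] D_def by (simp add: exp_add[symmetric] algebra_simps)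
    ultimately show "norm (beta_factor \<mu> s) \<le> exp (D + \<bar>C\<bar>)" by (simp add: norm_mult)
  qed simp
qed

text \<open>This shift carries a bound on the line Re s = -1/2 step by step to the lines Re s = -(N
  + 1/2).\<close>

lemma beta_factor_minus_one:
  assumes "s \<notin> \<int>\<^sub>\<le>\<^sub>0"
  shows "beta_factor \<mu> (s - 1) = (1 + of_real \<mu> / s) * beta_factor \<mu> s"
proof -
  have s0: "s \<noteq> 0" using assms by auto
  have "Gamma (s + 1) = s * Gamma s" using assms by (rule Gamma_plus1)
  moreover have "rGamma (s + of_real \<mu>) = (s + of_real \<mu>) * rGamma (s + of_real \<mu> + 1)"
    by (simp add: rGamma_plus1)
  ultimately show ?thesis using s0 by (simp add: beta_factor_def field_simps)
qed

text \<open>The product grows only polynomially in N, so the geometric factor wins. In the ratio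
  test (1 + y)/2 serves as a number strictly between y and 1.\<close>

lemma prod_power_tendsto_0:
  fixes y m :: real
  assumes "0 < y" "y < 1" "m \<ge> 0"
  shows "(\<lambda>N. (\<Prod>j<N. 1 + m / (real j + 1/2)) * y^N) \<longlonglongrightarrow> 0"
proof -
  define a where "a N = (\<Prod>j<N. 1 + m / (real j + 1/2)) * y^N" for N
  have "(\<lambda>N. (1 + m / (real N + 1/2)) * y) \<longlonglongrightarrow> y" by real_asymp
  then have "\<forall>\<^sub>F N in sequentially. (1 + m / (real N + 1/2)) * y < (1 + y) / 2"
    using assms by (intro order_tendstoD) auto
  then obtain N0 where N0: "\<And>N. N \<ge> N0 \<Longrightarrow> (1 + m / (real N + 1/2)) * y < (1 + y) / 2"
    by (auto simp: eventually_sequentially)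
  have "summable a"
  proof (rule summable_ratio_test)
    show "(1 + y) / 2 < 1" using assms by simp
    fix N assume N: "N \<ge> N0"
    have "norm (a (Suc N)) = ((1 + m / (real N + 1/2)) * y) * norm (a N)"
      using assms by (simp add: a_def abs_mult abs_of_nonneg add_nonneg_nonneg)
    also have "\<dots> \<le> (1 + y) / 2 * norm (a N)" using N0[OF N] by (intro mult_right_mono) auto
    finally show "norm (a (Suc N)) \<le> (1 + y) / 2 * norm (a N)" .
  qed
  then show ?thesis using summable_LIMSEQ_zero by (auto simp: a_def[abs_def])
qed

section \<open>The residue series of the beta kernel\<close>

text \<open>Iterated functional equation; it turns the residues into coefficients of the binomial
  series. In this form it also covers \<mu> = 0, where both sides vanish.\<close>

lemma rGamma_minus_nat:
  fixes \<mu> :: real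
  shows "rGamma (\<mu> - real n) = fact n * ((\<mu> - 1) gchoose n) * rGamma \<mu>"
proof (induction n)
  case (Suc n)
  have "rGamma (\<mu> - real (Suc n)) = (\<mu> - 1 - real n) * rGamma (\<mu> - real n)"
    using rGamma_plus1[of "\<mu> - real (Suc n)"] by (simp add: algebra_simps)
  also have "\<dots> = fact n * ((\<mu> - 1 - real n) * ((\<mu> - 1) gchoose n)) * rGamma \<mu>" unfolding Suc by simp
  also have "(\<mu> - 1 - real n) * ((\<mu> - 1) gchoose n) = real (Suc n) * ((\<mu> - 1) gchoose Suc n)"
    using gbinomial_mult_1[of "\<mu> - 1" n] by (simp add: algebra_simps)
  finally show ?case by (simp add: mult_ac)
qed simp

lemma beta_residue_sums:
  fixes \<mu> y :: real
  assumes "0 < y" "y < 1"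
  shows "(\<lambda>n. (-1)^n / fact n * rGamma (\<mu> - real n) * y^(n + 1)) sums (y * (1 - y) powr (\<mu> - 1) * rGamma \<mu>)"
proof -
  have "(\<lambda>n. y * rGamma \<mu> * (((\<mu> - 1) gchoose n) * (-y)^n)) sums (y * rGamma \<mu> * (1 + (-y)) powr (\<mu> - 1))"
    using assms by (intro sums_mult gen_binomial_real) auto
  moreover have "y * rGamma \<mu> * (((\<mu> - 1) gchoose n) * (-y)^n) = (-1)^n / fact n * rGamma (\<mu> - real n) * y^(n + 1)" for n
    unfolding rGamma_minus_nat power_minus[of y] by simp
  ultimately show ?thesis by (simp add: mult_ac)
qed

context
  fixes \<mu> y :: real and f :: "complex \<Rightarrow> complex"
  assumes y: "0 < y" "y < 1" and mu: "\<mu> \<ge> 0"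
    and f: "f = (\<lambda>s. beta_factor \<mu> s * exp (- s * of_real (ln y)))"
begin

lemma beta_kernel_holomorphic:
  assumes "\<And>s. s \<in> S \<Longrightarrow> s + 1 \<notin> \<int>\<^sub>\<le>\<^sub>0"
  shows "f holomorphic_on S"
  unfolding f using assms by (intro holomorphic_intros) auto

text \<open>\<open>Gamma (s + 1)\<close> has a simple pole with residue (-1)^n / n! at -(n + 1), and
  the other factors are entire. If \<open>rGamma\<close> vanishes there, the singularity is
  removable and the formula correctly gives 0.\<close>

lemma beta_kernel_residue:
  "residue f (- of_nat (Suc n)) = of_real ((-1)^n / fact n * rGamma (\<mu> - real n) * y^(n + 1))"
proof (rule residue_simple')
  let ?p = "- of_nat (Suc n) :: complex"
  show "open (ball ?p 1)" "?p \<in> ball ?p 1" by auto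
  show "f holomorphic_on (ball ?p 1 - {?p})"
  proof (rule beta_kernel_holomorphic)
    fix s assume s: "s \<in> ball ?p 1 - {?p}"
    show "s + 1 \<notin> \<int>\<^sub>\<le>\<^sub>0"
    proof
      assume "s + 1 \<in> \<int>\<^sub>\<le>\<^sub>0"
      then obtain k :: nat where "s + 1 = - of_nat k" by (elim nonpos_Ints_cases')
      then have k: "s = of_int (- int k - 1)" by (simp add: algebra_simps)
      have "dist ?p s = norm (of_int (int k - int n) :: complex)" unfolding k by (simp add: dist_norm)
      also have "\<dots> = of_int \<bar>int k - int n\<bar>" by (simp only: norm_of_int of_int_abs)
      finally have "\<bar>real k - real n\<bar> < 1" using s by (simp del: of_nat_Suc)
      then have "k = n" by linarith
      then show False using s k by (simp add: algebra_simps)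
    qed
  qed
  have "(\<lambda>z. Gamma (z + 1) * (z + 1 + of_nat n)) \<midarrow>(- of_nat n - 1) \<rightarrow> ((-1)^n / fact n :: complex)"
    using LIM_offset[OF Gamma_residues[of n, where ?'a = complex], of 1] by simp
  moreover have "- of_nat n - 1 = ?p" by simp
  ultimately have "(\<lambda>z. Gamma (z + 1) * (z + 1 + of_nat n)) \<midarrow>?p\<rightarrow> ((-1)^n / fact n :: complex)"
    by (simp only:)
  moreover have "(\<lambda>z. rGamma (z + 1 + of_real \<mu>) * exp (- z * of_real (ln y))) \<midarrow>?p\<rightarrow>
      rGamma (?p + 1 + of_real \<mu>) * exp (- ?p * of_real (ln y))"
    by (rule isContD) (intro continuous_intros)
  ultimately have "(\<lambda>z. Gamma (z + 1) * (z + 1 + of_nat n) * (rGamma (z + 1 + of_real \<mu>) * exp (- z * of_real (ln y))))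
      \<midarrow>?p\<rightarrow> (-1)^n / fact n * (rGamma (?p + 1 + of_real \<mu>) * exp (- ?p * of_real (ln y)))"
    by (rule tendsto_mult)
  moreover have "rGamma (?p + 1 + of_real \<mu>) = of_real (rGamma (\<mu> - real n))"
    by (simp add: rGamma_complex_of_real[symmetric])
  moreover have "exp (- ?p * of_real (ln y)) = of_real (y^(n + 1))"
  proof -
    have "- ?p * of_real (ln y) = of_real (real (Suc n) * ln y)" by simp
    then show ?thesis using y exp_of_nat_mult[of "Suc n" "ln y"] by (simp only: exp_of_real) simp
  qed
  ultimately show "(\<lambda>z. f z * (z - ?p)) \<midarrow>?p\<rightarrow> of_real ((-1)^n / fact n * rGamma (\<mu> - real n) * y^(n + 1))"
    by (simp add: f beta_factor_def algebra_simps)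
qed

text \<open>The left side at -(N + 1/2) passes between the poles -N and -(N + 1), so exactly N poles
  are enclosed. Three sides of the rectangle form the truncated loop, and the fourth is estimated
  separately.\<close>

lemma beta_kernel_rectpath:
  assumes "c > 0"
  shows "contour_integral (rectpath (Complex (- (real N + 1/2)) (-1)) (Complex c 1)) f
     = 2 * pi * \<i> * of_real (\<Sum>n<N. (-1)^n / fact n * rGamma (\<mu> - real n) * y^(n + 1))"
    and "contour_integral (rectpath (Complex (- (real N + 1/2)) (-1)) (Complex c 1)) f
     = contour_integral (fox_loop c (real N + 1/2)) f
       + contour_integral (linepath (Complex (- (real N + 1/2)) 1) (Complex (- (real N + 1/2)) (-1))) f"
proof -
  define a1 a3 where "a1 = Complex (- (real N + 1/2)) (-1)" and "a3 = Complex c 1"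
  \<comment> \<open>The half-plane contains the closed rectangle but stops before the next pole -(N
    + 1), so finitely many singularities remain.\<close>
  define S where "S = {s. Re s > - (real N + 3/4)}"
  define pts where "pts = (\<lambda>n. - of_nat (Suc n) :: complex) ` {..<N}"
  have hol: "f holomorphic_on S - pts"
  proof (rule beta_kernel_holomorphic)
    fix s assume s: "s \<in> S - pts"
    show "s + 1 \<notin> \<int>\<^sub>\<le>\<^sub>0"
    proof
      assume "s + 1 \<in> \<int>\<^sub>\<le>\<^sub>0"
      then obtain k :: nat where "s + 1 = - of_nat k" by (elim nonpos_Ints_cases')
      then have k: "s = - of_nat (Suc k)" by (simp add: eq_diff_eq[symmetric])
      then have "real k + 1 < real N + 3/4" using s by (simp add: S_def)
      then have "k < N" by linarith
      then show False using s k by (auto simp: pts_def)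
    qed
  qed
  have box: "p \<in> box a1 a3" if "p \<in> pts" for p
    using that assms by (auto simp: pts_def a1_def a3_def in_box_complex_iff)
  have le: "Re a1 \<le> Re a3" "Im a1 \<le> Im a3" using assms by (auto simp: a1_def a3_def)
  have cb: "cbox a1 a3 \<subseteq> S" by (auto simp: S_def a1_def a3_def in_cbox_complex_iff)
  have im: "path_image (rectpath a1 a3) \<subseteq> S - pts"
    unfolding path_image_rectpath_cbox_minus_box[OF le] using box cb by auto
  have "contour_integral (rectpath a1 a3) f = 2 * pi * \<i> * (\<Sum>p\<in>pts. winding_number (rectpath a1 a3) p * residue f p)"
  proof (rule Residue_theorem)
    show "open S" unfolding S_def by (rule open_halfspace_Re_gt)
    show "connected S" unfolding S_def by (intro convex_connected convex_halfspace_Re_gt)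
    show "\<forall>z. z \<notin> S \<longrightarrow> winding_number (rectpath a1 a3) z = 0"
      using cb by (auto intro!: winding_number_rectpath_outside le)
  qed (use hol im in \<open>auto simp: pts_def\<close>)
  also have "(\<Sum>p\<in>pts. winding_number (rectpath a1 a3) p * residue f p) = (\<Sum>p\<in>pts. residue f p)"
    by (intro sum.cong refl) (simp add: winding_number_rectpath[OF box])
  also have "\<dots> = (\<Sum>n<N. residue f (- of_nat (Suc n)))"
    unfolding pts_def by (subst sum.reindex) (auto simp: inj_on_def)
  also have "\<dots> = of_real (\<Sum>n<N. (-1)^n / fact n * rGamma (\<mu> - real n) * y^(n + 1))"
    unfolding beta_kernel_residue by simp
  finally show "contour_integral (rectpath (Complex (- (real N + 1/2)) (-1)) (Complex c 1)) f
     = 2 * pi * \<i> * of_real (\<Sum>n<N. (-1)^n / fact n * rGamma (\<mu> - real n) * y^(n + 1))"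
    unfolding a1_def a3_def .
  have int: "f contour_integrable_on linepath u v" if "closed_segment u v \<subseteq> path_image (rectpath a1 a3)" for u v
    using that im by (intro contour_integrable_continuous_linepath continuous_on_subset[OF holomorphic_on_imp_continuous_on[OF hol]]) auto
  have img: "path_image (rectpath a1 a3) =
      closed_segment (Complex (- (real N + 1/2)) (-1)) (Complex c (-1)) \<union> (closed_segment (Complex c (-1)) (Complex c 1)
      \<union> (closed_segment (Complex c 1) (Complex (- (real N + 1/2)) 1) \<union> closed_segment (Complex (- (real N + 1/2)) 1) (Complex (- (real N + 1/2)) (-1))))"
    by (simp add: rectpath_def Let_def path_image_join a1_def a3_def)
  have ints: "f contour_integrable_on linepath (Complex (- (real N + 1/2)) (-1)) (Complex c (-1))"
    "f contour_integrable_on linepath (Complex c (-1)) (Complex c 1)"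
    "f contour_integrable_on linepath (Complex c 1) (Complex (- (real N + 1/2)) 1)"
    "f contour_integrable_on linepath (Complex (- (real N + 1/2)) 1) (Complex (- (real N + 1/2)) (-1))"
    unfolding img by (rule int, unfold img, blast)+
  show "contour_integral (rectpath (Complex (- (real N + 1/2)) (-1)) (Complex c 1)) f
     = contour_integral (fox_loop c (real N + 1/2)) f
       + contour_integral (linepath (Complex (- (real N + 1/2)) 1) (Complex (- (real N + 1/2)) (-1))) f"
    using ints by (simp add: rectpath_def Let_def fox_loop_def contour_integral_join contour_integrable_joinI)
qed

text \<open>A bound K on the segment of Re s = -1/2 comes from compactness; each shift to the left
  multiplies it by at most 1 + \<mu> / (j + 1/2), while the exponential factor contributes
  y^N.\<close>

lemma beta_kernel_left_side:
  "(\<lambda>N. contour_integral (linepath (Complex (- (real N + 1/2)) 1) (Complex (- (real N + 1/2)) (-1))) f) \<longlonglongrightarrow> 0"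
proof -
  have nonint: "Complex (- (real N + 1/2)) t \<notin> \<int>" for N t
  proof
    assume "Complex (- (real N + 1/2)) t \<in> \<int>"
    then obtain k :: int where "Complex (- (real N + 1/2)) t = of_int k" by (elim Ints_cases)
    then have "- (real N + 1/2) = of_int k" by (metis Re_complex_of_real complex.sel(1) of_real_of_int_eq)
    then have "of_int (2 * k + 2 * int N + 1) = (0::real)" by simp
    then have "2 * k + 2 * int N + 1 = 0" by (simp only: of_int_eq_0_iff)
    then show False by presburger
  qed
  have nonint1: "Complex (- (real N + 1/2)) t + 1 \<notin> \<int>\<^sub>\<le>\<^sub>0" for N t
    using nonint[of N t] Ints_diff[of "Complex (- (real N + 1/2)) t + 1" 1] nonpos_Ints_Int by auto
  have "continuous_on {-1..1} (\<lambda>t. beta_factor \<mu> (Complex (-1/2) t))"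
  proof (rule continuous_on_compose2[of "range (Complex (-1/2))" "beta_factor \<mu>" _ "Complex (-1/2)"])
    show "continuous_on (range (Complex (-1/2))) (beta_factor \<mu>)"
      using nonint1[of 0] by (intro holomorphic_on_imp_continuous_on holomorphic_intros) auto
    have "continuous_on {-1..1} (\<lambda>t. Complex (-1/2) t)" unfolding Complex_eq by (intro continuous_intros)
    then show "continuous_on {-1..1} (Complex (-1/2))" by simp
  qed auto
  then have "bounded ((\<lambda>t. beta_factor \<mu> (Complex (-1/2) t)) ` {-1..1})"
    by (intro compact_imp_bounded compact_continuous_image) auto
  then obtain K where K: "K > 0" "\<And>t. \<bar>t\<bar> \<le> 1 \<Longrightarrow> norm (beta_factor \<mu> (Complex (-1/2) t)) \<le> K"
    unfolding bounded_pos by (auto simp: abs_le_iff)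
  have b: "norm (beta_factor \<mu> (Complex (- (real N + 1/2)) t)) \<le> K * (\<Prod>j<N. 1 + \<mu> / (real j + 1/2))" if "\<bar>t\<bar> \<le> 1" for N t
  proof (induction N)
    case 0
    then show ?case using K(2)[OF that] by simp
  next
    case (Suc N)
    define s where "s = Complex (- (real N + 1/2)) t"
    have "s \<notin> \<int>\<^sub>\<le>\<^sub>0" using nonint[of N t] nonpos_Ints_Int by (auto simp: s_def)
    have "Complex (- (real (Suc N) + 1/2)) t = s - 1" by (simp add: s_def complex_eq_iff)
    then have "beta_factor \<mu> (Complex (- (real (Suc N) + 1/2)) t) = (1 + of_real \<mu> / s) * beta_factor \<mu> s"
      using beta_factor_minus_one[OF \<open>s \<notin> \<int>\<^sub>\<le>\<^sub>0\<close>] by simp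
    moreover have "norm (1 + of_real \<mu> / s) \<le> 1 + \<mu> / (real N + 1/2)"
    proof -
      have "norm s \<ge> real N + 1/2" using abs_Re_le_cmod[of s] by (simp add: s_def)
      then have "norm (of_real \<mu> / s) \<le> \<mu> / (real N + 1/2)"
        using mu by (auto simp: norm_divide intro!: frac_le)
      then show ?thesis using norm_triangle_ineq[of 1 "of_real \<mu> / s"] by simp
    qed
    ultimately have "norm (beta_factor \<mu> (Complex (- (real (Suc N) + 1/2)) t)) \<le> (1 + \<mu> / (real N + 1/2)) * (K * (\<Prod>j<N. 1 + \<mu> / (real j + 1/2)))"
      using Suc mu unfolding s_def by (auto simp: norm_mult intro!: mult_mono)
    then show ?case by (simp add: mult_ac)
  qed
  have *: "norm (contour_integral (linepath (Complex (- (real N + 1/2)) 1) (Complex (- (real N + 1/2)) (-1))) f)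
      \<le> (K * ((\<Prod>j<N. 1 + \<mu> / (real j + 1/2)) * y^N)) * 2" for N
  proof -
    let ?u = "Complex (- (real N + 1/2)) 1" and ?v = "Complex (- (real N + 1/2)) (-1)"
    have seg: "\<exists>t. \<bar>t\<bar> \<le> 1 \<and> s = Complex (- (real N + 1/2)) t" if "s \<in> closed_segment ?u ?v" for s
      using that by (intro exI[of _ "Im s"]) (auto simp: closed_segment_same_Re closed_segment_eq_real_ivl complex_eq_iff)
    have pos: "0 \<le> (\<Prod>j<N. 1 + \<mu> / (real j + 1/2))" using mu by (intro prod_nonneg) auto
    have "norm (contour_integral (linepath ?u ?v) f) \<le> (K * ((\<Prod>j<N. 1 + \<mu> / (real j + 1/2)) * y^N)) * norm (?v - ?u)"
    proof (rule contour_integral_bound_linepath)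
      show "f contour_integrable_on linepath ?u ?v"
      proof (intro contour_integrable_continuous_linepath holomorphic_on_imp_continuous_on beta_kernel_holomorphic)
        show "s + 1 \<notin> \<int>\<^sub>\<le>\<^sub>0" if "s \<in> closed_segment ?u ?v" for s using seg[OF that] nonint1[of N] by auto
      qed
      show "0 \<le> K * ((\<Prod>j<N. 1 + \<mu> / (real j + 1/2)) * y^N)" using pos K y by simp
      fix s assume "s \<in> closed_segment ?u ?v"
      then obtain t where t: "\<bar>t\<bar> \<le> 1" "s = Complex (- (real N + 1/2)) t" using seg by blast
      have "norm (exp (- s * of_real (ln y))) = exp ((real N + 1/2) * ln y)"
        by (simp add: norm_exp_eq_Re t(2) algebra_simps)
      also have "\<dots> \<le> exp (real N * ln y)" using y by (auto simp: mult_right_mono_neg)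
      also have "\<dots> = y^N" using y exp_of_nat_mult[of N "ln y"] by simp
      finally have "norm (exp (- s * of_real (ln y))) \<le> y^N" .
      then have "norm (f s) \<le> (K * (\<Prod>j<N. 1 + \<mu> / (real j + 1/2))) * y^N"
        unfolding f norm_mult using b[OF t(1), of N] K pos unfolding t(2)[symmetric] by (intro mult_mono) auto
      then show "norm (f s) \<le> K * ((\<Prod>j<N. 1 + \<mu> / (real j + 1/2)) * y^N)" by simp
    qed
    moreover have "norm (?v - ?u) = 2" by (simp add: cmod_def)
    ultimately show ?thesis by simp
  qed
  have "(\<lambda>N. (K * ((\<Prod>j<N. 1 + \<mu> / (real j + 1/2)) * y^N)) * 2) \<longlonglongrightarrow> (K * 0) * 2"
    by (intro tendsto_intros prod_power_tendsto_0 y mu)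
  then show ?thesis by (intro Lim_null_comparison[OF always_eventually[OF allI[OF *]]]) simp
qed

text \<open>The residue theorem gives the limit along the half-integers. For other R the loop is
  compared with the nearest half-integer truncation to its right, which differs by two horizontal
  pieces of length at most 1 where the integrand is exponentially small.\<close>

lemma beta_kernel_loop_limit:
  assumes c: "c > 0"
  shows "((\<lambda>R. contour_integral (fox_loop c R) f) \<longlongrightarrow>
     2 * pi * \<i> * of_real (y * (1 - y) powr (\<mu> - 1) * rGamma \<mu>)) at_top"
proof -
  define L where "L = 2 * pi * \<i> * of_real (y * (1 - y) powr (\<mu> - 1) * rGamma \<mu>)"
  have "(\<lambda>N. of_real (\<Sum>n<N. (-1)^n / fact n * rGamma (\<mu> - real n) * y^(n + 1)) :: complex) \<longlonglongrightarrow>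
      of_real (y * (1 - y) powr (\<mu> - 1) * rGamma \<mu>)"
    using beta_residue_sums[OF y] unfolding sums_def by (rule tendsto_of_real)
  then have "(\<lambda>N. 2 * pi * \<i> * of_real (\<Sum>n<N. (-1)^n / fact n * rGamma (\<mu> - real n) * y^(n + 1))
      - contour_integral (linepath (Complex (- (real N + 1/2)) 1) (Complex (- (real N + 1/2)) (-1))) f) \<longlonglongrightarrow> L - 0"
    unfolding L_def by (intro tendsto_diff tendsto_mult_left beta_kernel_left_side)
  moreover have "2 * pi * \<i> * of_real (\<Sum>n<N. (-1)^n / fact n * rGamma (\<mu> - real n) * y^(n + 1))
      - contour_integral (linepath (Complex (- (real N + 1/2)) 1) (Complex (- (real N + 1/2)) (-1))) f
     = contour_integral (fox_loop c (real N + 1/2)) f" for N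
    using beta_kernel_rectpath(1)[OF c, of N] unfolding beta_kernel_rectpath(2)[OF c] by (simp add: algebra_simps)
  ultimately have sub: "(\<lambda>N. contour_integral (fox_loop c (real N + 1/2)) f) \<longlonglongrightarrow> L" by simp
  \<comment> \<open>Chosen so that N R + 1/2 is at most R and at least R - 1 once R \<ge> 1.\<close>
  define N :: "real \<Rightarrow> nat" where "N R = nat \<lfloor>R - 1/2\<rfloor>" for R
  have "filterlim N at_top at_top" unfolding N_def
    by (intro filterlim_compose[OF filterlim_nat_sequentially] filterlim_compose[OF filterlim_floor_sequentially]) real_asymp
  from filterlim_compose[OF sub this]
  have sub': "((\<lambda>R. contour_integral (fox_loop c (real (N R) + 1/2)) f) \<longlongrightarrow> L) at_top" .
  have "f holomorphic_on - \<real>\<^sub>\<le>\<^sub>0" by (rule beta_kernel_holomorphic) (use add_one_notin_nonpos_Ints in auto)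
  then obtain F where F: "\<And>s. s \<notin> \<real>\<^sub>\<le>\<^sub>0 \<Longrightarrow> (F has_field_derivative f s) (at s)"
    using slit_plane_primitive by blast
  have loop: "contour_integral (fox_loop c R) f = F (Complex (-R) 1) - F (Complex (-R) (-1))" for R
    by (rule contour_integral_unique[OF fox_loop_primitive[OF F c]])
  obtain C where C: "C > 0" "\<And>s. \<bar>Im s\<bar> \<ge> 1 \<Longrightarrow> norm (beta_factor \<mu> s) \<le> C"
    using beta_factor_bounded[OF mu] by blast
  have side: "norm (F (Complex (-R) \<sigma>) - F (Complex (- (real (N R) + 1/2)) \<sigma>)) \<le> C * exp (ln y * (R - 1))"
    if R: "R \<ge> 1" and \<sigma>: "\<bar>\<sigma>\<bar> = 1" for R \<sigma>
  proof -
    have N: "real (N R) + 1/2 \<le> R" "R - 1 \<le> real (N R) + 1/2" using R unfolding N_def by linarith+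
    let ?u = "Complex (- (real (N R) + 1/2)) \<sigma>" and ?v = "Complex (-R) \<sigma>"
    have s: "Im s = \<sigma> \<and> Re s \<le> - (R - 1)" if "s \<in> closed_segment ?u ?v" for s
      using that N by (auto simp: closed_segment_same_Im closed_segment_eq_real_ivl split: if_splits)
    have "norm (F ?v - F ?u) \<le> C * exp (ln y * (R - 1)) * norm (?v - ?u)"
    proof (rule primitive_diff_bound[OF F])
      show "closed_segment ?u ?v \<inter> \<real>\<^sub>\<le>\<^sub>0 = {}" using s \<sigma> by (fastforce simp: complex_nonpos_Reals_iff)
      fix z assume z: "z \<in> closed_segment ?u ?v"
      have "norm (exp (- z * of_real (ln y))) = exp (ln y * (- Re z))" by (simp add: norm_exp_eq_Re mult.commute)
      also have "\<dots> \<le> exp (ln y * (R - 1))"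
        unfolding exp_le_cancel_iff using s[OF z] y by (intro mult_left_mono_neg) auto
      finally show "norm (f z) \<le> C * exp (ln y * (R - 1))"
        unfolding f norm_mult using s[OF z] \<sigma> C by (intro mult_mono) auto
    qed (use C in auto)
    also have "\<dots> \<le> C * exp (ln y * (R - 1)) * 1"
      using C N by (intro mult_left_mono) (auto simp: cmod_def)
    finally show ?thesis by simp
  qed
  have "((\<lambda>R. contour_integral (fox_loop c R) f - contour_integral (fox_loop c (real (N R) + 1/2)) f) \<longlongrightarrow> 0) at_top"
  proof (rule Lim_null_comparison)
    show "\<forall>\<^sub>F R in at_top. norm (contour_integral (fox_loop c R) f - contour_integral (fox_loop c (real (N R) + 1/2)) f)
        \<le> 2 * C * exp (ln y * (R - 1))"
      using eventually_ge_at_top[of 1]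
    proof eventually_elim
      case (elim R)
      have eq: "contour_integral (fox_loop c R) f - contour_integral (fox_loop c (real (N R) + 1/2)) f
         = (F (Complex (-R) 1) - F (Complex (- (real (N R) + 1/2)) 1)) - (F (Complex (-R) (-1)) - F (Complex (- (real (N R) + 1/2)) (-1)))"
        unfolding loop by simp
      show ?case unfolding eq
        by (rule order_trans[OF norm_triangle_ineq4]) (use side[OF elim, of 1] side[OF elim, of "-1"] in simp)
    qed
    have "ln y < 0" using y by simp
    then show "((\<lambda>R. 2 * C * exp (ln y * (R - 1))) \<longlongrightarrow> 0) at_top" by real_asymp
  qed
  from tendsto_add[OF this sub'] show ?thesis by (simp add: L_def)
qed

end

section \<open>Decomposition of the H function\<close>

lemma continuous_on_Gamma_Re_pos:
  fixes f :: "'a::topological_space \<Rightarrow> complex"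
  assumes "continuous_on S f" "\<And>x. x \<in> S \<Longrightarrow> Re (f x) > 0"
  shows "continuous_on S (\<lambda>x. Gamma (f x))"
proof (rule continuous_on_compose2[OF _ assms(1)])
  show "continuous_on {z. Re z > 0} (Gamma :: complex \<Rightarrow> complex)"
    by (rule continuous_on_Gamma) (auto elim!: nonpos_Ints_cases)
qed (use assms in auto)

lemma continuous_on_rGamma_comp:
  fixes f :: "'a::topological_space \<Rightarrow> complex"
  assumes "continuous_on S f"
  shows "continuous_on S (\<lambda>x. rGamma (f x))"
  by (rule continuous_on_compose2[OF continuous_on_rGamma[of UNIV] assms]) auto

text \<open>On this line the arguments of all Gamma factors have positive real part, because A_k / 2
  + a_k > 0; joint continuity in the parameters and the height follows.\<close>

lemma continuous_on_fox_rem: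
  fixes A :: "real^'p" and B :: "real^'q" and S :: "(((real^'p) \<times> (real^'q)) \<times> real) set"
  assumes Apos: "\<forall>k. A$k > 0" and Bpos: "\<forall>j. B$j > 0"
    and S: "\<And>x k. x \<in> S \<Longrightarrow> fst (fst x) $ k \<ge> 0"
  shows "continuous_on S (\<lambda>x. fox_rem A B (fst (fst x)) (snd (fst x)) (Complex (1/2) (snd x)))"
proof -
  have c: "continuous_on S (\<lambda>x. Complex (1/2) (snd x))" unfolding Complex_eq by (intro continuous_intros)
  have mu: "continuous_on S (\<lambda>x. fox_mu (fst (fst x)) (snd (fst x)))"
    by (rule continuous_on_compose2[OF continuous_on_fox_mu[of UNIV], of _ fst]) (auto intro: continuous_intros)
  have nu: "continuous_on S (\<lambda>x. fox_nu A B (fst (fst x)) (snd (fst x)))"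
    by (rule continuous_on_compose2[OF continuous_on_fox_nu[OF Apos Bpos, of UNIV], of _ fst]) (auto intro: continuous_intros)
  have co: "continuous_on S (\<lambda>x. fox_corr A B (fst (fst x)) (snd (fst x)))"
    by (rule continuous_on_compose2[OF continuous_on_fox_corr[OF Apos Bpos, of UNIV], of _ fst]) (auto intro: continuous_intros)
  have G: "continuous_on S (\<lambda>x. Gamma (of_real (A$k) * Complex (1/2) (snd x) + of_real (fst (fst x) $ k)))" for k
    by (intro continuous_on_Gamma_Re_pos continuous_intros c) (use Apos S in \<open>auto intro!: add_pos_nonneg\<close>)
  have rG: "continuous_on S (\<lambda>x. rGamma (of_real (B$k) * Complex (1/2) (snd x) + of_real (snd (fst x) $ k)))" for k
    by (intro continuous_on_rGamma_comp continuous_intros c)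
  have b: "continuous_on S (\<lambda>x. beta_factor (m x) (Complex (1/2) (snd x)))" if "continuous_on S m" for m :: "_ \<Rightarrow> real"
    unfolding beta_factor_def
    by (intro continuous_on_mult continuous_on_Gamma_Re_pos continuous_on_rGamma_comp continuous_intros c that) auto
  show ?thesis
    unfolding fox_rem_def fox_gammas_def by (intro continuous_intros G rG b mu nu co c)
qed

text \<open>For |t| \<ge> 1 the asymptotic estimate applies. The middle part |t| \<le> 1 is not
  covered by it and is handled by compactness, jointly in t and the parameters, to keep the bound
  uniform.\<close>

lemma fox_rem_vertical_bound:
  fixes A :: "real^'p" and B :: "real^'q"
  assumes Apos: "\<forall>k. A$k > 0" and Bpos: "\<forall>j. B$j > 0"
    and balance: "(\<Sum>j\<in>UNIV. B$j) - (\<Sum>k\<in>UNIV. A$k) = 0"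
  obtains D where "D > 0" "\<And>a b t. norm (a, b) \<le> M \<Longrightarrow> (\<forall>k. a$k \<ge> 0) \<Longrightarrow> fox_mu a b \<ge> 0 \<Longrightarrow>
      norm (fox_rem A B a b (Complex (1/2) t)) \<le> D / (1 + t^2)"
proof -
  obtain C where C: "C > 0" "\<And>a b s. norm (a, b) \<le> M \<Longrightarrow> fox_mu a b \<ge> 0 \<Longrightarrow> \<bar>Im s\<bar> \<ge> 1 \<Longrightarrow>
      norm (fox_rem A B a b s) \<le> C * exp (ln (fox_rho A B) * Re s) / (Im s)^2"
    using fox_rem_bound[OF assms, of M] by blast
  define W :: "(((real^'p) \<times> (real^'q)) \<times> real) set"
    where "W = (cball 0 M \<inter> {x. \<forall>k. fst x $ k \<ge> 0}) \<times> {-1..1}"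
  have "closed {x :: (real^'p) \<times> (real^'q). \<forall>k. fst x $ k \<ge> 0}"
    by (intro closed_Collect_all closed_Collect_le continuous_intros)
  then have "compact W" unfolding W_def by (intro compact_Times compact_Int_closed) auto
  moreover have "continuous_on W (\<lambda>x. fox_rem A B (fst (fst x)) (snd (fst x)) (Complex (1/2) (snd x)))"
    by (rule continuous_on_fox_rem[OF Apos Bpos]) (auto simp: W_def)
  ultimately have "bounded ((\<lambda>x. fox_rem A B (fst (fst x)) (snd (fst x)) (Complex (1/2) (snd x))) ` W)"
    by (intro compact_imp_bounded compact_continuous_image)
  then obtain K where K: "K > 0" "\<And>x. x \<in> W \<Longrightarrow> norm (fox_rem A B (fst (fst x)) (snd (fst x)) (Complex (1/2) (snd x))) \<le> K"
    unfolding bounded_pos by auto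
  define E where "E = C * exp (ln (fox_rho A B) * (1/2))"
  have E: "E > 0" using C by (simp add: E_def)
  show ?thesis
  \<comment> \<open>The factor 2 serves both ranges: 1 + t^2 \<le> 2 inside and 1 + t^2 \<le> 2 t^2
    outside.\<close>
  proof (rule that[of "2 * (K + E)"])
    show "2 * (K + E) > 0" using K E by simp
    fix a :: "real^'p" and b :: "real^'q" and t :: real
    assume ab: "norm (a, b) \<le> M" "\<forall>k. a$k \<ge> 0" "fox_mu a b \<ge> 0"
    have p: "1 + t^2 > 0" by (simp add: add_pos_nonneg)
    show "norm (fox_rem A B a b (Complex (1/2) t)) \<le> 2 * (K + E) / (1 + t^2)"
    proof (cases "\<bar>t\<bar> \<le> 1")
      case True
      have "((a, b), t) \<in> W" using ab True by (auto simp: W_def abs_le_iff)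
      from K(2)[OF this] have "norm (fox_rem A B a b (Complex (1/2) t)) \<le> K" by simp
      also have "\<dots> \<le> 2 * (K + E) / (1 + t^2)"
      proof -
        have "t^2 \<le> 1" using True by (simp add: abs_square_le_1)
        then have "K * (1 + t^2) \<le> K * 2" using K by (intro mult_left_mono) auto
        then show ?thesis using p E by (simp add: pos_le_divide_eq)
      qed
      finally show ?thesis .
    next
      case False
      then have t2: "t^2 \<ge> 1" using abs_square_le_1[of t] by linarith
      have "norm (fox_rem A B a b (Complex (1/2) t)) \<le> E / t^2"
        using C(2)[OF ab(1,3), of "Complex (1/2) t"] False by (simp add: E_def)
      also have "\<dots> \<le> 2 * (K + E) / (1 + t^2)"
      proof -
        have "E * (1 + t^2) \<le> E * (2 * t^2)" using t2 E by (intro mult_left_mono) auto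
        also have "\<dots> \<le> 2 * (K + E) * t^2" using K by (simp add: algebra_simps)
        finally show ?thesis using p t2 K(1) E by (simp add: divide_simps)
      qed
      finally show ?thesis .
    qed
  qed
qed

text \<open>Nonnegativity of a puts every pole -(a + n)/A on the slit.\<close>

lemma affine_notin_nonpos_Ints:
  fixes s :: complex
  assumes "s \<notin> \<real>\<^sub>\<le>\<^sub>0" "A > 0" "a \<ge> 0"
  shows "of_real A * s + of_real a \<notin> \<int>\<^sub>\<le>\<^sub>0"
proof
  assume "of_real A * s + of_real a \<in> \<int>\<^sub>\<le>\<^sub>0"
  then obtain n :: int where n: "n \<le> 0" "of_real A * s + of_real a = of_int n" by (elim nonpos_Ints_cases)
  then have "A * Re s + a = of_int n" "A * Im s = 0" by (auto simp: complex_eq_iff)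
  then have "Im s = 0" "A * Re s \<le> 0" using assms n by auto
  then have "s \<in> \<real>\<^sub>\<le>\<^sub>0" using assms by (simp add: complex_nonpos_Reals_iff mult_le_0_iff)
  then show False using assms by simp
qed

lemma fox_rem_holomorphic:
  fixes A a :: "real^'p" and B b :: "real^'q"
  assumes "\<forall>k. A$k > 0" "\<forall>k. a$k \<ge> 0"
  shows "fox_rem A B a b holomorphic_on - \<real>\<^sub>\<le>\<^sub>0"
proof -
  have "(\<lambda>s. fox_gammas A B a b s
     - of_real (fox_nu A B a b) * exp (s * of_real (ln (fox_rho A B))) *
       (beta_factor (fox_mu a b) s + of_real (fox_corr A B a b) * beta_factor (fox_mu a b + 1) s)) holomorphic_on - \<real>\<^sub>\<le>\<^sub>0"
    unfolding fox_gammas_def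
    by (intro holomorphic_intros affine_notin_nonpos_Ints add_one_notin_nonpos_Ints) (use assms in auto)
  then show ?thesis unfolding fox_rem_def[abs_def] .
qed

section \<open>Beta densities plus an inverse Mellin integral\<close>

text \<open>The inverse Mellin transform of the remainder along Re s = 1/2; the i from ds has been
  cancelled against 2 pi i.\<close>

definition fox_smooth :: "real^'p \<Rightarrow> real^'q \<Rightarrow> real^'p \<Rightarrow> real^'q \<Rightarrow> real \<Rightarrow> complex" where
  "fox_smooth A B a b x =
     (LINT t|lborel. fox_rem A B a b (Complex (1/2) t) * exp (- Complex (1/2) t * of_real (ln x))) / (2 * of_real pi)"

text \<open>At \<mu> = 0 this is the zero function, because \<open>rGamma 0\<close> is 0.\<close>

definition beta_density :: "real \<Rightarrow> real \<Rightarrow> real" where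
  "beta_density \<mu> y = y * (1 - y) powr (\<mu> - 1) * rGamma \<mu>"

text \<open>The integrand splits according to the definition of \<open>fox_rem\<close>; in the two
  beta parts \<rho>^s and x^(-s) combine to y^(-s) with y = x/\<rho>. The case \<mu> = 0 is included
  on purpose: it is the case of the limit parameters.\<close>

lemma fox_H_eq:
  fixes A a :: "real^'p" and B b :: "real^'q"
  assumes Apos: "\<forall>k. A$k > 0" and Bpos: "\<forall>j. B$j > 0"
    and balance: "(\<Sum>j\<in>UNIV. B$j) - (\<Sum>k\<in>UNIV. A$k) = 0"
    and a: "\<forall>k. a$k \<ge> 0" and mu: "fox_mu a b \<ge> 0" and x: "0 < x" "x < fox_rho A B"
  shows "fox_H A B a b x = of_real (fox_nu A B a b * beta_density (fox_mu a b) (x / fox_rho A B))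
     + of_real (fox_nu A B a b * fox_corr A B a b * beta_density (fox_mu a b + 1) (x / fox_rho A B))
     + fox_smooth A B a b x"
proof -
  define \<rho> \<mu> \<nu> g c where "\<rho> = fox_rho A B" and "\<mu> = fox_mu a b" and "\<nu> = fox_nu A B a b"
    and "g = fox_corr A B a b" and "c = fox_c A a"
  define y where "y = x / \<rho>"
  have rho: "\<rho> > 0" using fox_rho_pos[OF Apos Bpos] by (simp add: \<rho>_def)
  have y: "0 < y" "y < 1" using x rho by (auto simp: y_def \<rho>_def)
  have lny: "ln y = ln x - ln \<rho>" using x rho by (simp add: y_def ln_div)
  have c: "c > 0" unfolding c_def fox_c_def using Apos by (intro add_pos_nonneg sum_nonneg) (auto simp: less_imp_le)
  have mu': "\<mu> \<ge> 0" "\<mu> + 1 \<ge> 0" using mu by (auto simp: \<mu>_def)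
  define f1 where "f1 = (\<lambda>s. beta_factor \<mu> s * exp (- s * of_real (ln y)))"
  define f2 where "f2 = (\<lambda>s. beta_factor (\<mu> + 1) s * exp (- s * of_real (ln y)))"
  define f3 where "f3 = (\<lambda>s. fox_rem A B a b s * exp (- s * of_real (ln x)))"
  have eq: "fox_integrand A B a b x = (\<lambda>s. of_real \<nu> * f1 s + of_real (\<nu> * g) * f2 s + f3 s)"
  proof
    fix s :: complex
    have "of_real x powr (- s) = exp (- s * of_real (ln x))"
      using x by (simp add: powr_def Ln_of_real)
    then have "fox_integrand A B a b x s = fox_gammas A B a b s * exp (- s * of_real (ln x))"
      by (simp add: fox_integrand_def fox_gammas_def)
    moreover have "fox_gammas A B a b s = fox_rem A B a b s + of_real \<nu> * exp (s * of_real (ln \<rho>)) *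
       (beta_factor \<mu> s + of_real g * beta_factor (\<mu> + 1) s)"
      by (simp add: fox_rem_def \<nu>_def \<rho>_def \<mu>_def g_def)
    moreover have "exp (- s * of_real (ln y)) = exp (s * of_real (ln \<rho>)) * exp (- s * of_real (ln x))"
      unfolding exp_add[symmetric] lny by (simp add: algebra_simps)
    ultimately show "fox_integrand A B a b x s = of_real \<nu> * f1 s + of_real (\<nu> * g) * f2 s + f3 s"
      unfolding f1_def f2_def f3_def by (simp add: algebra_simps)
  qed
  have l1: "((\<lambda>R. contour_integral (fox_loop c R) f1) \<longlongrightarrow> 2 * pi * \<i> * of_real (beta_density \<mu> y)) at_top"
    unfolding beta_density_def by (rule beta_kernel_loop_limit[OF y mu'(1) f1_def c])
  have l2: "((\<lambda>R. contour_integral (fox_loop c R) f2) \<longlongrightarrow> 2 * pi * \<i> * of_real (beta_density (\<mu> + 1) y)) at_top"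
    unfolding beta_density_def by (rule beta_kernel_loop_limit[OF y mu'(2) f2_def c])
  have hol: "f1 holomorphic_on - \<real>\<^sub>\<le>\<^sub>0" "f2 holomorphic_on - \<real>\<^sub>\<le>\<^sub>0" "f3 holomorphic_on - \<real>\<^sub>\<le>\<^sub>0"
    unfolding f1_def f2_def f3_def
    by (intro holomorphic_intros fox_rem_holomorphic[OF Apos a] add_one_notin_nonpos_Ints; simp)+
  have int: "f contour_integrable_on fox_loop c R" if hf: "f holomorphic_on - \<real>\<^sub>\<le>\<^sub>0" for f R
  proof -
    obtain F where "\<And>s. s \<notin> \<real>\<^sub>\<le>\<^sub>0 \<Longrightarrow> (F has_field_derivative f s) (at s)"
      using slit_plane_primitive[OF hf] by blast
    from fox_loop_primitive[OF this c] show ?thesis unfolding contour_integrable_on_def by blast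
  qed
  have l3: "((\<lambda>R. contour_integral (fox_loop c R) f3) \<longlongrightarrow> \<i> * (LINT t|lborel. f3 (Complex (1/2) t))) at_top"
  proof -
    obtain C where C0: "C > 0" "\<And>a' b' s. norm (a', b') \<le> norm (a, b) \<Longrightarrow> fox_mu a' b' \<ge> 0 \<Longrightarrow> \<bar>Im s\<bar> \<ge> 1 \<Longrightarrow>
        norm (fox_rem A B a' b' s) \<le> C * exp (ln (fox_rho A B) * Re s) / (Im s)^2"
      using fox_rem_bound[OF Apos Bpos balance, of "norm (a, b)"] by blast
    have C: "norm (fox_rem A B a b s) \<le> C * exp (ln \<rho> * Re s) / (Im s)^2" if "\<bar>Im s\<bar> \<ge> 1" for s
      using C0(2)[OF order_refl mu that] by (simp add: \<rho>_def)
    obtain D where D0: "D > 0" "\<And>a' b' t. norm (a', b') \<le> norm (a, b) \<Longrightarrow> (\<forall>k. a'$k \<ge> 0) \<Longrightarrow> fox_mu a' b' \<ge> 0 \<Longrightarrow>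
        norm (fox_rem A B a' b' (Complex (1/2) t)) \<le> D / (1 + t^2)"
      using fox_rem_vertical_bound[OF Apos Bpos balance, of "norm (a, b)"] by blast
    note D = D0(2)[OF order_refl a mu]
    show ?thesis
    \<comment> \<open>The decay rate -ln y is positive exactly because x < \<rho>: the growth
      \<rho>^s of the remainder is combined with x^(-s).\<close>
    proof (rule loop_limit_eq_vertical[OF hol(3) c, of "- ln y" C "D * exp (- ln x / 2)"])
      show "0 < - ln y" using y by simp
      fix s :: complex assume s: "\<bar>Im s\<bar> \<ge> 1"
      have "norm (f3 s) = norm (fox_rem A B a b s) * exp (- Re s * ln x)"
        by (simp add: f3_def norm_mult norm_exp_eq_Re)
      also have "\<dots> \<le> (C * exp (ln \<rho> * Re s) / (Im s)^2) * exp (- Re s * ln x)"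
        by (intro mult_right_mono C s) auto
      also have "\<dots> = C * (exp (ln \<rho> * Re s) * exp (- Re s * ln x)) / (Im s)^2" by simp
      also have "exp (ln \<rho> * Re s) * exp (- Re s * ln x) = exp (- ln y * Re s)"
        unfolding exp_add[symmetric] lny by (simp add: algebra_simps)
      finally show "norm (f3 s) \<le> C * exp (- ln y * Re s) / (Im s)^2" .
    next
      fix t
      have "norm (f3 (Complex (1/2) t)) = norm (fox_rem A B a b (Complex (1/2) t)) * exp (- ln x / 2)"
        by (simp add: f3_def norm_mult norm_exp_eq_Re)
      also have "\<dots> \<le> D / (1 + t^2) * exp (- ln x / 2)" by (intro mult_right_mono D) auto
      finally show "norm (f3 (Complex (1/2) t)) \<le> D * exp (- ln x / 2) / (1 + t^2)" by simp
    qed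
  qed
  have "((\<lambda>R. of_real \<nu> * contour_integral (fox_loop c R) f1 + of_real (\<nu> * g) * contour_integral (fox_loop c R) f2
       + contour_integral (fox_loop c R) f3) \<longlongrightarrow>
      of_real \<nu> * (2 * pi * \<i> * of_real (beta_density \<mu> y)) + of_real (\<nu> * g) * (2 * pi * \<i> * of_real (beta_density (\<mu> + 1) y))
       + \<i> * (LINT t|lborel. f3 (Complex (1/2) t))) at_top" (is "(_ \<longlongrightarrow> ?L) _")
    by (intro tendsto_add tendsto_mult tendsto_const l1 l2 l3)
  moreover have "of_real \<nu> * contour_integral (fox_loop c R) f1 + of_real (\<nu> * g) * contour_integral (fox_loop c R) f2
       + contour_integral (fox_loop c R) f3 = contour_integral (fox_loop c R) (fox_integrand A B a b x)" for R
    unfolding eq using int[OF hol(1)] int[OF hol(2)] int[OF hol(3)]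
    by (simp add: contour_integral_add contour_integral_lmul contour_integrable_add contour_integrable_lmul)
  ultimately have "Lim at_top (\<lambda>R. contour_integral (fox_loop c R) (fox_integrand A B a b x)) = ?L"
    by (intro tendsto_Lim) auto
  then have "fox_H A B a b x = ?L / (2 * of_real pi * \<i>)" unfolding fox_H_def c_def by simp
  also have "\<dots> = of_real (\<nu> * beta_density \<mu> y) + of_real (\<nu> * g * beta_density (\<mu> + 1) y) + (LINT t|lborel. f3 (Complex (1/2) t)) / (2 * of_real pi)"
    by (simp add: field_simps)
  finally show ?thesis
    unfolding fox_smooth_def f3_def \<nu>_def \<mu>_def y_def \<rho>_def g_def .
qed

section \<open>Concentration of the beta density\<close>

lemma has_integral_nonneg_lborel:
  fixes f :: "real \<Rightarrow> real"
  assumes "(f has_integral I) {a..b}" "\<And>x. x \<in> {a..b} \<Longrightarrow> f x \<ge> 0" "f \<in> borel_measurable borel"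
  shows "set_integrable lborel {a..b} f" "(LINT x:{a..b}|lborel. f x) = I"
proof -
  have "f absolutely_integrable_on {a..b}"
    using assms by (intro nonnegative_absolutely_integrable_1) auto
  moreover have "(\<lambda>x. indicator {a..b} x *\<^sub>R f x) \<in> borel_measurable lborel"
    using assms(3) by measurable
  ultimately show s: "set_integrable lborel {a..b} f"
    unfolding set_integrable_def by (subst (asm) integrable_completion) auto
  show "(LINT x:{a..b}|lborel. f x) = I"
    using set_borel_integral_eq_integral(2)[OF s] assms(1) by (simp add: integral_unique)
qed

text \<open>The decomposition of H is available only for 0 < x < \<rho>; the endpoints form a null
  set.\<close>

lemma Icc_Ioo_lborel:
  fixes f :: "real \<Rightarrow> 'b::{banach, second_countable_topology}"
  shows "set_integrable lborel {a..b} f \<longleftrightarrow> set_integrable lborel {a<..<b} f"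
    and "(LINT x:{a..b}|lborel. f x) = (LINT x:{a<..<b}|lborel. f x)"
  by (rule set_integrable_discrete_difference[of "{a, b}"] set_integral_discrete_difference[of "{a, b}"]; force)+

text \<open>For m < 1 the integrand is singular at \<rho>, but its antiderivative -\<rho> (1 -
  x/\<rho>)^m is continuous up to the end. The resulting mass tends to \<rho> as m tends to 0, for
  every \<eta>.\<close>

lemma powr_density_lborel:
  fixes \<eta> \<rho> m :: real
  assumes "0 \<le> \<eta>" "\<eta> < \<rho>" "m > 0"
  shows "set_integrable lborel {\<eta><..<\<rho>} (\<lambda>x. m * (1 - x / \<rho>) powr (m - 1))"
    and "(LINT x:{\<eta><..<\<rho>}|lborel. m * (1 - x / \<rho>) powr (m - 1)) = \<rho> * (1 - \<eta> / \<rho>) powr m"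
proof -
  have rho: "\<rho> > 0" using assms by simp
  have "((\<lambda>x. m * (1 - x / \<rho>) powr (m - 1)) has_integral (- \<rho> * (1 - \<rho> / \<rho>) powr m - (- \<rho> * (1 - \<eta> / \<rho>) powr m))) {\<eta>..\<rho>}"
  proof (rule fundamental_theorem_of_calculus_interior)
    show "continuous_on {\<eta>..\<rho>} (\<lambda>x. - \<rho> * (1 - x / \<rho>) powr m)"
      using rho assms by (intro continuous_intros continuous_on_powr') auto
    fix x assume "x \<in> {\<eta><..<\<rho>}"
    then have "1 - x / \<rho> > 0" using rho by simp
    then show "((\<lambda>x. - \<rho> * (1 - x / \<rho>) powr m) has_vector_derivative m * (1 - x / \<rho>) powr (m - 1)) (at x)"
      unfolding has_real_derivative_iff_has_vector_derivative[symmetric]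
      using rho by (auto intro!: derivative_eq_intros simp: powr_diff field_simps)
  qed (use assms in auto)
  then have *: "((\<lambda>x. m * (1 - x / \<rho>) powr (m - 1)) has_integral \<rho> * (1 - \<eta> / \<rho>) powr m) {\<eta>..\<rho>}"
    using rho assms by simp
  have meas: "(\<lambda>x. m * (1 - x / \<rho>) powr (m - 1)) \<in> borel_measurable borel" by measurable
  show "set_integrable lborel {\<eta><..<\<rho>} (\<lambda>x. m * (1 - x / \<rho>) powr (m - 1))"
    unfolding Icc_Ioo_lborel(1)[symmetric] using assms by (intro has_integral_nonneg_lborel[OF * _ meas]) auto
  show "(LINT x:{\<eta><..<\<rho>}|lborel. m * (1 - x / \<rho>) powr (m - 1)) = \<rho> * (1 - \<eta> / \<rho>) powr m"
    unfolding Icc_Ioo_lborel(2)[symmetric] using assms by (intro has_integral_nonneg_lborel[OF * _ meas]) auto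
qed

lemma set_integrable_mult_bounded:
  fixes h :: "real \<Rightarrow> real" and w :: "real \<Rightarrow> 'b::{banach, second_countable_topology, real_normed_algebra_1}"
  assumes "set_integrable lborel S w" "h \<in> borel_measurable borel" "\<And>x. \<bar>h x\<bar> \<le> K"
  shows "set_integrable lborel S (\<lambda>x. of_real (h x) * w x)"
proof -
  have w: "integrable lborel (\<lambda>x. indicator S x *\<^sub>R w x)" using assms(1) by (simp add: set_integrable_def)
  have "integrable lborel (\<lambda>x. h x *\<^sub>R (indicator S x *\<^sub>R w x))"
  proof (rule Bochner_Integration.integrable_bound[OF integrable_norm[OF integrable_scaleR_right[OF w, of K]]])
    show "(\<lambda>x. h x *\<^sub>R (indicator S x *\<^sub>R w x)) \<in> borel_measurable lborel"
      using assms(2) borel_measurable_integrable[OF w] by measurable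
    show "AE x in lborel. norm (h x *\<^sub>R (indicator S x *\<^sub>R w x)) \<le> norm (norm (K *\<^sub>R (indicator S x *\<^sub>R w x)))"
      by (intro AE_I2) (auto simp: abs_mult indicator_def intro!: mult_right_mono order_trans[OF assms(3) abs_ge_self])
  qed
  moreover have "h x *\<^sub>R (indicator S x *\<^sub>R w x) = indicator S x *\<^sub>R (of_real (h x) * w x)" for x
    by (simp add: scaleR_conv_of_real[symmetric] mult.commute)
  ultimately show ?thesis by (simp add: set_integrable_def)
qed

text \<open>Since \<open>rGamma m = m * rGamma (m + 1)\<close>, the kernel is essentially the
  density of \<open>powr_density_lborel\<close>. Its mass tends to \<rho>, and its first moment
  about \<rho> tends to 0, so only the value of h at \<rho> survives.\<close>

lemma powr_density_tendsto:
  fixes h :: "real \<Rightarrow> real" and m :: "nat \<Rightarrow> real"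
  assumes \<eta>: "0 \<le> \<eta>" "\<eta> < \<rho>" and h: "continuous_on UNIV h" "\<And>x. \<bar>h x\<bar> \<le> K"
    and m: "\<And>n. m n > 0" "m \<longlonglongrightarrow> 0"
  shows "(\<lambda>n. LINT x:{\<eta><..<\<rho>}|lborel. h x * ((1 - x / \<rho>) powr (m n - 1) * rGamma (m n))) \<longlonglongrightarrow> \<rho> * h \<rho>"
proof -
  define w where "w n x = m n * (1 - x / \<rho>) powr (m n - 1)" for n x
  let ?I = "{\<eta><..<\<rho>}"
  have rho: "\<rho> > 0" and base: "0 < 1 - \<eta> / \<rho>" "1 - \<eta> / \<rho> \<le> 1" using \<eta> by auto
  have meas: "h \<in> borel_measurable borel" using h(1) by (rule borel_measurable_continuous_onI)
  have wi: "set_integrable lborel ?I (w n)" and wv: "(LINT x:?I|lborel. w n x) = \<rho> * (1 - \<eta> / \<rho>) powr m n" for n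
    unfolding w_def using powr_density_lborel[OF \<eta> m(1)] by auto
  have hw: "set_integrable lborel ?I (\<lambda>x. h x * w n x)" for n
    using set_integrable_mult_bounded[OF wi meas h(2)] by simp
  have wlim: "(\<lambda>n. LINT x:?I|lborel. w n x) \<longlonglongrightarrow> \<rho>"
  proof -
    have "(\<lambda>n. \<rho> * (1 - \<eta> / \<rho>) powr m n) \<longlonglongrightarrow> \<rho> * (1 - \<eta> / \<rho>) powr 0"
      using base by (intro tendsto_intros m) auto
    then show ?thesis using \<eta> unfolding wv by simp
  qed
  have close: "(\<lambda>n. (LINT x:?I|lborel. h x * w n x) - h \<rho> * (LINT x:?I|lborel. w n x)) \<longlonglongrightarrow> 0"
  proof (rule LIMSEQ_I)
    fix r :: real assume r: "r > 0"
    define \<epsilon> where "\<epsilon> = r / (2 * \<rho>)"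
    have \<epsilon>: "\<epsilon> > 0" using r rho by (simp add: \<epsilon>_def)
    obtain d where d: "d > 0" "\<And>x. \<bar>x - \<rho>\<bar> < d \<Longrightarrow> \<bar>h x - h \<rho>\<bar> < \<epsilon>"
      using h(1) \<epsilon> unfolding continuous_on_iff by (auto simp: dist_real_def) metis
    have K: "K \<ge> 0" using h(2)[of 0] by simp
    \<comment> \<open>With this slope the linear function Q (1 - x/\<rho>) reaches 2K at distance d
      from \<rho>; it dominates the oscillation of h beyond d, and no splitting of the integral is
      necessary.\<close>
    define Q where "Q = 2 * K * \<rho> / d"
    have Q: "Q \<ge> 0" using K rho d by (simp add: Q_def)
    have hb: "\<bar>h x - h \<rho>\<bar> \<le> \<epsilon> + Q * (1 - x / \<rho>)" if "x \<in> ?I" for x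
    proof (cases "\<rho> - x < d")
      case True
      then have "\<bar>h x - h \<rho>\<bar> < \<epsilon>" using that by (intro d) auto
      moreover have "0 \<le> Q * (1 - x / \<rho>)" using Q that rho by (intro mult_nonneg_nonneg) auto
      ultimately show ?thesis by simp
    next
      case False
      have "\<bar>h x - h \<rho>\<bar> \<le> 2 * K" using h(2)[of x] h(2)[of \<rho>] by linarith
      also have "2 * K = Q * (d / \<rho>)" using d rho by (simp add: Q_def)
      also have "\<dots> \<le> Q * (1 - x / \<rho>)" using False rho Q by (intro mult_left_mono) (auto simp: field_simps)
      finally show ?thesis using \<epsilon> by simp
    qed
    \<comment> \<open>Multiplying by 1 - x/\<rho> gives the density for m + 1 with the small factor
      m / (m + 1); this is why the first moment vanishes in the limit.\<close>
    have w2: "(1 - x / \<rho>) * w n x = m n / (m n + 1) * ((m n + 1) * (1 - x / \<rho>) powr (m n + 1 - 1))" if "x \<in> ?I" for x n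
    proof -
      have b: "1 - x / \<rho> > 0" using that rho by simp
      have "(1 - x / \<rho>) * (1 - x / \<rho>) powr (m n - 1) = (1 - x / \<rho>) powr (m n)"
        using b by (simp add: powr_diff)
      then show ?thesis using m(1)[of n] by (simp add: w_def)
    qed
    have m1: "m n + 1 > 0" for n using m(1)[of n] by simp
    have w2i: "set_integrable lborel ?I (\<lambda>x. (1 - x / \<rho>) * w n x)" for n
    proof -
      have "set_integrable lborel ?I (\<lambda>x. m n / (m n + 1) * ((m n + 1) * (1 - x / \<rho>) powr (m n + 1 - 1)))"
        by (intro set_integrable_mult_right powr_density_lborel \<eta> m1)
      then show ?thesis using w2 by (subst set_integrable_cong[OF refl refl w2]) auto
    qed
    have w2v: "(LINT x:?I|lborel. (1 - x / \<rho>) * w n x) \<le> m n * \<rho>" for n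
    proof -
      have "(LINT x:?I|lborel. (1 - x / \<rho>) * w n x) = (LINT x:?I|lborel. m n / (m n + 1) * ((m n + 1) * (1 - x / \<rho>) powr (m n + 1 - 1)))"
        by (intro set_lebesgue_integral_cong allI impI w2) auto
      also have "\<dots> = m n / (m n + 1) * (\<rho> * (1 - \<eta> / \<rho>) powr (m n + 1))"
        by (subst set_integral_mult_right) (simp only: powr_density_lborel(2)[OF \<eta> m1])
      also have "\<dots> \<le> m n * (\<rho> * 1)"
      proof (intro mult_mono)
        show "m n / (m n + 1) \<le> m n" using m(1)[of n] by (simp add: field_simps)
        show "(1 - \<eta> / \<rho>) powr (m n + 1) \<le> 1" using base m1[of n] by (intro powr_le1) auto
      qed (use m(1)[of n] rho in auto)
      finally show ?thesis by simp
    qed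
    have bnd: "\<bar>(LINT x:?I|lborel. h x * w n x) - h \<rho> * (LINT x:?I|lborel. w n x)\<bar> \<le> r / 2 + Q * \<rho> * m n" for n
    proof -
      have "(LINT x:?I|lborel. h x * w n x) - h \<rho> * (LINT x:?I|lborel. w n x) = (LINT x:?I|lborel. h x * w n x - h \<rho> * w n x)"
        using hw wi by (simp add: set_integral_diff)
      also have "\<bar>\<dots>\<bar> \<le> (LINT x:?I|lborel. \<epsilon> * w n x + Q * ((1 - x / \<rho>) * w n x))"
        unfolding set_lebesgue_integral_def
      proof (rule integral_abs_bound_integral)
        show "integrable lborel (\<lambda>x. indicator ?I x *\<^sub>R (h x * w n x - h \<rho> * w n x))"
          using set_integral_diff(1)[OF hw set_integrable_mult_right[OF wi]] by (simp add: set_integrable_def)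
        show "integrable lborel (\<lambda>x. indicator ?I x *\<^sub>R (\<epsilon> * w n x + Q * ((1 - x / \<rho>) * w n x)))"
          using set_integral_add(1)[OF set_integrable_mult_right[OF wi] set_integrable_mult_right[OF w2i]] by (simp add: set_integrable_def)
        fix x
        show "\<bar>indicator ?I x *\<^sub>R (h x * w n x - h \<rho> * w n x)\<bar> \<le> indicator ?I x *\<^sub>R (\<epsilon> * w n x + Q * ((1 - x / \<rho>) * w n x))"
        proof (cases "x \<in> ?I")
          case True
          have "w n x \<ge> 0" using m(1)[of n] by (simp add: w_def)
          then have "\<bar>h x - h \<rho>\<bar> * w n x \<le> (\<epsilon> + Q * (1 - x / \<rho>)) * w n x"
            by (intro mult_right_mono hb True)
          then show ?thesis using True \<open>w n x \<ge> 0\<close> by (simp add: left_diff_distrib[symmetric] abs_mult) (simp add: algebra_simps)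
        qed simp
      qed
      also have "\<dots> = \<epsilon> * (LINT x:?I|lborel. w n x) + Q * (LINT x:?I|lborel. (1 - x / \<rho>) * w n x)"
        using set_integral_add(2)[OF set_integrable_mult_right[OF wi] set_integrable_mult_right[OF w2i]] by simp
      also have "\<dots> \<le> \<epsilon> * \<rho> + Q * (m n * \<rho>)"
      proof (intro add_mono mult_left_mono w2v)
        have "(1 - \<eta> / \<rho>) powr m n \<le> 1" using base m(1)[of n] by (intro powr_le1) auto
        then show "(LINT x:?I|lborel. w n x) \<le> \<rho>" unfolding wv using rho by simp
      qed (use \<epsilon> Q in auto)
      also have "\<epsilon> * \<rho> = r / 2" using rho by (simp add: \<epsilon>_def)
      finally show ?thesis by (simp add: mult_ac)
    qed
    have "(\<lambda>n. Q * \<rho> * m n) \<longlonglongrightarrow> Q * \<rho> * 0" by (intro tendsto_intros m)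
    then have "\<forall>\<^sub>F n in sequentially. Q * \<rho> * m n < r / 2" using r by (intro order_tendstoD) auto
    then obtain N where N: "\<And>n. n \<ge> N \<Longrightarrow> Q * \<rho> * m n < r / 2" by (auto simp: eventually_sequentially)
    show "\<exists>N. \<forall>n\<ge>N. norm ((LINT x:?I|lborel. h x * w n x) - h \<rho> * (LINT x:?I|lborel. w n x) - 0) < r"
    proof (intro exI allI impI)
      fix n assume "n \<ge> N"
      then show "norm ((LINT x:?I|lborel. h x * w n x) - h \<rho> * (LINT x:?I|lborel. w n x) - 0) < r"
        using bnd[of n] N[of n] by simp
    qed
  qed
  have "(\<lambda>n. (LINT x:?I|lborel. h x * w n x) - h \<rho> * (LINT x:?I|lborel. w n x) + h \<rho> * (LINT x:?I|lborel. w n x)) \<longlonglongrightarrow> 0 + h \<rho> * \<rho>"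
    by (intro tendsto_add close tendsto_mult tendsto_const wlim)
  then have l: "(\<lambda>n. LINT x:?I|lborel. h x * w n x) \<longlonglongrightarrow> h \<rho> * \<rho>" by simp
  have "isCont (\<lambda>z::real. rGamma (z + 1)) 0" by (intro continuous_intros)
  then have "(\<lambda>n. rGamma (m n + 1)) \<longlonglongrightarrow> rGamma (0 + 1)"
    by (rule isCont_tendsto_compose) (rule m)
  from tendsto_mult[OF this l] have "(\<lambda>n. rGamma (m n + 1) * (LINT x:?I|lborel. h x * w n x)) \<longlonglongrightarrow> h \<rho> * \<rho>" by simp
  moreover have "rGamma (m n + 1) * (LINT x:?I|lborel. h x * w n x) = (LINT x:?I|lborel. h x * ((1 - x / \<rho>) powr (m n - 1) * rGamma (m n)))" for n
  proof -
    have "rGamma (m n) = m n * rGamma (m n + 1)" by (simp add: rGamma_plus1)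
    then have "h x * ((1 - x / \<rho>) powr (m n - 1) * rGamma (m n)) = rGamma (m n + 1) * (h x * w n x)" for x
      by (simp add: w_def)
    then show ?thesis by (simp only: set_integral_mult_right)
  qed
  ultimately show ?thesis by (simp add: mult.commute)
qed

text \<open>The majorant of the smooth part: |x^(-s)| on Re s = 1/2. It is integrable even for
  \<eta> = 0.\<close>

lemma inverse_sqrt_set_integrable:
  fixes \<eta> \<rho> :: real
  assumes "0 \<le> \<eta>" "\<eta> < \<rho>"
  shows "set_integrable lborel {\<eta><..<\<rho>} (\<lambda>x. x powr (-1/2))"
proof -
  have "((\<lambda>x. x powr (-1/2)) has_integral (\<rho> powr (-1/2 + 1) / (-1/2 + 1))) {0..\<rho>}"
    using assms by (intro has_integral_powr_from_0) auto
  then have "set_integrable lborel {0..\<rho>} (\<lambda>x. x powr (-1/2))"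
    by (rule has_integral_nonneg_lborel) auto
  then show ?thesis by (rule set_integrable_subset) (use assms in auto)
qed

section \<open>Weak convergence\<close>

lemma set_integrable_complex_of_real:
  assumes "set_integrable M S f"
  shows "set_integrable M S (\<lambda>x. complex_of_real (f x))"
proof -
  have "integrable M (\<lambda>x. complex_of_real (indicator S x *\<^sub>R f x))"
    using assms unfolding set_integrable_def by (rule integrable_of_real)
  then show ?thesis by (simp add: set_integrable_def scaleR_conv_of_real)
qed

section \<open>Measurability and continuity of the smooth part\<close>

context
  fixes A :: "real^'p" and B :: "real^'q"
  assumes Apos: "\<forall>k. A$k > 0" and Bpos: "\<forall>j. B$j > 0"
begin

lemma fox_rem_vertical_measurable:
  fixes a :: "real^'p" and b :: "real^'q"
  assumes "\<forall>k. a$k \<ge> 0"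
  shows "(\<lambda>t. fox_rem A B a b (Complex (1/2) t)) \<in> borel_measurable borel"
proof -
  have "continuous_on UNIV (\<lambda>t. fox_rem A B a b (Complex (1/2) t))"
  proof -
    have c: "continuous_on UNIV (\<lambda>t::real. ((a, b), t))" by (intro continuous_intros)
    have r: "range (\<lambda>t::real. ((a, b), t)) \<subseteq> {(a, b)} \<times> UNIV" by auto
    show ?thesis
      using assms continuous_on_compose2[OF continuous_on_fox_rem[OF Apos Bpos, of "{(a, b)} \<times> UNIV"] c r] by force
  qed
  then show ?thesis by (rule borel_measurable_continuous_onI)
qed

lemma fox_smooth_integrand_measurable:
  fixes a :: "real^'p" and b :: "real^'q"
  assumes "\<forall>k. a$k \<ge> 0"
  shows "(\<lambda>(x, t). fox_rem A B a b (Complex (1/2) t) * exp (- Complex (1/2) t * of_real (ln x))) \<in> borel_measurable (borel \<Otimes>\<^sub>M lborel)"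
proof -
  have 1: "(\<lambda>z. fox_rem A B a b (Complex (1/2) (snd z))) \<in> borel_measurable (borel \<Otimes>\<^sub>M lborel)"
    using fox_rem_vertical_measurable[OF assms] by (intro measurable_compose[OF measurable_snd]) simp
  have "(\<lambda>z. - Complex (1/2) (snd z) * of_real (ln (fst z))) \<in> borel_measurable (borel \<Otimes>\<^sub>M lborel)"
    unfolding Complex_eq by measurable
  moreover have "(exp :: complex \<Rightarrow> complex) \<in> borel_measurable borel"
    by (intro borel_measurable_continuous_onI continuous_intros)
  ultimately have "(\<lambda>z. exp (- Complex (1/2) (snd z) * of_real (ln (fst z)))) \<in> borel_measurable (borel \<Otimes>\<^sub>M lborel)"
    by (rule measurable_compose)
  from borel_measurable_times[OF 1 this] show ?thesis by (simp add: split_def)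
qed

lemma fox_smooth_measurable:
  fixes a :: "real^'p" and b :: "real^'q"
  assumes "\<forall>k. a$k \<ge> 0"
  shows "fox_smooth A B a b \<in> borel_measurable borel"
proof -
  have "(\<lambda>x. LINT t|lborel. fox_rem A B a b (Complex (1/2) t) * exp (- Complex (1/2) t * of_real (ln x))) \<in> borel_measurable borel"
    using lborel.borel_measurable_lebesgue_integral[OF fox_smooth_integrand_measurable[OF assms]] .
  then show ?thesis unfolding fox_smooth_def[abs_def] by measurable
qed

context
  fixes M D :: real
  assumes D: "\<And>a b t. norm (a, b) \<le> M \<Longrightarrow> (\<forall>k. a$k \<ge> 0) \<Longrightarrow> fox_mu a b \<ge> 0 \<Longrightarrow>
      norm (fox_rem A B a b (Complex (1/2) t)) \<le> D / (1 + t^2)"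
begin

lemma fox_smooth_integrand_bound:
  fixes a :: "real^'p" and b :: "real^'q"
  assumes "norm (a, b) \<le> M" "\<forall>k. a$k \<ge> 0" "fox_mu a b \<ge> 0" "x > 0"
  shows "norm (fox_rem A B a b (Complex (1/2) t) * exp (- Complex (1/2) t * of_real (ln x))) \<le> x powr (-1/2) * D * (1 / (1 + t^2))"
proof -
  have "norm (exp (- Complex (1/2) t * of_real (ln x))) = x powr (-1/2)"
    using assms by (simp add: norm_exp_eq_Re powr_def)
  then show ?thesis
    using mult_right_mono[OF D[OF assms(1-3), of t], of "x powr (-1/2)"] by (simp add: norm_mult mult_ac)
qed

lemma fox_smooth_bound:
  fixes a :: "real^'p" and b :: "real^'q"
  assumes "norm (a, b) \<le> M" "\<forall>k. a$k \<ge> 0" "fox_mu a b \<ge> 0" "x > 0"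
  shows "norm (fox_smooth A B a b x) \<le> x powr (-1/2) * (D * (LINT t|lborel. 1 / (1 + t^2)) / (2 * pi))"
proof -
  have "norm (LINT t|lborel. fox_rem A B a b (Complex (1/2) t) * exp (- Complex (1/2) t * of_real (ln x)))
      \<le> (LINT t|lborel. x powr (-1/2) * D * (1 / (1 + t^2)))"
  proof (rule Bochner_Integration.integral_norm_bound_integral)
    show 1: "integrable lborel (\<lambda>t. x powr (-1/2) * D * (1 / (1 + t^2)))"
      by (intro integrable_mult_right integrable_inverse_one_plus_square)
    have "(\<lambda>t. fox_rem A B a b (Complex (1/2) t) * exp (- Complex (1/2) t * of_real (ln x))) \<in> borel_measurable lborel"
      using measurable_compose[OF measurable_Pair1' fox_smooth_integrand_measurable[OF assms(2)], of x] by simp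
    then show "integrable lborel (\<lambda>t. fox_rem A B a b (Complex (1/2) t) * exp (- Complex (1/2) t * of_real (ln x)))"
      by (rule Bochner_Integration.integrable_bound[OF 1])
         (intro AE_I2 order_trans[OF fox_smooth_integrand_bound[OF assms]], simp only: real_norm_def abs_ge_self)
  qed (use fox_smooth_integrand_bound[OF assms] in auto)
  also have "(LINT t|lborel. x powr (-1/2) * D * (1 / (1 + t^2))) = x powr (-1/2) * D * (LINT t|lborel. 1 / (1 + t^2))"
    by (rule integral_mult_right_zero)
  finally show ?thesis
    unfolding fox_smooth_def norm_divide by (simp add: divide_right_mono mult.assoc)
qed

text \<open>Dominated convergence in t: the bound D is shared by all members of the sequence, and
  the integrand converges pointwise by joint continuity of the remainder.\<close>

lemma fox_smooth_tendsto:
  fixes X :: "nat \<Rightarrow> (real^'p) \<times> (real^'q)" and a :: "real^'p" and b :: "real^'q"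
  assumes X: "\<And>n. norm (X n) \<le> M" "\<And>n. \<forall>k. fst (X n) $ k \<ge> 0" "\<And>n. fox_mu (fst (X n)) (snd (X n)) \<ge> 0"
    and lim: "X \<longlonglongrightarrow> (a, b)" and a: "\<forall>k. a$k \<ge> 0" and x: "x > 0"
  shows "(\<lambda>n. fox_smooth A B (fst (X n)) (snd (X n)) x) \<longlonglongrightarrow> fox_smooth A B a b x"
  unfolding fox_smooth_def
proof (intro tendsto_divide tendsto_const integral_dominated_convergence)
  show "integrable lborel (\<lambda>t. x powr (-1/2) * D * (1 / (1 + t^2)))"
    by (intro integrable_mult_right integrable_inverse_one_plus_square)
  have meas: "(\<lambda>t. fox_rem A B a b (Complex (1/2) t) * exp (- Complex (1/2) t * of_real (ln x))) \<in> borel_measurable lborel"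
    if "\<forall>k. a$k \<ge> 0" for a :: "real^'p" and b :: "real^'q"
    using measurable_compose[OF measurable_Pair1' fox_smooth_integrand_measurable[OF that], of x] by simp
  show "(\<lambda>t. fox_rem A B a b (Complex (1/2) t) * exp (- Complex (1/2) t * of_real (ln x))) \<in> borel_measurable lborel"
    "(\<lambda>t. fox_rem A B (fst (X n)) (snd (X n)) (Complex (1/2) t) * exp (- Complex (1/2) t * of_real (ln x))) \<in> borel_measurable lborel" for n
    by (intro meas a X(2))+
  show "AE t in lborel. norm (fox_rem A B (fst (X n)) (snd (X n)) (Complex (1/2) t) * exp (- Complex (1/2) t * of_real (ln x)))
      \<le> x powr (-1/2) * D * (1 / (1 + t^2))" for n
    by (intro AE_I2 fox_smooth_integrand_bound x) (use X in auto)
  show "AE t in lborel. (\<lambda>n. fox_rem A B (fst (X n)) (snd (X n)) (Complex (1/2) t) * exp (- Complex (1/2) t * of_real (ln x)))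
      \<longlonglongrightarrow> fox_rem A B a b (Complex (1/2) t) * exp (- Complex (1/2) t * of_real (ln x))"
  proof (intro AE_I2 tendsto_mult tendsto_const)
    fix t :: real
    define S where "S = {x :: (real^'p) \<times> (real^'q). \<forall>k. fst x $ k \<ge> 0} \<times> (UNIV :: real set)"
    have "continuous_on S (\<lambda>x. fox_rem A B (fst (fst x)) (snd (fst x)) (Complex (1/2) (snd x)))"
      by (rule continuous_on_fox_rem[OF Apos Bpos]) (auto simp: S_def)
    moreover have "(\<lambda>n. (X n, t)) \<longlonglongrightarrow> ((a, b), t)" by (intro tendsto_intros lim)
    moreover have "((a, b), t) \<in> S" "\<forall>\<^sub>F n in sequentially. (X n, t) \<in> S" using a X(2) by (auto simp: S_def)
    ultimately have "(\<lambda>n. fox_rem A B (fst (fst (X n, t))) (snd (fst (X n, t))) (Complex (1/2) (snd (X n, t))))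
        \<longlonglongrightarrow> fox_rem A B (fst (fst ((a, b), t))) (snd (fst ((a, b), t))) (Complex (1/2) (snd ((a, b), t)))"
      by (rule continuous_on_tendsto_compose)
    then show "(\<lambda>n. fox_rem A B (fst (X n)) (snd (X n)) (Complex (1/2) t)) \<longlonglongrightarrow> fox_rem A B a b (Complex (1/2) t)" by simp
  qed
qed auto

end

end

lemma fox_smooth_set_integrable:
  fixes A a :: "real^'p" and B b :: "real^'q"
  assumes Apos: "\<forall>k. A$k > 0" and Bpos: "\<forall>j. B$j > 0"
    and balance: "(\<Sum>j\<in>UNIV. B$j) - (\<Sum>k\<in>UNIV. A$k) = 0"
    and a: "\<forall>k. a$k \<ge> 0" and mu: "fox_mu a b \<ge> 0" and \<eta>: "0 \<le> \<eta>" "\<eta> < \<rho>"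
  shows "set_integrable lborel {\<eta><..<\<rho>} (fox_smooth A B a b)"
proof -
  obtain D where D: "D > 0" "\<And>a' b' t. norm (a', b') \<le> norm (a, b) \<Longrightarrow> (\<forall>k. a'$k \<ge> 0) \<Longrightarrow> fox_mu a' b' \<ge> 0 \<Longrightarrow>
      norm (fox_rem A B a' b' (Complex (1/2) t)) \<le> D / (1 + t^2)"
    using fox_rem_vertical_bound[OF Apos Bpos balance, of "norm (a, b)"] by blast
  define E where "E = D * (LINT t|lborel. 1 / (1 + t^2)) / (2 * pi)"
  have "set_integrable lborel {\<eta><..<\<rho>} (\<lambda>x. x powr (-1/2) * E)"
    by (intro set_integrable_mult_left inverse_sqrt_set_integrable \<eta>)
  then show ?thesis unfolding set_integrable_def
  proof (rule Bochner_Integration.integrable_bound)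
    show "(\<lambda>x. indicator {\<eta><..<\<rho>} x *\<^sub>R fox_smooth A B a b x) \<in> borel_measurable lborel"
      using fox_smooth_measurable[OF Apos Bpos a, of b] by measurable
    show "AE x in lborel. norm (indicator {\<eta><..<\<rho>} x *\<^sub>R fox_smooth A B a b x) \<le> norm (indicator {\<eta><..<\<rho>} x *\<^sub>R (x powr (-1/2) * E))"
    proof (rule AE_I2)
      fix x
      show "norm (indicator {\<eta><..<\<rho>} x *\<^sub>R fox_smooth A B a b x) \<le> norm (indicator {\<eta><..<\<rho>} x *\<^sub>R (x powr (-1/2) * E))"
      proof (cases "x \<in> {\<eta><..<\<rho>}")
        case True
        then have "norm (fox_smooth A B a b x) \<le> x powr (-1/2) * E"
          unfolding E_def using \<eta> by (intro fox_smooth_bound[OF Apos Bpos D(2) order_refl a mu]) auto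
        also have "\<dots> \<le> norm (x powr (-1/2) * E)" by (simp only: real_norm_def abs_ge_self)
        finally show ?thesis using True by (simp only: indicator_simps scaleR_one)
      qed simp
    qed
  qed
qed

section \<open>Passage to the limit along sequences\<close>

lemma fox_weak_limit_sequentially:
  fixes A as :: "real^'p" and B bs :: "real^'q" and f :: "real \<Rightarrow> real"
    and X :: "nat \<Rightarrow> (real^'p) \<times> (real^'q)"
  assumes Apos: "\<forall>k. A$k > 0" and Bpos: "\<forall>j. B$j > 0"
    and balance: "(\<Sum>j\<in>UNIV. B$j) - (\<Sum>k\<in>UNIV. A$k) = 0"
    and mu0: "fox_mu as bs = 0"
    and eta: "0 \<le> \<eta>" "\<eta> < fox_rho A B"
    and f: "continuous_on {\<eta>..fox_rho A B} f"
    and X: "\<And>n k. fst (X n) $ k \<ge> 0" "\<And>n. fox_mu (fst (X n)) (snd (X n)) > 0"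
    and lim: "X \<longlonglongrightarrow> (as, bs)"
  shows "(\<lambda>n. LINT x:{\<eta>..fox_rho A B}|lborel. of_real (f x) * fox_H A B (fst (X n)) (snd (X n)) x)
    \<longlonglongrightarrow> of_real (fox_nu A B as bs * fox_rho A B * f (fox_rho A B))
       + (LINT x:{\<eta>..fox_rho A B}|lborel. of_real (f x) * fox_H A B as bs x)"
proof -
  define \<rho> where "\<rho> = fox_rho A B"
  have \<eta>: "0 \<le> \<eta>" "\<eta> < \<rho>" using eta by (auto simp: \<rho>_def)
  have rho: "\<rho> > 0" using \<eta> by simp
  let ?I = "{\<eta><..<\<rho>}"
  \<comment> \<open>Clamping extends f from the interval to a bounded continuous function on the
    line; the factor y of the beta density is moved into the test function h, which still has the
    value f \<rho> at \<rho>.\<close>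
  define cl where "cl x = max \<eta> (min \<rho> x)" for x
  define u where "u x = f (cl x)" for x
  define h where "h x = u x * (cl x / \<rho>)" for x
  have cl: "cl x \<in> {\<eta>..\<rho>}" for x using \<eta> by (auto simp: cl_def)
  have clI: "cl x = x" if "x \<in> {\<eta>..\<rho>}" for x using that by (auto simp: cl_def)
  have ccl: "continuous_on UNIV cl" unfolding cl_def by (intro continuous_intros)
  have uc: "continuous_on UNIV u"
    unfolding u_def using f cl by (intro continuous_on_compose2[OF _ ccl]) (auto simp: \<rho>_def)
  have hc: "continuous_on UNIV h" unfolding h_def using rho by (intro continuous_intros uc ccl) auto
  have "bounded (f ` {\<eta>..\<rho>})" using f by (intro compact_imp_bounded compact_continuous_image) (auto simp: \<rho>_def)
  then obtain K where K: "K > 0" "\<And>x. x \<in> {\<eta>..\<rho>} \<Longrightarrow> \<bar>f x\<bar> \<le> K" unfolding bounded_pos by auto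
  have ub: "\<bar>u x\<bar> \<le> K" for x unfolding u_def by (intro K cl)
  have hb: "\<bar>h x\<bar> \<le> K" for x
  proof -
    have "0 \<le> cl x / \<rho>" "cl x / \<rho> \<le> 1" using cl[of x] rho \<eta> by auto
    then show ?thesis using mult_mono[OF ub[of x], of "\<bar>cl x / \<rho>\<bar>" 1] K by (simp add: h_def abs_mult)
  qed
  have um: "u \<in> borel_measurable borel" and hm: "h \<in> borel_measurable borel"
    using uc hc by (auto intro: borel_measurable_continuous_onI)
  have h\<rho>: "h \<rho> = f \<rho>" using \<eta> rho clI[of \<rho>] by (simp add: h_def u_def)
  define P where "P \<mu> = (LINT x:?I|lborel. h x * ((1 - x / \<rho>) powr (\<mu> - 1) * rGamma \<mu>))" for \<mu>
  define V where "V a b = (LINT x:?I|lborel. of_real (u x) * fox_smooth A B a b x)" for a b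
  have Pi: "set_integrable lborel ?I (\<lambda>x. h x * ((1 - x / \<rho>) powr (\<mu> - 1) * rGamma \<mu>))" if "\<mu> \<ge> 0" for \<mu>
  proof (cases "\<mu> = 0")
    case False
    then have m: "\<mu> > 0" using that by simp
    have "set_integrable lborel ?I (\<lambda>x. of_real (h x) * (rGamma \<mu> / \<mu> * (\<mu> * (1 - x / \<rho>) powr (\<mu> - 1))))"
      by (intro set_integrable_mult_bounded[OF _ hm hb] set_integrable_mult_right powr_density_lborel \<eta> m)
    then show ?thesis using m by (simp add: mult_ac)
  qed (simp add: set_integrable_def)
  have main: "(LINT x:{\<eta>..\<rho>}|lborel. of_real (f x) * fox_H A B a b x) =
      of_real (fox_nu A B a b * P (fox_mu a b)) + of_real (fox_nu A B a b * fox_corr A B a b * P (fox_mu a b + 1)) + V a b"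
    if a: "\<forall>k. a$k \<ge> 0" and mu: "fox_mu a b \<ge> 0" for a :: "real^'p" and b :: "real^'q"
  proof -
    define p where "p \<mu> x = h x * ((1 - x / \<rho>) powr (\<mu> - 1) * rGamma \<mu>)" for \<mu> x
    have eq: "of_real (f x) * fox_H A B a b x = of_real (fox_nu A B a b * p (fox_mu a b) x)
        + of_real (fox_nu A B a b * fox_corr A B a b * p (fox_mu a b + 1) x) + of_real (u x) * fox_smooth A B a b x"
      if "x \<in> ?I" for x
    proof -
      have x: "0 < x" "x < fox_rho A B" using that \<eta> by (auto simp: \<rho>_def)
      have "u x = f x" "h x = f x * (x / \<rho>)" using that clI[of x] by (auto simp: u_def h_def)
      then show ?thesis
        unfolding fox_H_eq[OF Apos Bpos balance a mu x] beta_density_def p_def \<rho>_def[symmetric]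
        by (simp add: algebra_simps)
    qed
    have mu1: "fox_mu a b + 1 \<ge> 0" using mu by simp
    have i1: "set_integrable lborel ?I (\<lambda>x. complex_of_real (fox_nu A B a b * p (fox_mu a b) x))"
      unfolding p_def by (intro set_integrable_complex_of_real set_integrable_mult_right Pi mu)
    have i2: "set_integrable lborel ?I (\<lambda>x. complex_of_real (fox_nu A B a b * fox_corr A B a b * p (fox_mu a b + 1) x))"
      unfolding p_def by (intro set_integrable_complex_of_real set_integrable_mult_right Pi mu1)
    have i3: "set_integrable lborel ?I (\<lambda>x. of_real (u x) * fox_smooth A B a b x)"
      by (intro set_integrable_mult_bounded[OF _ um ub] fox_smooth_set_integrable Apos Bpos balance a mu \<eta>)
    have "(LINT x:{\<eta>..\<rho>}|lborel. of_real (f x) * fox_H A B a b x) = (LINT x:?I|lborel. of_real (f x) * fox_H A B a b x)"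
      by (rule Icc_Ioo_lborel)
    also have "\<dots> = (LINT x:?I|lborel. of_real (fox_nu A B a b * p (fox_mu a b) x)
        + of_real (fox_nu A B a b * fox_corr A B a b * p (fox_mu a b + 1) x) + of_real (u x) * fox_smooth A B a b x)"
      by (intro set_lebesgue_integral_cong allI impI eq) auto
    also have "\<dots> = (LINT x:?I|lborel. of_real (fox_nu A B a b * p (fox_mu a b) x))
        + (LINT x:?I|lborel. of_real (fox_nu A B a b * fox_corr A B a b * p (fox_mu a b + 1) x)) + V a b"
      unfolding V_def set_integral_add(2)[OF set_integral_add(1)[OF i1 i2] i3] set_integral_add(2)[OF i1 i2] ..
    finally show ?thesis
      unfolding set_integral_complex_of_real set_integral_mult_right unfolding P_def p_def .
  qed
  define \<mu> where "\<mu> n = fox_mu (fst (X n)) (snd (X n))" for n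
  have m: "\<mu> n > 0" for n using X(2) by (simp add: \<mu>_def)
  have tend: "(\<lambda>n. F (X n)) \<longlonglongrightarrow> F (as, bs)" if "continuous_on UNIV F" for F :: "(real^'p) \<times> (real^'q) \<Rightarrow> real"
    by (rule continuous_on_tendsto_compose[OF that lim]) auto
  have mlim: "\<mu> \<longlonglongrightarrow> 0" using tend[OF continuous_on_fox_mu] mu0 by (simp add: \<mu>_def[abs_def])
  have nlim: "(\<lambda>n. fox_nu A B (fst (X n)) (snd (X n))) \<longlonglongrightarrow> fox_nu A B as bs"
    using tend[OF continuous_on_fox_nu[OF Apos Bpos]] by simp
  have glim: "(\<lambda>n. fox_corr A B (fst (X n)) (snd (X n))) \<longlonglongrightarrow> fox_corr A B as bs"
    using tend[OF continuous_on_fox_corr[OF Apos Bpos]] by simp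
  \<comment> \<open>The condition is closed, so it passes to the limit point, and
    \<open>main\<close> becomes applicable there.\<close>
  have as: "\<forall>k. as$k \<ge> 0"
  proof
    fix k
    have "(\<lambda>n. fst (X n) $ k) \<longlonglongrightarrow> fst (as, bs) $ k" by (intro tendsto_intros lim)
    then show "as$k \<ge> 0" using X(1) by (intro LIMSEQ_le_const[of _ "as$k"]) auto
  qed
  \<comment> \<open>Here the point mass arises: \<open>P\<close> is discontinuous at 0, with the
    value 0 there but the limit \<rho> f(\<rho>) from the right.\<close>
  have P1: "(\<lambda>n. P (\<mu> n)) \<longlonglongrightarrow> \<rho> * f \<rho>"
    unfolding P_def h\<rho>[symmetric] by (rule powr_density_tendsto[OF \<eta> hc hb m mlim])
  \<comment> \<open>The exponent is now \<mu> itself and not \<mu> - 1, so the integrand stays below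
    K and there is no concentration.\<close>
  have P2: "(\<lambda>n. P (\<mu> n + 1)) \<longlonglongrightarrow> P (0 + 1)"
  proof -
    have "(\<lambda>n. LINT x:?I|lborel. h x * (1 - x / \<rho>) powr \<mu> n) \<longlonglongrightarrow> (LINT x:?I|lborel. h x * (1 - x / \<rho>) powr 0)"
      unfolding set_lebesgue_integral_def
    proof (rule integral_dominated_convergence)
      show "integrable lborel (\<lambda>x. K * indicator ?I x)" using \<eta> by (intro integrable_mult_right) auto
      show "AE x in lborel. (\<lambda>n. indicator ?I x *\<^sub>R (h x * (1 - x / \<rho>) powr \<mu> n)) \<longlonglongrightarrow> indicator ?I x *\<^sub>R (h x * (1 - x / \<rho>) powr 0)"
      proof (rule AE_I2)
        fix x
        show "(\<lambda>n. indicator ?I x *\<^sub>R (h x * (1 - x / \<rho>) powr \<mu> n)) \<longlonglongrightarrow> indicator ?I x *\<^sub>R (h x * (1 - x / \<rho>) powr 0)"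
        proof (cases "x \<in> ?I")
          case True
          then have "1 - x / \<rho> \<noteq> 0" using rho by simp
          then show ?thesis by (intro tendsto_intros mlim disjI1)
        qed simp
      qed
      show "AE x in lborel. norm (indicator ?I x *\<^sub>R (h x * (1 - x / \<rho>) powr \<mu> n)) \<le> K * indicator ?I x" for n
      proof (rule AE_I2)
        fix x
        show "norm (indicator ?I x *\<^sub>R (h x * (1 - x / \<rho>) powr \<mu> n)) \<le> K * indicator ?I x"
        proof (cases "x \<in> ?I")
          case True
          have "(1 - x / \<rho>) powr \<mu> n \<le> 1" using True rho m[of n] \<eta> by (intro powr_le1) auto
          then have "\<bar>h x\<bar> * (1 - x / \<rho>) powr \<mu> n \<le> K * 1" using hb[of x] K by (intro mult_mono) auto
          then show ?thesis using True by (simp add: abs_mult)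
        qed simp
      qed
    qed (use hm in measurable)
    moreover have "(\<lambda>n. rGamma (\<mu> n + 1)) \<longlonglongrightarrow> rGamma (0 + 1)"
    proof -
      have "isCont (\<lambda>z::real. rGamma (z + 1)) 0" by (intro continuous_intros)
      then show ?thesis by (rule isCont_tendsto_compose) (rule mlim)
    qed
    ultimately have "(\<lambda>n. rGamma (\<mu> n + 1) * (LINT x:?I|lborel. h x * (1 - x / \<rho>) powr \<mu> n))
        \<longlonglongrightarrow> rGamma (0 + 1) * (LINT x:?I|lborel. h x * (1 - x / \<rho>) powr 0)" by (intro tendsto_mult)
    moreover have "P (m + 1) = rGamma (m + 1) * (LINT x:?I|lborel. h x * (1 - x / \<rho>) powr m)" for m
      unfolding P_def set_integral_mult_right[symmetric] by (simp add: mult_ac)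
    ultimately show ?thesis by (simp only:)
  qed
  have V: "(\<lambda>n. V (fst (X n)) (snd (X n))) \<longlonglongrightarrow> V as bs"
  proof -
    \<comment> \<open>A convergent sequence is bounded, which brings all its members under one
      uniform estimate of the remainder.\<close>
    obtain M where M: "\<And>n. norm (X n) \<le> M"
      using convergent_imp_Bseq[OF convergentI[OF lim]] unfolding Bseq_def by blast
    obtain D where D: "D > 0" "\<And>a' b' t. norm (a', b') \<le> M \<Longrightarrow> (\<forall>k. a'$k \<ge> 0) \<Longrightarrow> fox_mu a' b' \<ge> 0 \<Longrightarrow>
        norm (fox_rem A B a' b' (Complex (1/2) t)) \<le> D / (1 + t^2)"
      using fox_rem_vertical_bound[OF Apos Bpos balance, of M] by blast
    have X': "\<And>n. \<forall>k. fst (X n) $ k \<ge> 0" "\<And>n. fox_mu (fst (X n)) (snd (X n)) \<ge> 0"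
      using X by (auto simp: less_imp_le)
    define E where "E = D * (LINT t|lborel. 1 / (1 + t^2)) / (2 * pi)"
    show ?thesis unfolding V_def set_lebesgue_integral_def
    proof (rule integral_dominated_convergence)
      have "set_integrable lborel ?I (\<lambda>x. K * (x powr (-1/2) * E))"
        by (intro set_integrable_mult_right set_integrable_mult_left inverse_sqrt_set_integrable \<eta>)
      then show "integrable lborel (\<lambda>x. indicator ?I x *\<^sub>R (K * (x powr (-1/2) * E)))" by (simp add: set_integrable_def)
      show "AE x in lborel. (\<lambda>n. indicator ?I x *\<^sub>R (of_real (u x) * fox_smooth A B (fst (X n)) (snd (X n)) x))
          \<longlonglongrightarrow> indicator ?I x *\<^sub>R (of_real (u x) * fox_smooth A B as bs x)"
      proof (rule AE_I2)
        fix x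
        show "(\<lambda>n. indicator ?I x *\<^sub>R (of_real (u x) * fox_smooth A B (fst (X n)) (snd (X n)) x))
          \<longlonglongrightarrow> indicator ?I x *\<^sub>R (of_real (u x) * fox_smooth A B as bs x)"
        proof (cases "x \<in> ?I")
          case True
          then show ?thesis
            using \<eta> by (intro tendsto_scaleR tendsto_const tendsto_mult fox_smooth_tendsto[OF Apos Bpos D(2) M X' lim as]) auto
        qed simp
      qed
      show "AE x in lborel. norm (indicator ?I x *\<^sub>R (of_real (u x) * fox_smooth A B (fst (X n)) (snd (X n)) x))
          \<le> indicator ?I x *\<^sub>R (K * (x powr (-1/2) * E))" for n
      proof (rule AE_I2)
        fix x
        show "norm (indicator ?I x *\<^sub>R (of_real (u x) * fox_smooth A B (fst (X n)) (snd (X n)) x)) \<le> indicator ?I x *\<^sub>R (K * (x powr (-1/2) * E))"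
        proof (cases "x \<in> ?I")
          case True
          have "norm (fox_smooth A B (fst (X n)) (snd (X n)) x) \<le> x powr (-1/2) * E"
            unfolding E_def using True \<eta> M[of n] X' by (intro fox_smooth_bound[OF Apos Bpos D(2)]) auto
          then have "\<bar>u x\<bar> * norm (fox_smooth A B (fst (X n)) (snd (X n)) x) \<le> K * (x powr (-1/2) * E)"
            using ub[of x] K by (intro mult_mono) auto
          then show ?thesis using True by (simp add: norm_mult)
        qed simp
      qed
      show "(\<lambda>x. indicator ?I x *\<^sub>R (of_real (u x) * fox_smooth A B as bs x)) \<in> borel_measurable lborel"
        "(\<lambda>x. indicator ?I x *\<^sub>R (of_real (u x) * fox_smooth A B (fst (X n)) (snd (X n)) x)) \<in> borel_measurable lborel" for n
        using um fox_smooth_measurable[OF Apos Bpos as, of bs] fox_smooth_measurable[OF Apos Bpos X'(1), of n "snd (X n)"]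
        by measurable
    qed
  qed
  have "(\<lambda>n. of_real (fox_nu A B (fst (X n)) (snd (X n)) * P (\<mu> n))
      + of_real (fox_nu A B (fst (X n)) (snd (X n)) * fox_corr A B (fst (X n)) (snd (X n)) * P (\<mu> n + 1)) + V (fst (X n)) (snd (X n)))
    \<longlonglongrightarrow> of_real (fox_nu A B as bs * (\<rho> * f \<rho>)) + of_real (fox_nu A B as bs * fox_corr A B as bs * P (0 + 1)) + V as bs"
    by (intro tendsto_add tendsto_of_real tendsto_mult nlim glim P1 P2 V)
  moreover have "(LINT x:{\<eta>..\<rho>}|lborel. of_real (f x) * fox_H A B (fst (X n)) (snd (X n)) x) =
      of_real (fox_nu A B (fst (X n)) (snd (X n)) * P (\<mu> n))
      + of_real (fox_nu A B (fst (X n)) (snd (X n)) * fox_corr A B (fst (X n)) (snd (X n)) * P (\<mu> n + 1)) + V (fst (X n)) (snd (X n))" for n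
    unfolding \<mu>_def using X by (intro main) (auto simp: less_imp_le)
  \<comment> \<open>For the limit parameters \<mu> = 0 the first beta term is absent, since
    \<open>P 0\<close> is 0; the missing term is the separate point mass in the claim.\<close>
  moreover have "(LINT x:{\<eta>..\<rho>}|lborel. of_real (f x) * fox_H A B as bs x) =
      of_real (fox_nu A B as bs * fox_corr A B as bs * P (0 + 1)) + V as bs"
    using main[OF as, of bs] mu0 by (simp add: P_def set_lebesgue_integral_def)
  ultimately show ?thesis unfolding \<rho>_def[symmetric] by (simp add: add.assoc mult.assoc)
qed

theorem theorem3:
  fixes A a :: "real^'p" and B b :: "real^'q"
    and as :: "real^'p" and bs :: "real^'q"
    and \<eta> :: real
  assumes Apos: "\<forall>k. A$k > 0" and Bpos: "\<forall>j. B$j > 0"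
    and balance: "(\<Sum>j\<in>UNIV. B$j) - (\<Sum>k\<in>UNIV. A$k) = 0"
    and limpt: "(as, bs) islimpt {(a, b). (\<forall>k. a$k \<ge> 0) \<and> fox_mu a b > 0}"
    and mu0: "fox_mu as bs = 0"
    and eta: "0 \<le> \<eta>" "\<eta> < fox_rho A B"
  shows "\<forall>f :: real \<Rightarrow> real. continuous_on {\<eta>..fox_rho A B} f \<longrightarrow>
     ((\<lambda>(a, b). LINT x:{\<eta>..fox_rho A B}|lborel. of_real (f x) * fox_H A B a b x)
       \<longlongrightarrow> of_real (fox_nu A B as bs * fox_rho A B * f (fox_rho A B))
            + (LINT x:{\<eta>..fox_rho A B}|lborel. of_real (f x) * fox_H A B as bs x))
     (at (as, bs) within {(a, b). (\<forall>k. a$k \<ge> 0) \<and> fox_mu a b > 0})"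
proof (intro allI impI)
  fix f :: "real \<Rightarrow> real"
  assume f: "continuous_on {\<eta>..fox_rho A B} f"
  show "((\<lambda>(a, b). LINT x:{\<eta>..fox_rho A B}|lborel. of_real (f x) * fox_H A B a b x)
       \<longlongrightarrow> of_real (fox_nu A B as bs * fox_rho A B * f (fox_rho A B))
            + (LINT x:{\<eta>..fox_rho A B}|lborel. of_real (f x) * fox_H A B as bs x))
     (at (as, bs) within {(a, b). (\<forall>k. a$k \<ge> 0) \<and> fox_mu a b > 0})"
    \<comment> \<open>Testing along arbitrary sequences in S gives independence of the path and
      makes dominated convergence available.\<close>
    unfolding tendsto_at_iff_sequentially
  proof (intro allI impI)
    fix X :: "nat \<Rightarrow> (real^'p) \<times> (real^'q)"
    assume X: "\<forall>i. X i \<in> {(a, b). (\<forall>k. a$k \<ge> 0) \<and> fox_mu a b > 0} - {(as, bs)}" and lim: "X \<longlonglongrightarrow> (as, bs)"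
    have "fst (X n) $ k \<ge> 0" "fox_mu (fst (X n)) (snd (X n)) > 0" for n k
      using X[rule_format, of n] by (auto simp: split_def)
    from fox_weak_limit_sequentially[OF Apos Bpos balance mu0 eta f this lim]
    show "((\<lambda>(a, b). LINT x:{\<eta>..fox_rho A B}|lborel. of_real (f x) * fox_H A B a b x) \<circ> X)
       \<longlonglongrightarrow> of_real (fox_nu A B as bs * fox_rho A B * f (fox_rho A B))
            + (LINT x:{\<eta>..fox_rho A B}|lborel. of_real (f x) * fox_H A B as bs x)"
      by (simp add: o_def split_def)
  qed
qed

end
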